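(* Let $A$ and $C$ be finite-dimensional quantum systems of the same dimension $d$, and $B$ a finite-dimensional system. For any pure state $\psi_{ABC}$ such that $\rho_{AC}=\operatorname{tr}_B\psi_{ABC}$ is supported either on the symmetric or on the antisymmetric subspace of $\mathcal{H}_A\otimes\mathcal{H}_C$, we have $$S(\rho_A)\le\Delta(\psi)\le 2S(\rho_A).$$
   Context: $S$ is the von Neumann entropy (binary logarithm) and $\rho_A$ the reduced state of $\psi$ on $A$. A quantum Markov state on a tripartite system $XYZ$ is a state $\mu_{XYZ}$ for which there exist an orthogonal direct sum decomposition $\mathcal H_Y=\bigoplus_j b_j^L\otimes b_j^R$, a probability distribution $(p_j)$ and states $\mu^{(j)}_{Xb_j^L}$, $\mu^{(j)}_{b_j^RZ}$ with $\mu_{XYZ}=\bigoplus_j p_j\,\mu^{(j)}_{Xb_j^L}\otimes\mu^{(j)}_{b_j^RZ}$. $\Delta(\psi)=\inf D(\psi\|\mu)$, the infimum over all finite-dimensional systems $\widehat A\supseteq A$, $\widehat B\supseteq B$, $\widehat C\supseteq C$ (isometric embeddings, with $\psi$ regarded as a state on $\widehat A\widehat B\widehat C$) and all quantum Markov states $\mu$ on $\widehat A\widehat B\widehat C$, where $D(\rho\|\mu)=\operatorname{tr}\rho(\log\rho-\log\mu)$ is the quantum relative entropy. *)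

theory Defs
  imports "Jordan_Normal_Form.Schur_Decomposition" "HOL-Library.Extended_Real"
begin

text \<open>Finite-dimensional quantum systems are modelled concretely: a system of
dimension n is the Hilbert space of complex column vectors of length n
(JNF type complex vec), operators are complex n x n matrices. A composite
system X Y Z with dimensions dX, dY, dZ is indexed by x * dY * dZ + y * dZ + z
(the ordering used by the Kronecker product below).\<close>

definition cinner :: "complex vec \<Rightarrow> complex vec \<Rightarrow> complex" where
  "cinner v w = (\<Sum>i<dim_vec v. cnj (v $ i) * w $ i)"

definition mtrace :: "complex mat \<Rightarrow> complex" where
  "mtrace A = (\<Sum>i<dim_row A. A $$ (i, i))"

definition unitary_mat :: "nat \<Rightarrow> complex mat \<Rightarrow> bool" where
  "unitary_mat n U \<longleftrightarrow> U \<in> carrier_mat n n \<and> mat_adjoint U * U = 1\<^sub>m n"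

definition isometry_mat :: "nat \<Rightarrow> nat \<Rightarrow> complex mat \<Rightarrow> bool" where
  "isometry_mat m n V \<longleftrightarrow> V \<in> carrier_mat m n \<and> mat_adjoint V * V = 1\<^sub>m n"

definition hermitian_mat :: "complex mat \<Rightarrow> bool" where
  "hermitian_mat A \<longleftrightarrow> mat_adjoint A = A"

definition density_mat :: "nat \<Rightarrow> complex mat \<Rightarrow> bool" where
  "density_mat n \<rho> \<longleftrightarrow> \<rho> \<in> carrier_mat n n \<and> hermitian_mat \<rho> \<and>
     (\<forall>v \<in> carrier_vec n. 0 \<le> Re (cinner v (\<rho> *\<^sub>v v))) \<and> mtrace \<rho> = 1"

definition diag_cmat :: "nat \<Rightarrow> (nat \<Rightarrow> complex) \<Rightarrow> complex mat" where
  "diag_cmat n f = mat n n (\<lambda>(i,j). if i = j then f i else 0)"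

text \<open>Functional calculus for Hermitian matrices: f(A) = U diag(f(\<lambda>_i)) U^* for a
unitary diagonalisation A = U diag(\<lambda>_i) U^* with real \<lambda>_i (independent of the choice).\<close>
definition mat_fun :: "(real \<Rightarrow> real) \<Rightarrow> complex mat \<Rightarrow> complex mat" where
  "mat_fun f A = (let n = dim_row A;
     (U, lam) = (SOME (U, lam). unitary_mat n U \<and>
                   A = U * diag_cmat n (\<lambda>i. complex_of_real (lam i)) * mat_adjoint U)
   in U * diag_cmat n (\<lambda>i. complex_of_real (f (lam i))) * mat_adjoint U)"

text \<open>Binary logarithm, restricted to the support (value 0 at 0; 0 log 0 = 0).\<close>
definition log2s :: "real \<Rightarrow> real" where
  "log2s x = (if x > 0 then log 2 x else 0)"

definition vn_entropy :: "complex mat \<Rightarrow> real" where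
  "vn_entropy \<rho> = - Re (mtrace (\<rho> * mat_fun log2s \<rho>))"

definition mat_range :: "complex mat \<Rightarrow> complex vec set" where
  "mat_range M = {M *\<^sub>v v | v. v \<in> carrier_vec (dim_col M)}"

definition rel_entropy :: "complex mat \<Rightarrow> complex mat \<Rightarrow> ereal" where
  "rel_entropy \<rho> \<mu> = (if mat_range \<rho> \<subseteq> mat_range \<mu>
      then ereal (Re (mtrace (\<rho> * (mat_fun log2s \<rho> - mat_fun log2s \<mu>)))) else \<infinity>)"

definition kron :: "complex mat \<Rightarrow> complex mat \<Rightarrow> complex mat" where
  "kron A B = mat (dim_row A * dim_row B) (dim_col A * dim_col B)
     (\<lambda>(i,j). A $$ (i div dim_row B, j div dim_col B) * B $$ (i mod dim_row B, j mod dim_col B))"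

definition kron_vec :: "complex vec \<Rightarrow> complex vec \<Rightarrow> complex vec" where
  "kron_vec v w = vec (dim_vec v * dim_vec w) (\<lambda>i. v $ (i div dim_vec w) * w $ (i mod dim_vec w))"

definition ptrace_mid :: "nat \<Rightarrow> nat \<Rightarrow> nat \<Rightarrow> complex mat \<Rightarrow> complex mat" where
  "ptrace_mid d1 d2 d3 M = mat (d1 * d3) (d1 * d3) (\<lambda>(i,j).
     \<Sum>k<d2. M $$ ((i div d3) * d2 * d3 + k * d3 + i mod d3,
                   (j div d3) * d2 * d3 + k * d3 + j mod d3))"

definition proj_vec :: "complex vec \<Rightarrow> complex mat" where
  "proj_vec \<psi> = mat (dim_vec \<psi>) (dim_vec \<psi>) (\<lambda>(i,j). \<psi> $ i * cnj (\<psi> $ j))"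

definition pure_state :: "nat \<Rightarrow> complex vec \<Rightarrow> bool" where
  "pure_state n \<psi> \<longleftrightarrow> \<psi> \<in> carrier_vec n \<and> cinner \<psi> \<psi> = 1"

definition red_A :: "nat \<Rightarrow> nat \<Rightarrow> nat \<Rightarrow> complex vec \<Rightarrow> complex mat" where
  "red_A dA dB dC \<psi> = ptrace_mid dA (dB * dC) 1 (proj_vec \<psi>)"

definition red_AC :: "nat \<Rightarrow> nat \<Rightarrow> nat \<Rightarrow> complex vec \<Rightarrow> complex mat" where
  "red_AC dA dB dC \<psi> = ptrace_mid dA dB dC (proj_vec \<psi>)"

definition sym_vec :: "nat \<Rightarrow> complex vec \<Rightarrow> bool" where
  "sym_vec d v \<longleftrightarrow> v \<in> carrier_vec (d * d) \<and> (\<forall>a<d. \<forall>c<d. v $ (a * d + c) = v $ (c * d + a))"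

definition antisym_vec :: "nat \<Rightarrow> complex vec \<Rightarrow> bool" where
  "antisym_vec d v \<longleftrightarrow> v \<in> carrier_vec (d * d) \<and> (\<forall>a<d. \<forall>c<d. v $ (a * d + c) = - v $ (c * d + a))"

text \<open>Quantum Markov state on X Y Z. The orthogonal direct sum decomposition
H_Y = \<oplus>_{j<J} b_j^L \<otimes> b_j^R is given by isometries W_j : C^(l_j) \<otimes> C^(r_j) \<rightarrow> H_Y
with mutually orthogonal ranges spanning H_Y; \<sigma>_j is a state on X b_j^L and
\<tau>_j a state on b_j^R Z.\<close>
definition markov_state :: "nat \<Rightarrow> nat \<Rightarrow> nat \<Rightarrow> complex mat \<Rightarrow> bool" where
  "markov_state dX dY dZ \<mu> \<longleftrightarrow>
    (\<exists>(J::nat) (l::nat \<Rightarrow> nat) (r::nat \<Rightarrow> nat) (W::nat \<Rightarrow> complex mat) (p::nat \<Rightarrow> real)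
       (\<sigma>::nat \<Rightarrow> complex mat) (\<tau>::nat \<Rightarrow> complex mat).
      (\<forall>j<J. 0 < l j \<and> 0 < r j \<and> W j \<in> carrier_mat dY (l j * r j)) \<and>
      (\<forall>j<J. \<forall>k<J. mat_adjoint (W j) * W k =
          (if j = k then 1\<^sub>m (l j * r j) else 0\<^sub>m (l j * r j) (l k * r k))) \<and>
      (\<forall>a<dY. \<forall>b<dY. (\<Sum>j<J. (W j * mat_adjoint (W j)) $$ (a, b)) = (if a = b then 1 else 0)) \<and>
      (\<forall>j<J. 0 \<le> p j) \<and> (\<Sum>j<J. p j) = 1 \<and>
      (\<forall>j<J. density_mat (dX * l j) (\<sigma> j) \<and> density_mat (r j * dZ) (\<tau> j)) \<and>
      \<mu> = mat (dX * dY * dZ) (dX * dY * dZ) (\<lambda>(i, i').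
          \<Sum>j<J. complex_of_real (p j) *
            ((kron (kron (1\<^sub>m dX) (W j)) (1\<^sub>m dZ) * kron (\<sigma> j) (\<tau> j)
               * mat_adjoint (kron (kron (1\<^sub>m dX) (W j)) (1\<^sub>m dZ))) $$ (i, i'))))"

definition Delta :: "nat \<Rightarrow> nat \<Rightarrow> nat \<Rightarrow> complex vec \<Rightarrow> ereal" where
  "Delta dA dB dC \<psi> = (INF x \<in> {(dA', dB', dC', VA, VB, VC, \<mu>).
        isometry_mat dA' dA VA \<and> isometry_mat dB' dB VB \<and> isometry_mat dC' dC VC \<and>
        markov_state dA' dB' dC' \<mu>}.
     (case x of (dA', dB', dC', VA, VB, VC, \<mu>) \<Rightarrow>
        rel_entropy (proj_vec (kron (kron VA VB) VC *\<^sub>v \<psi>)) \<mu>))"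

end

theory Submission
  imports "HOL-Complex_Analysis.Conformal_Mappings" Defs
begin

text \<open>
Upper bound: the product state of the two marginals of \<psi> across the cut A versus BC is a Markov state,
and the Schmidt vectors of \<psi> are eigenvectors of it.

Lower bound: let \<mu> be a Markov state and let \<psi>_j on A b_L b_R C be the (unnormalised) component of
\<psi> in the j-th block; the relative entropy is - <\<psi>, log \<mu> \<psi>>, and log \<mu> is
log (p_j \<sigma>_j) + log \<tau>_j on that block.
By the exchange symmetry of \<psi>, \<tau>_j may be moved from b_R C to b_R A without changing its expectation.
Let \<omega> be the marginal of \<mu> on A and consider, for each j, the analytic function
g(z) = <\<psi>_j, (p_j \<sigma>_j)^z \<omega>^(-z) \<tau>_j^z \<psi>_j>.
It is bounded by q = |\<psi>_j|^2 on Re z = 0, where all factors are partial isometries. It is bounded by q also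
on Re z = 1/2, since there the Hilbert-Schmidt norm of the operator is at most 1: tracing out b_L and using
p_j tr \<sigma>_j \<le> \<omega> leaves at most tr \<tau>_j = 1. As g(0) = q, the three lines theorem
gives Re g'(0) \<le> 0, which says that log \<mu> has expectation at most that of log \<omega>. Klein's inequality
finally compares - <\<psi>, log \<omega> \<psi>> with the entropy of \<rho> on A.
This replaces the usual appeal to strong subadditivity.
\<close>

text \<open>The right edge at 1/2 comes from the Hilbert-Schmidt norm: squaring turns the power 1/2
  of an eigenvalue into the eigenvalue itself, so that traces appear. Without moving \<tau>_j onto A
  the bound 1 would be lost: (p_j \<sigma>_j)^(1/2) \<omega>^(-1/2) alone can have squared norm as
  large as the dimension of A, whereas a \<tau>_j that shares A with \<omega> absorbs the inverse.
  Two obstacles shape the encoding. The Markov state lives on larger systems than \<psi>, so all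
  operators are compressed along the embeddings to A and C; only there does an exchange of A and C
  make sense. The compressed \<omega> may lose trace, which Klein's inequality tolerates. Moreover
  \<sigma>_j, \<tau>_j and \<omega> may be singular: powers are taken on supports only, and
  finiteness of the relative entropy puts \<psi> inside them. The block estimates can be added
  because the components \<psi>_j have marginals on A that sum to the marginal of \<psi>.\<close>

hide_type (open) Finite_Cartesian_Product.vec
hide_const (open) Finite_Cartesian_Product.vec Finite_Cartesian_Product.vec_nth
no_notation Finite_Cartesian_Product.vec_nth (infixl "$" 90)

section \<open>The three lines theorem for exponential sums\<close>

text \<open>The factor exp (\<epsilon> z^2) has modulus exp (\<epsilon> ((Re z)^2 - (Im z)^2)) and
  so decays along the strip; the maximum principle then applies on a tall rectangle. The price is a
  factor exp (\<epsilon> h^2), which disappears as \<epsilon> tends to 0. The crude bound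
  \<open>B\<close> serves only on the two horizontal edges.\<close>

lemma three_lines_bound:
  fixes f :: "complex \<Rightarrow> complex"
  assumes hol: "f holomorphic_on UNIV" and h: "0 < h" and q: "0 < q"
    and bnd: "\<And>z. 0 \<le> Re z \<Longrightarrow> Re z \<le> h \<Longrightarrow> cmod (f z) \<le> B"
    and left: "\<And>z. Re z = 0 \<Longrightarrow> cmod (f z) \<le> q"
    and right: "\<And>z. Re z = h \<Longrightarrow> cmod (f z) \<le> q"
    and z: "0 \<le> Re z" "Re z \<le> h"
  shows "cmod (f z) \<le> q"
proof -
  have B: "0 \<le> B" using bnd[of 0] h norm_ge_zero[of "f 0"] by (simp del: norm_ge_zero)
  have eps: "cmod (f z) * exp (\<epsilon> * ((Re z)\<^sup>2 - (Im z)\<^sup>2)) \<le> q * exp (\<epsilon> * h\<^sup>2)" if \<epsilon>: "0 < \<epsilon>" for \<epsilon>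
  proof -
    \<comment> \<open>The height must contain z and satisfy B exp (- \<epsilon> Y^2) \<le> q. Since
      exp x \<ge> x, it is enough that B \<le> q \<epsilon> Y^2; the summand 1 gives Y \<le>
      Y^2.\<close>
    define Y where "Y = \<bar>Im z\<bar> + B / (q * \<epsilon>) + 1"
    have Bq: "0 \<le> B / (q * \<epsilon>)" using B q \<epsilon> by simp
    have Y1: "1 \<le> Y" "\<bar>Im z\<bar> \<le> Y" "B / (q * \<epsilon>) \<le> Y" using Bq unfolding Y_def by auto
    have "Y \<le> Y\<^sup>2" using Y1(1) by (simp add: power2_eq_square)
    then have "B / (q * \<epsilon>) \<le> Y\<^sup>2" using Y1(3) by linarith
    then have "B \<le> q * (\<epsilon> * Y\<^sup>2)" using q \<epsilon> by (simp add: field_simps)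
    also have "\<dots> \<le> q * exp (\<epsilon> * Y\<^sup>2)"
      using q exp_ge_add_one_self[of "\<epsilon> * Y\<^sup>2"] by (intro mult_left_mono) linarith+
    finally have BY: "B * exp (- (\<epsilon> * Y\<^sup>2)) \<le> q" by (simp add: exp_minus field_simps)
    define S where "S = cbox (Complex 0 (- Y)) (Complex h Y)"
    define F where "F = (\<lambda>z. f z * exp (of_real \<epsilon> * z\<^sup>2))"
    have nF: "cmod (F w) = cmod (f w) * exp (\<epsilon> * ((Re w)\<^sup>2 - (Im w)\<^sup>2))" for w
      by (simp add: F_def norm_mult power2_eq_square)
    have F_hol: "F holomorphic_on UNIV"
      unfolding F_def by (intro holomorphic_intros hol)
    have "cmod (F z) \<le> q * exp (\<epsilon> * h\<^sup>2)"
    proof (rule maximum_modulus_frontier[where f = F and \<xi> = z and S = S])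
      show "F holomorphic_on interior S" using F_hol holomorphic_on_subset by blast
      show "continuous_on (closure S) F"
        using F_hol holomorphic_on_imp_continuous_on continuous_on_subset by blast
      show "bounded S" unfolding S_def by simp
      show "z \<in> S" using z Y1(2) unfolding S_def in_cbox_complex_iff by auto
    next
      fix w assume "w \<in> frontier S"
      then have w: "w \<in> cbox (Complex 0 (- Y)) (Complex h Y)" "w \<notin> box (Complex 0 (- Y)) (Complex h Y)"
        unfolding frontier_def S_def by auto
      have wS: "0 \<le> Re w" "Re w \<le> h" "- Y \<le> Im w" "Im w \<le> Y"
        using w(1) unfolding in_cbox_complex_iff by auto
      have Re2: "(Re w)\<^sup>2 \<le> h\<^sup>2" using wS by (intro power_mono) auto
      then have "(Re w)\<^sup>2 - (Im w)\<^sup>2 \<le> h\<^sup>2" using zero_le_power2[of "Im w"] by linarith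
      then have Re3: "exp (\<epsilon> * ((Re w)\<^sup>2 - (Im w)\<^sup>2)) \<le> exp (\<epsilon> * h\<^sup>2)" using \<epsilon> by simp
      from w(2) wS consider "Re w = 0" | "Re w = h" | "\<bar>Im w\<bar> = Y"
        unfolding in_box_complex_iff by fastforce
      then show "cmod (F w) \<le> q * exp (\<epsilon> * h\<^sup>2)"
      proof cases
        case 3
        then have "(Im w)\<^sup>2 = Y\<^sup>2" by (metis power2_abs)
        then have "exp (\<epsilon> * ((Re w)\<^sup>2 - (Im w)\<^sup>2)) \<le> exp (- (\<epsilon> * Y\<^sup>2)) * exp (\<epsilon> * h\<^sup>2)"
          using Re2 \<epsilon> by (simp add: exp_add[symmetric] algebra_simps)
        then have "cmod (F w) \<le> B * (exp (- (\<epsilon> * Y\<^sup>2)) * exp (\<epsilon> * h\<^sup>2))"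
          unfolding nF using bnd[of w] wS B by (intro mult_mono) auto
        also have "\<dots> \<le> q * exp (\<epsilon> * h\<^sup>2)" using BY by (simp add: mult.assoc[symmetric])
        finally show ?thesis .
      qed (use left[of w] right[of w] Re3 q in \<open>simp_all add: nF mult_mono\<close>)
    qed
    then show ?thesis unfolding nF .
  qed
  have "((\<lambda>\<epsilon>. cmod (f z) * exp (\<epsilon> * ((Re z)\<^sup>2 - (Im z)\<^sup>2))) \<longlongrightarrow> cmod (f z) * exp (0 * ((Re z)\<^sup>2 - (Im z)\<^sup>2))) (at_right 0)"
    by (intro tendsto_intros)
  moreover have "((\<lambda>\<epsilon>. q * exp (\<epsilon> * h\<^sup>2)) \<longlongrightarrow> q * exp (0 * h\<^sup>2)) (at_right 0)"
    by (intro tendsto_intros)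
  moreover have "\<forall>\<^sub>F \<epsilon> in at_right 0. cmod (f z) * exp (\<epsilon> * ((Re z)\<^sup>2 - (Im z)\<^sup>2)) \<le> q * exp (\<epsilon> * h\<^sup>2)"
    using eps by (auto simp: eventually_at_right_less intro: eventually_mono[OF eventually_at_right_less])
  ultimately show ?thesis
    using tendsto_le[OF trivial_limit_at_right_real] by fastforce
qed

text \<open>On the segment from 0 to h the real part of the sum is at most q and equals q at 0, so
  its derivative at the left end point cannot be positive. Real exponents make the modulus of each
  term depend on Re z only, which provides the crude bound that the three lines argument asks
  for.\<close>

lemma exponential_sum_slope_nonpos:
  fixes \<alpha> :: "'i \<Rightarrow> real" and c :: "'i \<Rightarrow> complex"
  assumes h: "0 < h" and q: "0 \<le> q"
    and left: "\<And>z. Re z = 0 \<Longrightarrow> cmod (\<Sum>i\<in>I. c i * exp (of_real (\<alpha> i) * z)) \<le> q"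
    and right: "\<And>z. Re z = h \<Longrightarrow> cmod (\<Sum>i\<in>I. c i * exp (of_real (\<alpha> i) * z)) \<le> q"
    and zero: "(\<Sum>i\<in>I. c i) = of_real q"
  shows "Re (\<Sum>i\<in>I. c i * of_real (\<alpha> i)) \<le> 0"
proof -
  define f where "f z = (\<Sum>i\<in>I. c i * exp (of_real (\<alpha> i) * z))" for z
  define B where "B = (\<Sum>i\<in>I. cmod (c i) * exp (\<bar>\<alpha> i\<bar> * h))"
  have hol: "f holomorphic_on UNIV" unfolding f_def by (intro holomorphic_intros)
  have bnd: "cmod (f z) \<le> B" if "0 \<le> Re z" "Re z \<le> h" for z
    unfolding f_def B_def
  proof (rule sum_norm_le)
    fix i assume "i \<in> I"
    have "\<alpha> i * Re z \<le> \<bar>\<alpha> i\<bar> * h"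
      using that by (meson abs_ge_self abs_ge_zero mult_mono)
    then show "cmod (c i * exp (of_real (\<alpha> i) * z)) \<le> cmod (c i) * exp (\<bar>\<alpha> i\<bar> * h)"
      by (simp add: norm_mult mult_left_mono)
  qed
  \<comment> \<open>The three lines bound divides by q, so the case q = 0 is reached through q +
    \<delta>.\<close>
  have strip: "cmod (f z) \<le> q" if "0 \<le> Re z" "Re z \<le> h" for z
  proof (rule field_le_epsilon)
    fix \<delta> :: real assume "0 < \<delta>"
    then show "cmod (f z) \<le> q + \<delta>"
      using left right q
      by (intro three_lines_bound[OF hol h _ bnd _ _ that]) (fastforce simp: f_def[symmetric])+
  qed
  define D where "D = (\<Sum>i\<in>I. c i * of_real (\<alpha> i))"
  have "(f has_field_derivative D) (at (of_real 0))"
    unfolding f_def D_def by (auto intro!: derivative_eq_intros simp: mult.commute)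
  from has_vector_derivative_real_field[OF this]
  have "((\<lambda>x. f (of_real x)) has_vector_derivative D) (at 0)" .
  then have der: "((\<lambda>x. Re (f (of_real x))) has_real_derivative Re D) (at 0)"
    unfolding has_real_derivative_iff_has_vector_derivative using has_derivative_Re by (fastforce simp: has_vector_derivative_def)
  show ?thesis
  proof (rule ccontr)
    assume "\<not> Re (\<Sum>i\<in>I. c i * of_real (\<alpha> i)) \<le> 0"
    then have "0 < Re D" unfolding D_def by simp
    from DERIV_pos_inc_right[OF der this]
    obtain d where d: "0 < d" "\<And>t. 0 < t \<Longrightarrow> t < d \<Longrightarrow> Re (f (of_real 0)) < Re (f (of_real (0 + t)))"
      by auto
    define t where "t = min (d / 2) h"
    have t: "0 < t" "t < d" "t \<le> h" using d(1) h unfolding t_def by auto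
    have "Re (f 0) = q" using zero unfolding f_def by simp
    moreover have "Re (f (of_real t)) \<le> q"
      using strip[of "of_real t"] t complex_Re_le_cmod[of "f (of_real t)"] by simp
    ultimately show False using d(2)[OF t(1,2)] by simp
  qed
qed

section \<open>Parseval frames\<close>

text \<open>The condition is the resolution of the identity by the operators |e_k><e_k|. The vectors
  may be linearly dependent and shorter than 1, as is the case for an orthonormal basis projected to
  a subspace.\<close>

definition parseval_frame :: "'k set \<Rightarrow> 'x set \<Rightarrow> ('k \<Rightarrow> 'x \<Rightarrow> complex) \<Rightarrow> bool" where
  "parseval_frame K X e \<longleftrightarrow> finite K \<and> finite X \<and>
     (\<forall>x\<in>X. \<forall>y\<in>X. (\<Sum>k\<in>K. e k x * cnj (e k y)) = (if x = y then 1 else 0))"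

lemma frame_reconstruction:
  assumes fr: "parseval_frame K X e" and x: "x \<in> X"
  shows "(\<Sum>k\<in>K. (\<Sum>y\<in>X. cnj (e k y) * \<phi> y) * e k x) = \<phi> x"
proof -
  have "(\<Sum>k\<in>K. (\<Sum>y\<in>X. cnj (e k y) * \<phi> y) * e k x) = (\<Sum>y\<in>X. (\<Sum>k\<in>K. e k x * cnj (e k y)) * \<phi> y)"
    unfolding sum_distrib_right by (subst sum.swap) (simp add: mult_ac)
  also have "\<dots> = (\<Sum>y\<in>X. if x = y then \<phi> y else 0)"
    using fr x unfolding parseval_frame_def by (intro sum.cong) auto
  finally show ?thesis using fr x unfolding parseval_frame_def by simp
qed

lemma cmod_sq_sum: "of_real (\<Sum>x\<in>X. (cmod (\<phi> x))\<^sup>2) = (\<Sum>x\<in>X. cnj (\<phi> x) * \<phi> x)"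
  by (simp add: complex_norm_square mult.commute del: of_real_power)

lemma frame_parseval:
  assumes fr: "parseval_frame K X e"
  shows "(\<Sum>k\<in>K. (cmod (\<Sum>x\<in>X. cnj (e k x) * \<phi> x))\<^sup>2) = (\<Sum>x\<in>X. (cmod (\<phi> x))\<^sup>2)"
proof -
  define b where "b k = (\<Sum>x\<in>X. cnj (e k x) * \<phi> x)" for k
  have "complex_of_real (\<Sum>k\<in>K. (cmod (b k))\<^sup>2) = (\<Sum>k\<in>K. cnj (b k) * b k)"
    by (rule cmod_sq_sum)
  also have "\<dots> = (\<Sum>k\<in>K. \<Sum>x\<in>X. cnj (\<phi> x) * (b k * e k x))"
    by (subst (1) b_def) (simp add: sum_distrib_left mult_ac)
  also have "\<dots> = (\<Sum>x\<in>X. cnj (\<phi> x) * (\<Sum>k\<in>K. b k * e k x))"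
    by (subst sum.swap) (simp add: sum_distrib_left)
  also have "\<dots> = (\<Sum>x\<in>X. cnj (\<phi> x) * \<phi> x)"
    unfolding b_def using frame_reconstruction[OF fr] by (intro sum.cong) auto
  also have "\<dots> = of_real (\<Sum>x\<in>X. (cmod (\<phi> x))\<^sup>2)" by (rule cmod_sq_sum[symmetric])
  finally show ?thesis unfolding b_def of_real_eq_iff .
qed

text \<open>Synthesis is the adjoint of the analysis map, which is an isometry by
  \<open>frame_parseval\<close>, hence it is a contraction. Concretely, let \<open>b\<close> be the
  analysis coefficients of the synthesised vector \<open>y\<close>: both <c, b> and |b|^2 equal
  |y|^2, and |c - b|^2 \<ge> 0 gives the claim.\<close>

lemma frame_synthesis_bound:
  assumes fr: "parseval_frame K X e"
  shows "(\<Sum>x\<in>X. (cmod (\<Sum>k\<in>K. c k * e k x))\<^sup>2) \<le> (\<Sum>k\<in>K. (cmod (c k))\<^sup>2)"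
proof -
  define y where "y x = (\<Sum>k\<in>K. c k * e k x)" for x
  define b where "b k = (\<Sum>x\<in>X. cnj (e k x) * y x)" for k
  have b: "(\<Sum>k\<in>K. (cmod (b k))\<^sup>2) = (\<Sum>x\<in>X. (cmod (y x))\<^sup>2)"
    unfolding b_def by (rule frame_parseval[OF fr])
  have "(\<Sum>k\<in>K. cnj (c k) * b k) = (\<Sum>x\<in>X. cnj (y x) * y x)"
    unfolding b_def sum_distrib_left
    by (subst sum.swap, subst (2) y_def) (simp add: sum_distrib_left mult_ac)
  then have cb: "(\<Sum>k\<in>K. cnj (c k) * b k) = of_real (\<Sum>x\<in>X. (cmod (y x))\<^sup>2)"
    unfolding cmod_sq_sum .
  have "0 \<le> (\<Sum>k\<in>K. (cmod (c k - b k))\<^sup>2)" by (intro sum_nonneg) simp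
  also have "\<dots> = (\<Sum>k\<in>K. (cmod (c k))\<^sup>2 - 2 * Re (cnj (c k) * b k) + (cmod (b k))\<^sup>2)"
    by (intro sum.cong refl) (simp only: cmod_power2, simp add: power2_eq_square algebra_simps)
  also have "\<dots> = (\<Sum>k\<in>K. (cmod (c k))\<^sup>2) - 2 * Re (\<Sum>k\<in>K. cnj (c k) * b k) + (\<Sum>k\<in>K. (cmod (b k))\<^sup>2)"
    by (simp add: sum.distrib sum_subtractf sum_distrib_left)
  finally show ?thesis unfolding cb b y_def by simp
qed

text \<open>This is the synthesis bound for the coefficient family that is 1 at \<open>k\<close> and
  0 elsewhere.\<close>

lemma frame_norm_le_1:
  assumes fr: "parseval_frame K X e" and k: "k \<in> K"
  shows "(\<Sum>x\<in>X. (cmod (e k x))\<^sup>2) \<le> 1"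
proof -
  have K: "finite K" using fr unfolding parseval_frame_def by simp
  have "(\<Sum>x\<in>X. (cmod (\<Sum>i\<in>K. (if i = k then 1 else 0) * e i x))\<^sup>2) \<le> (\<Sum>i\<in>K. (cmod (if i = k then 1 else 0))\<^sup>2)"
    by (rule frame_synthesis_bound[OF fr])
  moreover have "(\<Sum>i\<in>K. (if i = k then 1 else 0) * e i x) = e k x" for x
  proof -
    have "(\<Sum>i\<in>K. (if i = k then 1 else 0) * e i x) = (\<Sum>i\<in>K. if i = k then e i x else 0)"
      by (intro sum.cong) auto
    then show ?thesis using K k by simp
  qed
  moreover have "(\<Sum>i\<in>K. (cmod (if i = k then 1 else 0))\<^sup>2) = (\<Sum>i\<in>K. if i = k then 1 else (0::real))"
    by (intro sum.cong) auto
  ultimately show ?thesis using K k by simp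
qed

lemma cmod_sum_mult_le:
  fixes x y :: "'i \<Rightarrow> complex"
  shows "(cmod (\<Sum>i\<in>I. x i * y i))\<^sup>2 \<le> (\<Sum>i\<in>I. (cmod (x i))\<^sup>2) * (\<Sum>i\<in>I. (cmod (y i))\<^sup>2)"
proof -
  have "cmod (\<Sum>i\<in>I. x i * y i) \<le> (\<Sum>i\<in>I. cmod (x i) * cmod (y i))"
    by (rule order_trans[OF norm_sum]) (simp add: norm_mult)
  then have "(cmod (\<Sum>i\<in>I. x i * y i))\<^sup>2 \<le> (\<Sum>i\<in>I. cmod (x i) * cmod (y i))\<^sup>2"
    by (intro power_mono) auto
  also have "\<dots> \<le> (\<Sum>i\<in>I. (cmod (x i))\<^sup>2) * (\<Sum>i\<in>I. (cmod (y i))\<^sup>2)"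
    by (rule Cauchy_Schwarz_ineq_sum)
  finally show ?thesis .
qed

section \<open>The analytic estimate on one block of a Markov state\<close>

lemma sum_move_in:
  "(\<Sum>k\<in>K. \<Sum>m\<in>M. \<Sum>a\<in>A. \<Sum>l\<in>L. \<Sum>r\<in>R. \<Sum>c\<in>C. h k m a l r c) =
   (\<Sum>a\<in>A. \<Sum>l\<in>L. \<Sum>r\<in>R. \<Sum>c\<in>C. \<Sum>k\<in>K. \<Sum>m\<in>M. h k m a l r c)"
  (is "?l = ?r")
proof -
  have "?l = (\<Sum>k\<in>K. \<Sum>m\<in>M. \<Sum>(a, l, r, c)\<in>A \<times> L \<times> R \<times> C. h k m a l r c)"
    by (simp only: sum.cartesian_product' prod.case)
  also have "\<dots> = (\<Sum>(a, l, r, c)\<in>A \<times> L \<times> R \<times> C. \<Sum>k\<in>K. \<Sum>m\<in>M. h k m a l r c)"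
    by (simp only: case_prod_unfold sum.swap[of _ "A \<times> L \<times> R \<times> C" M] sum.swap[of _ "A \<times> L \<times> R \<times> C" K])
  also have "\<dots> = ?r" by (simp only: sum.cartesian_product' prod.case)
  finally show ?thesis .
qed

lemma cmod_nested_sum_mult_le:
  fixes x y :: "'i \<Rightarrow> 'j \<Rightarrow> 'k \<Rightarrow> 'l \<Rightarrow> complex"
  shows "(cmod (\<Sum>i\<in>I. \<Sum>j\<in>J. \<Sum>k\<in>K. \<Sum>l\<in>L. x i j k l * y i j k l))\<^sup>2 \<le>
    (\<Sum>i\<in>I. \<Sum>j\<in>J. \<Sum>k\<in>K. \<Sum>l\<in>L. (cmod (x i j k l))\<^sup>2) *
    (\<Sum>i\<in>I. \<Sum>j\<in>J. \<Sum>k\<in>K. \<Sum>l\<in>L. (cmod (y i j k l))\<^sup>2)"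
  using cmod_sum_mult_le[of "\<lambda>(i, j, k, l). x i j k l" "\<lambda>(i, j, k, l). y i j k l" "I \<times> J \<times> K \<times> L"]
  by (simp add: sum.cartesian_product case_prod_unfold)

text \<open>The first slot of \<open>\<phi>\<close> is A b_L and the second one b_R C, with A and C both indexed by \<open>A\<close>.
The families \<open>e\<close>, \<open>f\<close> with weights \<open>s\<close>, \<open>t\<close> are the eigenvectors of \<sigma> and \<tau>, compressed
along the embeddings of A and C; compression turns orthonormal bases into Parseval frames. The operator
\<omega> is assumed diagonal, with entries \<open>w\<close>.\<close>

locale symmetric_block =
  fixes A :: "'a set" and L :: "'l set" and R :: "'r set" and K :: "'k set" and M :: "'m set"
    and e :: "'k \<Rightarrow> 'a \<times> 'l \<Rightarrow> complex" and f :: "'m \<Rightarrow> 'r \<times> 'a \<Rightarrow> complex"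
    and s :: "'k \<Rightarrow> real" and t :: "'m \<Rightarrow> real" and w :: "'a \<Rightarrow> real"
    and \<phi> :: "'a \<times> 'l \<Rightarrow> 'r \<times> 'a \<Rightarrow> complex" and \<epsilon> :: complex
    and amp :: "'k \<Rightarrow> 'm \<Rightarrow> complex"
  assumes fin: "finite A" "finite L" "finite R"
    and frame_e: "parseval_frame K (A \<times> L) e" and frame_f: "parseval_frame M (R \<times> A) f"
    and s_nonneg: "\<And>k. k \<in> K \<Longrightarrow> 0 \<le> s k" and t_nonneg: "\<And>m. m \<in> M \<Longrightarrow> 0 \<le> t m"
    and w_nonneg: "\<And>a. a \<in> A \<Longrightarrow> 0 \<le> w a"
    and t_sum: "sum t M \<le> 1"
    and dominated: "\<And>y. (\<Sum>k\<in>K. \<Sum>l\<in>L. s k * (cmod (\<Sum>a\<in>A. cnj (e k (a, l)) * y a))\<^sup>2)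
        \<le> (\<Sum>a\<in>A. w a * (cmod (y a))\<^sup>2)"
    and eps: "cmod \<epsilon> = 1"
    and sym: "\<And>a l r c. a \<in> A \<Longrightarrow> l \<in> L \<Longrightarrow> r \<in> R \<Longrightarrow> c \<in> A \<Longrightarrow> \<phi> (a, l) (r, c) = \<epsilon> * \<phi> (c, l) (r, a)"
    and amp: "\<And>k m. amp k m = (\<Sum>x\<in>A \<times> L. \<Sum>y\<in>R \<times> A. cnj (e k x) * cnj (f m y) * \<phi> x y)"
    and supp: "\<And>k m. k \<in> K \<Longrightarrow> m \<in> M \<Longrightarrow> s k = 0 \<or> t m = 0 \<Longrightarrow> amp k m = 0"
begin

text \<open>\<open>u k\<close> is the partial inner product of \<phi> with the frame vector
  \<open>e k\<close>, a vector on b_R C; \<open>v m\<close> is the one with \<open>f m\<close>, a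
  vector on A b_L. Their frame coefficients are the same numbers \<open>amp k m\<close>.\<close>

definition "u k y = (\<Sum>x\<in>A \<times> L. cnj (e k x) * \<phi> x y)"
definition "v m x = (\<Sum>y\<in>R \<times> A. cnj (f m y) * \<phi> x y)"
definition "Q = (\<Sum>x\<in>A \<times> L. \<Sum>y\<in>R \<times> A. (cmod (\<phi> x y))\<^sup>2)"
text \<open>\<open>H X Y Z\<close> is the value <\<phi>, X(\<sigma>) Z(\<omega>) Y(\<tau>) \<phi>> with \<tau> acting on b_R A.\<close>

definition "G k m a = (\<Sum>l\<in>L. \<Sum>r\<in>R. \<Sum>c\<in>A. cnj (u k (r, c)) * cnj (e k (a, l)) * (\<epsilon> * v m (c, l) * f m (r, a)))"
definition "H X Y Z = (\<Sum>k\<in>K. \<Sum>m\<in>M. \<Sum>a\<in>A. G k m a * (X k * Y m * Z a))"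

lemma Q_nonneg: "0 \<le> Q" unfolding Q_def by (intro sum_nonneg) simp

lemma amp_u: "amp k m = (\<Sum>y\<in>R \<times> A. cnj (f m y) * u k y)"
  unfolding amp u_def sum_distrib_left by (subst sum.swap) (simp add: mult_ac)

lemma amp_v: "amp k m = (\<Sum>x\<in>A \<times> L. cnj (e k x) * v m x)"
  unfolding amp v_def sum_distrib_left by (simp add: mult_ac)

lemma sum_amp_sq_u: "(\<Sum>m\<in>M. (cmod (amp k m))\<^sup>2) = (\<Sum>y\<in>R \<times> A. (cmod (u k y))\<^sup>2)"
  unfolding amp_u by (rule frame_parseval[OF frame_f])

lemma sum_amp_sq_v: "(\<Sum>k\<in>K. (cmod (amp k m))\<^sup>2) = (\<Sum>x\<in>A \<times> L. (cmod (v m x))\<^sup>2)"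
  unfolding amp_v by (rule frame_parseval[OF frame_e])

lemma sum_u_sq: "(\<Sum>k\<in>K. \<Sum>y\<in>R \<times> A. (cmod (u k y))\<^sup>2) = Q"
  unfolding Q_def u_def
  by (subst sum.swap[of _ _ K], subst sum.swap[of _ "R \<times> A" "A \<times> L"])
    (intro sum.cong refl frame_parseval[OF frame_e])

lemma sum_v_sq: "(\<Sum>m\<in>M. \<Sum>x\<in>A \<times> L. (cmod (v m x))\<^sup>2) = Q"
  unfolding Q_def v_def by (subst sum.swap) (intro sum.cong refl frame_parseval[OF frame_f])

text \<open>The frame coefficients of \<open>u k\<close> are the amplitudes \<open>amp k m\<close>,
  all of which vanish by \<open>supp\<close>; reconstruction then gives zero. The same argument
  serves \<open>v_zero\<close>.\<close>

lemma u_zero: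
  assumes "k \<in> K" "s k = 0" "y \<in> R \<times> A"
  shows "u k y = 0"
  using frame_reconstruction[OF frame_f assms(3), of "u k"] supp assms
  by (simp add: amp_u[symmetric])

lemma v_zero:
  assumes "m \<in> M" "t m = 0" "x \<in> A \<times> L"
  shows "v m x = 0"
  using frame_reconstruction[OF frame_e assms(3), of "v m"] supp assms
  by (simp add: amp_v[symmetric])

lemma reconstruct_u: "x \<in> A \<times> L \<Longrightarrow> (\<Sum>k\<in>K. u k y * e k x) = \<phi> x y"
  unfolding u_def by (rule frame_reconstruction[OF frame_e])

text \<open>Here the exchange of A and C enters: reconstruction from \<tau> on b_R A yields \<phi>
  with the indices \<open>a\<close> and \<open>c\<close> exchanged, and the factor \<epsilon> turns
  it back into \<phi>.\<close>

lemma reconstruct_v: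
  assumes "a \<in> A" "l \<in> L" "r \<in> R" "c \<in> A"
  shows "(\<Sum>m\<in>M. \<epsilon> * v m (c, l) * f m (r, a)) = \<phi> (a, l) (r, c)"
proof -
  have "(\<Sum>m\<in>M. v m (c, l) * f m (r, a)) = \<phi> (c, l) (r, a)"
    unfolding v_def using assms by (intro frame_reconstruction[OF frame_f]) auto
  then show ?thesis
    using sym[OF assms] by (simp add: sum_distrib_left[symmetric] mult.assoc)
qed

text \<open>The domination is tested on the coordinate vector at \<open>a\<close>, where \<omega>
  vanishes: a sum of nonnegative terms is at most 0, so each eigenvector of nonzero weight must
  vanish at \<open>a\<close>.\<close>

lemma e_zero:
  assumes a: "a \<in> A" "w a = 0" and l: "l \<in> L" and k: "k \<in> K" "s k \<noteq> 0"
  shows "e k (a, l) = 0"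
proof -
  have K: "finite K" using frame_e unfolding parseval_frame_def by simp
  have D: "(\<Sum>a'\<in>A. g a' * (if a' = a then 1 else 0)) = g a" for g :: "'a \<Rightarrow> complex"
  proof -
    have "(\<Sum>a'\<in>A. g a' * (if a' = a then 1 else 0)) = (\<Sum>a'\<in>A. if a' = a then g a' else 0)"
      by (intro sum.cong) auto
    then show ?thesis using fin a by simp
  qed
  have "(\<Sum>k\<in>K. \<Sum>l\<in>L. s k * (cmod (cnj (e k (a, l))))\<^sup>2)
      \<le> (\<Sum>a'\<in>A. w a' * (cmod (if a' = a then 1 else 0))\<^sup>2)"
    using dominated[of "\<lambda>a'. if a' = a then 1 else 0"] unfolding D .
  also have "\<dots> = 0" using a by (intro sum.neutral) auto
  finally have le: "(\<Sum>k\<in>K. \<Sum>l\<in>L. s k * (cmod (cnj (e k (a, l))))\<^sup>2) \<le> 0" .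
  have "s k * (cmod (cnj (e k (a, l))))\<^sup>2 \<le> (\<Sum>l\<in>L. s k * (cmod (cnj (e k (a, l))))\<^sup>2)"
    using l k s_nonneg fin by (intro member_le_sum) auto
  also have "\<dots> \<le> (\<Sum>k\<in>K. \<Sum>l\<in>L. s k * (cmod (cnj (e k (a, l))))\<^sup>2)"
    using k s_nonneg K by (intro member_le_sum[where f = "\<lambda>k. \<Sum>l\<in>L. s k * (cmod (cnj (e k (a, l))))\<^sup>2"])
      (auto intro!: sum_nonneg)
  finally have "s k * (cmod (e k (a, l)))\<^sup>2 \<le> 0" using le by simp
  then show ?thesis using s_nonneg[OF k(1)] k(2) by (simp add: mult_le_0_iff)
qed

text \<open>Expand \<phi> in the \<open>e k\<close>: for each \<open>k\<close> either the weight is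
  zero and \<open>u k\<close> vanishes, or \<open>e k\<close> itself vanishes at \<open>a\<close>.
  Thus \<phi> inherits the support of \<omega> from the support of \<sigma>.\<close>

lemma phi_zero:
  assumes "a \<in> A" "w a = 0" "l \<in> L" "y \<in> R \<times> A"
  shows "\<phi> (a, l) y = 0"
proof -
  have "u k y * e k (a, l) = 0" if "k \<in> K" for k
    using that u_zero[of k y] e_zero[of a l k] assms by auto
  then show ?thesis using reconstruct_u[of "(a, l)" y] assms by simp
qed

text \<open>Terms with a vanishing eigenvalue drop out of \<open>H\<close>, so powers and logarithms
  of 0 may be given any convenient value there.\<close>

lemma G_zero:
  assumes "k \<in> K" "m \<in> M" "a \<in> A" "s k = 0 \<or> t m = 0 \<or> w a = 0"
  shows "G k m a = 0"
  unfolding G_def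
proof (intro sum.neutral ballI)
  fix l r c assume "l \<in> L" "r \<in> R" "c \<in> A"
  then show "cnj (u k (r, c)) * cnj (e k (a, l)) * (\<epsilon> * v m (c, l) * f m (r, a)) = 0"
    using u_zero[of k "(r, c)"] v_zero[of m "(c, l)"] e_zero[of a l k] assms by auto
qed

text \<open>The form for Re z = 0. It is an inner product of two vectors: the adjoint of X(\<sigma>)
  is applied to the left copy of \<phi>, and Z(\<omega>) Y(\<tau>) to the right one.\<close>

lemma H_eq:
  "H X Y Z = (\<Sum>a\<in>A. \<Sum>l\<in>L. \<Sum>r\<in>R. \<Sum>c\<in>A. cnj (\<Sum>k\<in>K. (cnj (X k) * u k (r, c)) * e k (a, l)) *
     (Z a * (\<Sum>m\<in>M. (Y m * (\<epsilon> * v m (c, l))) * f m (r, a))))"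
proof -
  have "H X Y Z = (\<Sum>k\<in>K. \<Sum>m\<in>M. \<Sum>a\<in>A. \<Sum>l\<in>L. \<Sum>r\<in>R. \<Sum>c\<in>A.
    X k * cnj (u k (r, c)) * cnj (e k (a, l)) * (Z a * (Y m * (\<epsilon> * v m (c, l)) * f m (r, a))))"
    unfolding H_def G_def sum_distrib_right by (intro sum.cong refl) (simp add: mult_ac)
  also have "\<dots> = (\<Sum>a\<in>A. \<Sum>l\<in>L. \<Sum>r\<in>R. \<Sum>c\<in>A. \<Sum>k\<in>K. \<Sum>m\<in>M.
    X k * cnj (u k (r, c)) * cnj (e k (a, l)) * (Z a * (Y m * (\<epsilon> * v m (c, l)) * f m (r, a))))"
    by (rule sum_move_in)
  also have "\<dots> = (\<Sum>a\<in>A. \<Sum>l\<in>L. \<Sum>r\<in>R. \<Sum>c\<in>A. cnj (\<Sum>k\<in>K. (cnj (X k) * u k (r, c)) * e k (a, l)) *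
     (Z a * (\<Sum>m\<in>M. (Y m * (\<epsilon> * v m (c, l))) * f m (r, a))))"
    by (intro sum.cong refl, subst sum.swap)
      (simp only: sum_distrib_left sum_distrib_right cnj_sum complex_cnj_mult complex_cnj_cnj)
  finally show ?thesis .
qed

text \<open>The form for Re z = 1/2. The sum over C is carried out first, since no operator acts
  there; what remains are the matrix elements of the operator between \<open>e k\<close> and
  \<open>f m\<close>, contracted over A.\<close>

lemma H_eq':
  "H X Y Z = (\<Sum>k\<in>K. \<Sum>m\<in>M. \<Sum>l\<in>L. \<Sum>r\<in>R. (\<Sum>c\<in>A. cnj (u k (r, c)) * (\<epsilon> * v m (c, l))) *
     (X k * Y m * (\<Sum>a\<in>A. cnj (e k (a, l)) * (Z a * f m (r, a)))))"
proof -
  have "(\<Sum>a\<in>A. G k m a * (X k * Y m * Z a)) =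
    (\<Sum>l\<in>L. \<Sum>r\<in>R. (\<Sum>c\<in>A. cnj (u k (r, c)) * (\<epsilon> * v m (c, l))) *
     (X k * Y m * (\<Sum>a\<in>A. cnj (e k (a, l)) * (Z a * f m (r, a)))))" (is "?l = ?r") for k m
  proof -
    have "?l = (\<Sum>l\<in>L. \<Sum>r\<in>R. \<Sum>a\<in>A. \<Sum>c\<in>A. cnj (u k (r, c)) * (\<epsilon> * v m (c, l)) * (X k * Y m * (cnj (e k (a, l)) * (Z a * f m (r, a)))))"
      unfolding G_def sum_distrib_right
      by (simp only: sum.swap[of _ L A] sum.swap[of _ R A]) (intro sum.cong refl, simp add: mult_ac)
    also have "\<dots> = ?r"
      by (simp only: sum_distrib_left sum_distrib_right)
    finally show ?thesis .
  qed
  then show ?thesis unfolding H_def by simp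
qed

text \<open>Both vectors in \<open>H_eq\<close> have squared norm at most \<open>Q\<close>:
  coefficients of modulus at most 1 pass through the synthesis bounds of the two frames, and
  \<omega> acts diagonally. On the \<tau> side the indices of A and C are exchanged, which only
  permutes the summation.\<close>

lemma H_bound_unit:
  assumes X: "\<And>k. k \<in> K \<Longrightarrow> cmod (X k) \<le> 1" and Y: "\<And>m. m \<in> M \<Longrightarrow> cmod (Y m) \<le> 1"
    and Z: "\<And>a. a \<in> A \<Longrightarrow> cmod (Z a) \<le> 1"
  shows "cmod (H X Y Z) \<le> Q"
proof -
  define \<Phi> where "\<Phi> x y = (\<Sum>k\<in>K. (cnj (X k) * u k y) * e k x)" for x y
  define \<Psi> where "\<Psi> x y = (\<Sum>m\<in>M. (Y m * (\<epsilon> * v m x)) * f m y)" for x y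
  have \<Phi>: "(\<Sum>a\<in>A. \<Sum>l\<in>L. \<Sum>r\<in>R. \<Sum>c\<in>A. (cmod (cnj (\<Phi> (a, l) (r, c))))\<^sup>2) \<le> Q"
  proof -
    have "(\<Sum>a\<in>A. \<Sum>l\<in>L. \<Sum>r\<in>R. \<Sum>c\<in>A. (cmod (cnj (\<Phi> (a, l) (r, c))))\<^sup>2) = (\<Sum>y\<in>R \<times> A. \<Sum>x\<in>A \<times> L. (cmod (\<Phi> x y))\<^sup>2)"
      by (subst sum.swap[of _ "A \<times> L"]) (simp add: sum.cartesian_product' )
    also have "\<dots> \<le> (\<Sum>y\<in>R \<times> A. \<Sum>k\<in>K. (cmod (u k y))\<^sup>2)"
      unfolding \<Phi>_def
      by (intro sum_mono order_trans[OF frame_synthesis_bound[OF frame_e]])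
        (use X in \<open>simp add: norm_mult mult_left_le_one_le\<close>)
    also have "\<dots> = Q" by (subst sum.swap) (rule sum_u_sq)
    finally show ?thesis .
  qed
  have \<Psi>: "(\<Sum>a\<in>A. \<Sum>l\<in>L. \<Sum>r\<in>R. \<Sum>c\<in>A. (cmod (Z a * \<Psi> (c, l) (r, a)))\<^sup>2) \<le> Q"
  proof -
    have "(\<Sum>a\<in>A. \<Sum>l\<in>L. \<Sum>r\<in>R. \<Sum>c\<in>A. (cmod (Z a * \<Psi> (c, l) (r, a)))\<^sup>2) \<le> 
        (\<Sum>a\<in>A. \<Sum>l\<in>L. \<Sum>r\<in>R. \<Sum>c\<in>A. (cmod (\<Psi> (c, l) (r, a)))\<^sup>2)"
      by (intro sum_mono) (use Z in \<open>simp add: norm_mult mult_left_le_one_le\<close>)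
    also have "\<dots> = (\<Sum>c\<in>A. \<Sum>l\<in>L. \<Sum>r\<in>R. \<Sum>a\<in>A. (cmod (\<Psi> (c, l) (r, a)))\<^sup>2)"
      by (simp only: sum.swap[of _ L A] sum.swap[of _ R A])
        (rule sum.cong[OF refl], rule sum.cong[OF refl], rule sum.swap)
    also have "\<dots> = (\<Sum>x\<in>A \<times> L. \<Sum>y\<in>R \<times> A. (cmod (\<Psi> x y))\<^sup>2)"
      by (simp add: sum.cartesian_product')
    also have "\<dots> \<le> (\<Sum>x\<in>A \<times> L. \<Sum>m\<in>M. (cmod (v m x))\<^sup>2)"
      unfolding \<Psi>_def
      by (intro sum_mono order_trans[OF frame_synthesis_bound[OF frame_f]])
        (use Y in \<open>simp add: norm_mult eps mult_left_le_one_le\<close>)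
    also have "\<dots> = Q" by (subst sum.swap) (rule sum_v_sq)
    finally show ?thesis .
  qed
  have "(cmod (H X Y Z))\<^sup>2 \<le>
    (\<Sum>a\<in>A. \<Sum>l\<in>L. \<Sum>r\<in>R. \<Sum>c\<in>A. (cmod (cnj (\<Phi> (a, l) (r, c))))\<^sup>2) *
    (\<Sum>a\<in>A. \<Sum>l\<in>L. \<Sum>r\<in>R. \<Sum>c\<in>A. (cmod (Z a * \<Psi> (c, l) (r, a)))\<^sup>2)"
    unfolding H_eq \<Phi>_def[symmetric] \<Psi>_def[symmetric] by (rule cmod_nested_sum_mult_le)
  also have "\<dots> \<le> Q * Q" using \<Phi> \<Psi> Q_nonneg by (intro mult_mono) (auto intro!: sum_nonneg)
  finally have "(cmod (H X Y Z))\<^sup>2 \<le> Q\<^sup>2" unfolding power2_eq_square[of Q] .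
  then show ?thesis using Q_nonneg by (rule power2_le_imp_le)
qed

text \<open>Cauchy-Schwarz in \<open>H_eq'\<close> separates state and operator. The state enters
  through overlaps of \<open>u k\<close> and \<open>v m\<close> over C, whose squares sum to at most
  \<open>Q * Q\<close>, because the total squared norm of each family is \<open>Q\<close>. The
  operator enters through its squared Hilbert-Schmidt norm, computed in the frames.\<close>

lemma H_bound_half:
  assumes X: "\<And>k. k \<in> K \<Longrightarrow> (cmod (X k))\<^sup>2 \<le> s k" and Y: "\<And>m. m \<in> M \<Longrightarrow> (cmod (Y m))\<^sup>2 \<le> t m"
    and Z: "\<And>a. a \<in> A \<Longrightarrow> w a * (cmod (Z a))\<^sup>2 \<le> 1"
  shows "cmod (H X Y Z) \<le> Q"
proof -
  have first: "(\<Sum>k\<in>K. \<Sum>m\<in>M. \<Sum>l\<in>L. \<Sum>r\<in>R. (cmod (\<Sum>c\<in>A. cnj (u k (r, c)) * (\<epsilon> * v m (c, l))))\<^sup>2) \<le> Q * Q"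
  proof -
    define U where "U k r = (\<Sum>c\<in>A. (cmod (u k (r, c)))\<^sup>2)" for k r
    define V where "V m l = (\<Sum>c\<in>A. (cmod (v m (c, l)))\<^sup>2)" for m l
    have "(\<Sum>k\<in>K. \<Sum>m\<in>M. \<Sum>l\<in>L. \<Sum>r\<in>R. (cmod (\<Sum>c\<in>A. cnj (u k (r, c)) * (\<epsilon> * v m (c, l))))\<^sup>2)
      \<le> (\<Sum>k\<in>K. \<Sum>m\<in>M. \<Sum>l\<in>L. \<Sum>r\<in>R. U k r * V m l)"
      unfolding U_def V_def
      by (intro sum_mono order_trans[OF cmod_sum_mult_le]) (simp add: norm_mult eps)
    also have "\<dots> = (\<Sum>k\<in>K. \<Sum>r\<in>R. U k r) * (\<Sum>m\<in>M. \<Sum>l\<in>L. V m l)"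
      by (simp only: sum_distrib_left sum_distrib_right sum.swap[of _ M K] sum.swap[of _ L K])
    also have "(\<Sum>k\<in>K. \<Sum>r\<in>R. U k r) = Q"
      unfolding U_def sum_u_sq[symmetric] by (simp add: sum.cartesian_product')
    also have "(\<Sum>m\<in>M. \<Sum>l\<in>L. V m l) = Q"
      unfolding V_def sum_v_sq[symmetric]
      by (simp add: sum.cartesian_product' sum.swap[of _ A L])
    finally show ?thesis .
  qed
  have second: "(\<Sum>k\<in>K. \<Sum>m\<in>M. \<Sum>l\<in>L. \<Sum>r\<in>R. (cmod (X k * Y m * (\<Sum>a\<in>A. cnj (e k (a, l)) * (Z a * f m (r, a)))))\<^sup>2) \<le> 1"
  proof -
    define N where "N k m l r = (cmod (\<Sum>a\<in>A. cnj (e k (a, l)) * (Z a * f m (r, a))))\<^sup>2" for k m l r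
    have "(\<Sum>k\<in>K. \<Sum>m\<in>M. \<Sum>l\<in>L. \<Sum>r\<in>R. (cmod (X k * Y m * (\<Sum>a\<in>A. cnj (e k (a, l)) * (Z a * f m (r, a)))))\<^sup>2)
      \<le> (\<Sum>k\<in>K. \<Sum>m\<in>M. \<Sum>l\<in>L. \<Sum>r\<in>R. t m * (s k * N k m l r))"
      unfolding norm_mult power_mult_distrib N_def[unfolded norm_mult]
      using X Y s_nonneg t_nonneg by (intro sum_mono) (subst mult.assoc[symmetric], intro mult_right_mono, subst mult.commute, intro mult_mono, auto)
    also have "\<dots> = (\<Sum>m\<in>M. t m * (\<Sum>r\<in>R. \<Sum>k\<in>K. \<Sum>l\<in>L. s k * N k m l r))"
      by (simp only: sum_distrib_left sum.swap[of _ L R] sum.swap[of _ K R] sum.swap[of _ K M])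
    also have "\<dots> \<le> (\<Sum>m\<in>M. t m * (\<Sum>r\<in>R. \<Sum>a\<in>A. (cmod (f m (r, a)))\<^sup>2))"
    proof (intro sum_mono mult_left_mono t_nonneg)
      fix m r
      \<comment> \<open>The domination is used for the vector
        \<open>\<lambda>a. Z a * f m (r, a)\<close>; the weights \<open>w\<close> that it produces
        are cancelled by the squares of \<open>Z\<close>, leaving the part of |f m|^2 at
        \<open>r\<close>.\<close>
      have "(\<Sum>k\<in>K. \<Sum>l\<in>L. s k * N k m l r) \<le> (\<Sum>a\<in>A. w a * (cmod (Z a * f m (r, a)))\<^sup>2)"
        unfolding N_def by (rule dominated)
      also have "\<dots> \<le> (\<Sum>a\<in>A. (cmod (f m (r, a)))\<^sup>2)"
        unfolding norm_mult power_mult_distrib mult.assoc[symmetric]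
        using Z w_nonneg by (intro sum_mono mult_left_le_one_le) auto
      finally show "(\<Sum>k\<in>K. \<Sum>l\<in>L. s k * N k m l r) \<le> (\<Sum>a\<in>A. (cmod (f m (r, a)))\<^sup>2)" .
    qed
    also have "\<dots> \<le> (\<Sum>m\<in>M. t m * 1)"
      using frame_norm_le_1[OF frame_f] t_nonneg
      by (intro sum_mono mult_left_mono) (auto simp: sum.cartesian_product')
    also have "\<dots> \<le> 1" using t_sum by simp
    finally show ?thesis .
  qed
  have "(cmod (H X Y Z))\<^sup>2 \<le> Q * Q * 1"
    unfolding H_eq'
    by (rule order_trans[OF cmod_nested_sum_mult_le], rule mult_mono[OF first second])
      (auto intro!: sum_nonneg mult_nonneg_nonneg Q_nonneg)
  then have "(cmod (H X Y Z))\<^sup>2 \<le> Q\<^sup>2" by (simp add: power2_eq_square[of Q])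
  then show ?thesis using Q_nonneg by (rule power2_le_imp_le)
qed

text \<open>With trivial \<omega> and \<tau> the exchange is undone by \<open>reconstruct_v\<close>,
  and the expectation of X(\<sigma>) in \<phi> remains.\<close>

lemma H_one: "H X (\<lambda>_. 1) (\<lambda>_. 1) = (\<Sum>k\<in>K. X k * of_real (\<Sum>y\<in>R \<times> A. (cmod (u k y))\<^sup>2))"
proof -
  have "H X (\<lambda>_. 1) (\<lambda>_. 1) = (\<Sum>a\<in>A. \<Sum>l\<in>L. \<Sum>r\<in>R. \<Sum>c\<in>A. cnj (\<Sum>k\<in>K. (cnj (X k) * u k (r, c)) * e k (a, l)) * \<phi> (a, l) (r, c))"
    unfolding H_eq using reconstruct_v by (intro sum.cong refl) simp
  also have "\<dots> = (\<Sum>x\<in>A \<times> L. \<Sum>y\<in>R \<times> A. \<Sum>k\<in>K. X k * cnj (u k y) * (cnj (e k x) * \<phi> x y))"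
    by (simp add: sum.cartesian_product' sum_distrib_left sum_distrib_right mult_ac)
  also have "\<dots> = (\<Sum>k\<in>K. \<Sum>y\<in>R \<times> A. X k * cnj (u k y) * u k y)"
    unfolding u_def sum_distrib_left
    by (subst (2) sum.swap, subst sum.swap, subst (2) sum.swap) (rule refl)
  also have "\<dots> = (\<Sum>k\<in>K. X k * of_real (\<Sum>y\<in>R \<times> A. (cmod (u k y))\<^sup>2))"
    unfolding cmod_sq_sum sum_distrib_left by (simp add: mult_ac)
  finally show ?thesis .
qed

text \<open>The right copy of \<phi> carries \<epsilon>. Exchanging A and C in the left copy
  produces its conjugate, and the two phases cancel; renaming the summation indices then returns
  \<tau> to b_R C. This is where the move of \<tau> is seen to preserve its expectation.\<close>

lemma H_mid: "H (\<lambda>_. 1) Y (\<lambda>_. 1) = (\<Sum>m\<in>M. Y m * of_real (\<Sum>x\<in>A \<times> L. (cmod (v m x))\<^sup>2))"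
proof -
  have "H (\<lambda>_. 1) Y (\<lambda>_. 1) = (\<Sum>a\<in>A. \<Sum>l\<in>L. \<Sum>r\<in>R. \<Sum>c\<in>A. cnj (\<phi> (a, l) (r, c)) * (\<Sum>m\<in>M. (Y m * (\<epsilon> * v m (c, l))) * f m (r, a)))"
    unfolding H_eq using reconstruct_u by (intro sum.cong refl) simp
  also have "\<dots> = (\<Sum>a\<in>A. \<Sum>l\<in>L. \<Sum>r\<in>R. \<Sum>c\<in>A. cnj (\<phi> (c, l) (r, a)) * (\<Sum>m\<in>M. Y m * v m (c, l) * f m (r, a)))"
  proof (intro sum.cong refl)
    fix a l r c assume al: "a \<in> A" "l \<in> L" "r \<in> R" "c \<in> A"
    have "cnj \<epsilon> * \<epsilon> = 1"
      using eps complex_norm_square[of \<epsilon>] by (simp add: mult.commute)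
    then have eq: "cnj (\<epsilon> * x) * (y * (\<epsilon> * v) * f) = cnj x * (y * v * f)" for x y v f
    proof -
      have "cnj (\<epsilon> * x) * (y * (\<epsilon> * v) * f) = (cnj \<epsilon> * \<epsilon>) * (cnj x * (y * v * f))"
        by (simp only: complex_cnj_mult mult_ac)
      then show ?thesis using \<open>cnj \<epsilon> * \<epsilon> = 1\<close> by simp
    qed
    show "cnj (\<phi> (a, l) (r, c)) * (\<Sum>m\<in>M. (Y m * (\<epsilon> * v m (c, l))) * f m (r, a)) =
        cnj (\<phi> (c, l) (r, a)) * (\<Sum>m\<in>M. Y m * v m (c, l) * f m (r, a))"
      by (simp only: sym[OF al] sum_distrib_left eq)
  qed
  also have "\<dots> = (\<Sum>c\<in>A. \<Sum>l\<in>L. \<Sum>r\<in>R. \<Sum>a\<in>A. cnj (\<phi> (c, l) (r, a)) * (\<Sum>m\<in>M. Y m * v m (c, l) * f m (r, a)))"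
    by (simp only: sum.swap[of _ L A] sum.swap[of _ R A])
      (rule sum.cong[OF refl], rule sum.cong[OF refl], rule sum.swap)
  also have "\<dots> = (\<Sum>x\<in>A \<times> L. \<Sum>y\<in>R \<times> A. \<Sum>m\<in>M. Y m * v m x * (f m y * cnj (\<phi> x y)))"
    by (simp add: sum.cartesian_product' sum_distrib_left sum_distrib_right mult_ac)
  also have "\<dots> = (\<Sum>m\<in>M. \<Sum>x\<in>A \<times> L. \<Sum>y\<in>R \<times> A. Y m * v m x * (f m y * cnj (\<phi> x y)))"
    by (simp only: sum.swap[of _ M "R \<times> A"] sum.swap[of _ M "A \<times> L"])
  also have "\<dots> = (\<Sum>m\<in>M. \<Sum>x\<in>A \<times> L. Y m * (cnj (v m x) * v m x))"
    by (intro sum.cong refl, simp only: sum_distrib_left[symmetric])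
      (simp add: v_def mult_ac)
  also have "\<dots> = (\<Sum>m\<in>M. Y m * of_real (\<Sum>x\<in>A \<times> L. (cmod (v m x))\<^sup>2))"
    unfolding cmod_sq_sum sum_distrib_left by (rule refl)
  finally show ?thesis .
qed

lemma H_last: "H (\<lambda>_. 1) (\<lambda>_. 1) Z = (\<Sum>a\<in>A. Z a * of_real (\<Sum>l\<in>L. \<Sum>y\<in>R \<times> A. (cmod (\<phi> (a, l) y))\<^sup>2))"
proof -
  have "H (\<lambda>_. 1) (\<lambda>_. 1) Z = (\<Sum>a\<in>A. \<Sum>l\<in>L. \<Sum>r\<in>R. \<Sum>c\<in>A. Z a * (cnj (\<phi> (a, l) (r, c)) * \<phi> (a, l) (r, c)))"
    unfolding H_eq using reconstruct_u reconstruct_v by (intro sum.cong refl) simp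
  also have "\<dots> = (\<Sum>a\<in>A. Z a * of_real (\<Sum>l\<in>L. \<Sum>y\<in>R \<times> A. (cmod (\<phi> (a, l) y))\<^sup>2))"
    unfolding of_real_sum[of _ L] cmod_sq_sum by (simp add: sum.cartesian_product' sum_distrib_left)
  finally show ?thesis .
qed

text \<open>The diagonal entry at \<open>a\<close> of the unnormalised marginal of \<phi> on
  A.\<close>

definition "weight a = (\<Sum>l\<in>L. \<Sum>y\<in>R \<times> A. (cmod (\<phi> (a, l) y))\<^sup>2)"

lemma weight_zero: "a \<in> A \<Longrightarrow> w a = 0 \<Longrightarrow> weight a = 0"
  unfolding weight_def by (intro sum.neutral ballI) (simp add: phi_zero)

lemma H_ones: "H (\<lambda>_. 1) (\<lambda>_. 1) (\<lambda>_. 1) = of_real Q"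
  unfolding H_one sum_u_sq[symmetric] by simp

text \<open>The power of a zero eigenvalue is set to 0 because \<open>H_bound_half\<close> asks for
  |X k|^2 \<le> s k and |Y m|^2 \<le> t m. The exponential on the right does not follow this
  convention at such terms; \<open>G_zero\<close> makes their coefficients vanish.\<close>

lemma H_exp:
  "H (\<lambda>k. if s k = 0 then 0 else exp (of_real (ln (s k)) * z))
     (\<lambda>m. if t m = 0 then 0 else exp (of_real (ln (t m)) * z))
     (\<lambda>a. if w a = 0 then 0 else exp (- of_real (ln (w a)) * z)) =
   (\<Sum>i\<in>K \<times> M \<times> A. (case i of (k, m, a) \<Rightarrow> G k m a) *
      exp (of_real (case i of (k, m, a) \<Rightarrow> ln (s k) + ln (t m) - ln (w a)) * z))"
  unfolding H_def sum.cartesian_product' prod.case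
proof (intro sum.cong refl)
  fix k m a assume "k \<in> K" "m \<in> M" "a \<in> A"
  then show "G k m a * ((if s k = 0 then 0 else exp (of_real (ln (s k)) * z)) *
     (if t m = 0 then 0 else exp (of_real (ln (t m)) * z)) *
     (if w a = 0 then 0 else exp (- of_real (ln (w a)) * z))) =
    G k m a * exp (of_real (ln (s k) + ln (t m) - ln (w a)) * z)"
    using G_zero[of k m a]
    by (cases "s k = 0 \<or> t m = 0 \<or> w a = 0") (auto simp: exp_add[symmetric] algebra_simps)
qed

text \<open>The product rule at z = 0: the derivative of the exponential sum splits into the
  expectations of three logarithms, each with the other two operators trivial.\<close>

lemma H_distrib:
  "H X (\<lambda>_. 1) (\<lambda>_. 1) + H (\<lambda>_. 1) Y (\<lambda>_. 1) + H (\<lambda>_. 1) (\<lambda>_. 1) Z =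
   (\<Sum>i\<in>K \<times> M \<times> A. (case i of (k, m, a) \<Rightarrow> G k m a) * (case i of (k, m, a) \<Rightarrow> X k + Y m + Z a))"
  unfolding H_def sum.cartesian_product' prod.case
  by (simp only: sum.distrib[symmetric], intro sum.cong refl) (simp add: algebra_simps)

text \<open>The slope of the exponential sum at 0 is the expectation of ln \<sigma> + ln \<tau> - ln
  \<omega>, and \<open>exponential_sum_slope_nonpos\<close> makes it at most 0. The logarithm of the
  product splits only where both eigenvalues are positive; elsewhere the amplitude is 0.\<close>

theorem log_weights_le:
  "(\<Sum>k\<in>K. \<Sum>m\<in>M. (cmod (amp k m))\<^sup>2 * ln (s k * t m)) \<le> (\<Sum>a\<in>A. weight a * ln (w a))"
proof -
  have sq: "(cmod (exp (of_real x * z)))\<^sup>2 = exp x" if "Re z = 1 / 2" for x z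
    using that by (simp add: power2_eq_square exp_add[symmetric])
  let ?c = "\<lambda>i. case i of (k, m, a) \<Rightarrow> G k m a"
  let ?\<alpha> = "\<lambda>i. case i of (k, m, a) \<Rightarrow> ln (s k) + ln (t m) - ln (w a)"
  have "Re (\<Sum>i\<in>K \<times> M \<times> A. ?c i * of_real (?\<alpha> i)) \<le> 0"
  proof (rule exponential_sum_slope_nonpos[where h = "1 / 2" and q = Q])
    fix z :: complex assume "Re z = 0"
    then show "cmod (\<Sum>i\<in>K \<times> M \<times> A. ?c i * exp (of_real (?\<alpha> i) * z)) \<le> Q"
      unfolding H_exp[symmetric] by (intro H_bound_unit) auto
  next
    fix z :: complex assume z: "Re z = 1 / 2"
    have "w a * (cmod (exp (- of_real (ln (w a)) * z)))\<^sup>2 \<le> 1" if "a \<in> A" "w a \<noteq> 0" for a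
      using sq[OF z, of "- ln (w a)"] that w_nonneg[of a] by (simp add: exp_minus)
    then show "cmod (\<Sum>i\<in>K \<times> M \<times> A. ?c i * exp (of_real (?\<alpha> i) * z)) \<le> Q"
      unfolding H_exp[symmetric]
      using s_nonneg t_nonneg sq[OF z] by (intro H_bound_half) (auto simp: order_le_less)
  next
    show "(\<Sum>i\<in>K \<times> M \<times> A. ?c i) = of_real Q"
      using H_ones unfolding H_def sum.cartesian_product' by simp
  qed (use Q_nonneg in auto)
  also have "(\<Sum>i\<in>K \<times> M \<times> A. ?c i * of_real (?\<alpha> i)) =
    H (\<lambda>k. of_real (ln (s k))) (\<lambda>_. 1) (\<lambda>_. 1) + H (\<lambda>_. 1) (\<lambda>m. of_real (ln (t m))) (\<lambda>_. 1)
      + H (\<lambda>_. 1) (\<lambda>_. 1) (\<lambda>a. of_real (- ln (w a)))"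
    unfolding H_distrib by (intro sum.cong refl) (auto split: prod.splits)
  also have "\<dots> = of_real ((\<Sum>k\<in>K. ln (s k) * (\<Sum>m\<in>M. (cmod (amp k m))\<^sup>2))
     + (\<Sum>m\<in>M. ln (t m) * (\<Sum>k\<in>K. (cmod (amp k m))\<^sup>2)) - (\<Sum>a\<in>A. ln (w a) * weight a))"
    unfolding H_one H_mid H_last sum_amp_sq_u sum_amp_sq_v weight_def[symmetric]
    by (simp add: sum_negf)
  finally have le: "(\<Sum>k\<in>K. ln (s k) * (\<Sum>m\<in>M. (cmod (amp k m))\<^sup>2))
     + (\<Sum>m\<in>M. ln (t m) * (\<Sum>k\<in>K. (cmod (amp k m))\<^sup>2)) \<le> (\<Sum>a\<in>A. ln (w a) * weight a)"
    by simp
  have "(\<Sum>k\<in>K. \<Sum>m\<in>M. (cmod (amp k m))\<^sup>2 * ln (s k * t m)) =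
    (\<Sum>k\<in>K. \<Sum>m\<in>M. ln (s k) * (cmod (amp k m))\<^sup>2 + ln (t m) * (cmod (amp k m))\<^sup>2)"
  proof (intro sum.cong refl)
    fix k m assume km: "k \<in> K" "m \<in> M"
    show "(cmod (amp k m))\<^sup>2 * ln (s k * t m) = ln (s k) * (cmod (amp k m))\<^sup>2 + ln (t m) * (cmod (amp k m))\<^sup>2"
      using supp[OF km] s_nonneg[OF km(1)] t_nonneg[OF km(2)]
      by (cases "s k = 0 \<or> t m = 0") (auto simp: ln_mult algebra_simps)
  qed
  also have "\<dots> = (\<Sum>k\<in>K. ln (s k) * (\<Sum>m\<in>M. (cmod (amp k m))\<^sup>2))
     + (\<Sum>m\<in>M. ln (t m) * (\<Sum>k\<in>K. (cmod (amp k m))\<^sup>2))"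
    by (simp add: sum.distrib sum_distrib_left) (rule sum.swap)
  finally show ?thesis using le by (simp add: mult.commute)
qed

end

section \<open>Spectral calculus of Hermitian matrices\<close>

lemma mat_adjoint_dim [simp]: "dim_row (mat_adjoint A) = dim_col A" "dim_col (mat_adjoint A) = dim_row A"
  unfolding mat_adjoint_def by auto

lemma mat_adjoint_carrier [simp]: "A \<in> carrier_mat n m \<Longrightarrow> mat_adjoint A \<in> carrier_mat m n"
  by (intro carrier_matI) auto

lemma mat_adjoint_index [simp]:
  "i < dim_col A \<Longrightarrow> j < dim_row A \<Longrightarrow> mat_adjoint A $$ (i, j) = cnj (A $$ (j, i))"
  for A :: "complex mat"
  unfolding mat_adjoint_def by (simp add: mat_of_rows_index conjugate_complex_def)

lemma times_mat_index:
  "i < dim_row A \<Longrightarrow> j < dim_col B \<Longrightarrow> dim_col A = dim_row B \<Longrightarrow>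
   (A * B) $$ (i, j) = (\<Sum>k<dim_row B. A $$ (i, k) * B $$ (k, j))"
  by (simp add: scalar_prod_def atLeast0LessThan)

lemma mult_mat_vec_index:
  "i < dim_row A \<Longrightarrow> dim_col A = dim_vec v \<Longrightarrow> (A *\<^sub>v v) $ i = (\<Sum>k<dim_vec v. A $$ (i, k) * v $ k)"
  by (simp add: scalar_prod_def atLeast0LessThan)

lemma mat_adjoint_adjoint [simp]: "mat_adjoint (mat_adjoint A) = (A :: complex mat)"
  by (rule eq_matI) auto

lemma mat_adjoint_one [simp]: "mat_adjoint (1\<^sub>m n) = (1\<^sub>m n :: complex mat)"
  by (rule eq_matI) auto

lemma mat_adjoint_times:
  fixes A B :: "complex mat"
  assumes "dim_col A = dim_row B"
  shows "mat_adjoint (A * B) = mat_adjoint B * mat_adjoint A"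
proof (rule eq_matI)
  fix i j assume "i < dim_row (mat_adjoint B * mat_adjoint A)" "j < dim_col (mat_adjoint B * mat_adjoint A)"
  then show "mat_adjoint (A * B) $$ (i, j) = (mat_adjoint B * mat_adjoint A) $$ (i, j)"
    using assms by (simp add: times_mat_index mult.commute del: index_mult_mat(1))
qed auto

lemma diag_cmat_dim [simp]: "dim_row (diag_cmat n f) = n" "dim_col (diag_cmat n f) = n"
  unfolding diag_cmat_def by auto

lemma diag_cmat_carrier [simp]: "diag_cmat n f \<in> carrier_mat n n"
  by (intro carrier_matI) auto

lemma diag_cmat_index [simp]: "i < n \<Longrightarrow> j < n \<Longrightarrow> diag_cmat n f $$ (i, j) = (if i = j then f i else 0)"
  unfolding diag_cmat_def by auto

lemma times_diag_cmat_index: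
  assumes "i < dim_row A" "dim_col A = n" "j < n"
  shows "(A * diag_cmat n f) $$ (i, j) = A $$ (i, j) * f j"
proof -
  have "(A * diag_cmat n f) $$ (i, j) = (\<Sum>k<n. A $$ (i, k) * diag_cmat n f $$ (k, j))"
    using assms by (subst times_mat_index) auto
  also have "\<dots> = (\<Sum>k<n. if k = j then A $$ (i, j) * f j else 0)"
    using assms by (intro sum.cong) auto
  finally show ?thesis using assms by simp
qed

lemma diag_conj_index:
  assumes "i < dim_row A" "j < dim_row A" "dim_col A = n"
  shows "(A * diag_cmat n f * mat_adjoint A) $$ (i, j) = (\<Sum>k<n. A $$ (i, k) * f k * cnj (A $$ (j, k)))"
  using assms by (subst times_mat_index) (auto simp: times_diag_cmat_index simp del: index_mult_mat(1))

lemma unitary_matD: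
  assumes "unitary_mat n U"
  shows "U \<in> carrier_mat n n" "mat_adjoint U * U = 1\<^sub>m n" "U * mat_adjoint U = 1\<^sub>m n"
  using assms mat_mult_left_right_inverse[of "mat_adjoint U" n U] unfolding unitary_mat_def by auto

lemma complex_eigenvector_exists:
  assumes A: "A \<in> carrier_mat n n" and n: "0 < n"
  shows "\<exists>e v. eigenvector (A :: complex mat) v e"
proof -
  have "degree (char_poly A) = n" using degree_monic_char_poly[OF A] by simp
  then have "\<not> constant (poly (char_poly A))" using n by (simp add: constant_degree)
  from fundamental_theorem_of_algebra[OF this] obtain e where "poly (char_poly A) e = 0" ..
  then show ?thesis using eigenvalue_root_char_poly[OF A] unfolding eigenvalue_def by blast
qed

text \<open>Gram-Schmidt applied to a basis that starts with \<open>v\<close> keeps \<open>v\<close>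
  as its first vector. The result is orthogonal but not normalised, hence the division by the norms;
  \<open>c\<close> is the normalisation of \<open>v\<close>.\<close>

lemma unitary_first_column:
  assumes v: "v \<in> carrier_vec n" "v \<noteq> 0\<^sub>v n"
  shows "\<exists>W c. unitary_mat n W \<and> (\<forall>i<n. W $$ (i, 0) = c * v $ i)"
proof -
  interpret cof_vec_space n "TYPE(complex)" .
  define b where "b = basis_completion v"
  define ws where "ws = gram_schmidt n b"
  from basis_completion[OF v, folded b_def]
  have dist_b: "distinct b" and indep: "\<not> lin_dep (set b)" and b: "set b \<subseteq> carrier_vec n"
    and hdb: "hd b = v" and len_b: "length b = n" by auto
  have n: "0 < n" using v by (cases n) auto
  from hdb len_b n obtain vs where bv: "b = v # vs" by (cases b) auto
  from gram_schmidt_result[OF b dist_b indep refl, folded ws_def]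
  have ws: "set ws \<subseteq> carrier_vec n" "corthogonal ws" "length ws = n" by (auto simp: len_b)
  from gram_schmidt_hd[OF v(1), of vs, folded bv] have hdws: "hd ws = v" unfolding ws_def .
  have ws0: "ws ! 0 = v" using hdws ws(3) n by (metis hd_conv_nth length_0_conv less_numeral_extra(3))
  have wsc: "ws ! i \<in> carrier_vec n" if "i < n" for i using ws that by auto
  define N where "N i = (\<Sum>k<n. (cmod (ws ! i $ k))\<^sup>2)" for i
  have ip: "ws ! j \<bullet>c ws ! i = (\<Sum>k<n. cnj (ws ! i $ k) * ws ! j $ k)" if "i < n" "j < n" for i j
    using wsc[OF that(1)] wsc[OF that(2)]
    by (simp add: scalar_prod_def atLeast0LessThan conjugate_complex_def mult.commute)
  have N0: "N i \<noteq> 0" if "i < n" for i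
  proof -
    have "ws ! i \<bullet>c ws ! i \<noteq> 0" using corthogonalD[OF ws(2)] that ws(3) by blast
    then have "of_real (N i) \<noteq> (0 :: complex)"
      unfolding N_def cmod_sq_sum ip[OF that that] .
    then show ?thesis by simp
  qed
  have Npos: "0 < N i" if "i < n" for i
    using N0[OF that] sum_nonneg[of "{..<n}" "\<lambda>k. (cmod (ws ! i $ k))\<^sup>2"] unfolding N_def by fastforce
  define W where "W = mat n n (\<lambda>(i, j). ws ! j $ i / of_real (sqrt (N j)))"
  have "mat_adjoint W * W = 1\<^sub>m n"
  proof (rule eq_matI)
    fix i j assume "i < dim_row (1\<^sub>m n)" "j < dim_col (1\<^sub>m n)"
    then have i: "i < n" and j: "j < n" by auto
    have "(mat_adjoint W * W) $$ (i, j) = (\<Sum>k<n. cnj (ws ! i $ k) * ws ! j $ k) / (of_real (sqrt (N i)) * of_real (sqrt (N j)))"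
      using i j by (subst times_mat_index) (auto simp: W_def sum_divide_distrib intro!: sum.cong)
    also have "\<dots> = (if i = j then 1 else 0)"
    proof (cases "i = j")
      case True
      have "(\<Sum>k<n. cnj (ws ! i $ k) * ws ! i $ k) = of_real (N i)" unfolding N_def cmod_sq_sum ..
      moreover have "of_real (sqrt (N i)) * of_real (sqrt (N i)) = (of_real (N i) :: complex)"
        using Npos[OF i] by (simp add: of_real_mult[symmetric])
      ultimately show ?thesis using True N0[OF i] by simp
    next
      case False
      then have "ws ! j \<bullet>c ws ! i = 0" using corthogonalD[OF ws(2)] i j ws(3) by metis
      then show ?thesis using False by (simp add: ip[OF i j])
    qed
    finally show "(mat_adjoint W * W) $$ (i, j) = 1\<^sub>m n $$ (i, j)" using i j by simp
  qed (auto simp: W_def)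
  then have "unitary_mat n W" unfolding unitary_mat_def by (auto simp: W_def)
  moreover have "W $$ (i, 0) = 1 / of_real (sqrt (N 0)) * v $ i" if "i < n" for i
    using that n ws0 unfolding W_def by simp
  ultimately show ?thesis by blast
qed

lemma unitary_mat_times:
  assumes "unitary_mat n U" "unitary_mat n V"
  shows "unitary_mat n (U * V)"
proof -
  note U = unitary_matD[OF assms(1)] and V = unitary_matD[OF assms(2)]
  have "mat_adjoint (U * V) * (U * V) = mat_adjoint V * (mat_adjoint U * U * V)"
    using U(1) V(1) by (simp add: mat_adjoint_times assoc_mult_mat[of _ n n _ n _ n])
  then show ?thesis using U V unfolding unitary_mat_def by simp
qed

text \<open>Deflation: conjugation with a unitary whose first column is an eigenvector clears the
  first column below the diagonal; hermiticity then clears the first row and makes the eigenvalue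
  real. The remaining block is handled by the induction hypothesis.\<close>

theorem hermitian_spectral_decomposition:
  assumes "A \<in> carrier_mat n n" "hermitian_mat A"
  shows "\<exists>U lam. unitary_mat n U \<and> A = U * diag_cmat n (\<lambda>i. complex_of_real (lam i)) * mat_adjoint U"
  using assms
proof (induction n arbitrary: A)
  case 0
  have "unitary_mat 0 (1\<^sub>m 0)" unfolding unitary_mat_def by auto
  moreover have "A = 1\<^sub>m 0 * diag_cmat 0 (\<lambda>i. complex_of_real (0 :: real)) * mat_adjoint (1\<^sub>m 0)"
    using 0 by (intro eq_matI) auto
  ultimately show ?case by (intro exI[of _ "1\<^sub>m 0"] exI[of _ "\<lambda>_. 0"]) simp
next
  case (Suc m)
  let ?n = "Suc m"
  note A = Suc.prems(1)
  have hA: "mat_adjoint A = A" using Suc.prems(2) unfolding hermitian_mat_def .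
  obtain e v where ev: "eigenvector A v e" using complex_eigenvector_exists[OF A] by auto
  then have v: "v \<in> carrier_vec ?n" "v \<noteq> 0\<^sub>v ?n" "A *\<^sub>v v = e \<cdot>\<^sub>v v"
    using A unfolding eigenvector_def by auto
  obtain W c where uW: "unitary_mat ?n W" and W0: "\<And>i. i < ?n \<Longrightarrow> W $$ (i, 0) = c * v $ i"
    using unitary_first_column[OF v(1,2)] by blast
  note W = unitary_matD[OF uW]
  define A' where "A' = mat_adjoint W * A * W"
  have A': "A' \<in> carrier_mat ?n ?n" using W(1) A unfolding A'_def by auto
  have hA': "mat_adjoint A' = A'"
    using W(1) A unfolding A'_def
    by (simp add: mat_adjoint_times hA assoc_mult_mat[of _ ?n ?n _ ?n _ ?n] mult_carrier_mat[of _ ?n ?n _ ?n])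
  have AW0: "(A * W) $$ (i, 0) = e * W $$ (i, 0)" if i: "i < ?n" for i
  proof -
    have "(A * W) $$ (i, 0) = c * (\<Sum>k<?n. A $$ (i, k) * v $ k)"
      using A W(1) i by (subst times_mat_index) (auto simp: W0 sum_distrib_left mult_ac simp del: sum.lessThan_Suc intro!: sum.cong)
    also have "(\<Sum>k<?n. A $$ (i, k) * v $ k) = (A *\<^sub>v v) $ i"
      using A v(1) i by (subst mult_mat_vec_index) auto
    finally show ?thesis using v(1) i unfolding v(3) W0[OF i] by simp
  qed
  have A'0: "A' $$ (i, 0) = (if i = 0 then e else 0)" if i: "i < ?n" for i
  proof -
    have "A' $$ (i, 0) = (mat_adjoint W * (A * W)) $$ (i, 0)"
      using W(1) A unfolding A'_def by (simp add: assoc_mult_mat[of _ ?n ?n _ ?n _ ?n] mult_carrier_mat[of _ ?n ?n _ ?n])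
    also have "\<dots> = e * (mat_adjoint W * W) $$ (i, 0)"
      using W(1) A i by (subst (1 2) times_mat_index)
        (auto simp: AW0 sum_distrib_left mult_ac simp del: index_mult_mat(1) sum.lessThan_Suc intro!: sum.cong)
    finally show ?thesis using i unfolding W(2) by simp
  qed
  have A'sym: "A' $$ (j, i) = cnj (A' $$ (i, j))" if "i < ?n" "j < ?n" for i j
    using arg_cong[OF hA', of "\<lambda>M. M $$ (j, i)"] A' that by simp
  have A'0': "A' $$ (0, i) = (if i = 0 then e else 0)" if i: "i < ?n" for i
    using A'sym[OF i, of 0] A'0[OF i] A'0[of 0] A'sym[of 0 0] by auto
  have e_real: "e = of_real (Re e)"
    using A'sym[of 0 0] A'0[of 0] by (simp add: complex_eq_iff)
  define B where "B = mat m m (\<lambda>(i, j). A' $$ (Suc i, Suc j))"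
  have "hermitian_mat B"
    unfolding hermitian_mat_def
    by (rule eq_matI) (auto simp: B_def intro: A'sym[symmetric])
  moreover have B: "B \<in> carrier_mat m m" unfolding B_def by simp
  ultimately obtain U' lam' where uU': "unitary_mat m U'"
    and BU: "B = U' * diag_cmat m (\<lambda>i. complex_of_real (lam' i)) * mat_adjoint U'"
    using Suc.IH by blast
  note U' = unitary_matD[OF uU']
  \<comment> \<open>\<open>U2\<close> is the direct sum of the 1 x 1 identity and
    \<open>U'\<close>.\<close>
  define U2 where "U2 = mat ?n ?n (\<lambda>(i, j). case i of 0 \<Rightarrow> (if j = 0 then 1 else 0)
      | Suc i' \<Rightarrow> (case j of 0 \<Rightarrow> 0 | Suc j' \<Rightarrow> U' $$ (i', j')))"
  define lam where "lam = case_nat (Re e) lam'"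
  have U2: "U2 \<in> carrier_mat ?n ?n" unfolding U2_def by simp
  have "mat_adjoint U2 * U2 = 1\<^sub>m ?n"
  proof (rule eq_matI)
    fix i j assume "i < dim_row (1\<^sub>m ?n)" "j < dim_col (1\<^sub>m ?n)"
    then have ij: "i < ?n" "j < ?n" by auto
    have in': "(\<Sum>k<m. cnj (U' $$ (k, i')) * U' $$ (k, j')) = (if i' = j' then 1 else 0)"
      if "i' < m" "j' < m" for i' j'
      using arg_cong[OF U'(2), of "\<lambda>M. M $$ (i', j')"] U'(1) that
      by (simp add: times_mat_index del: index_mult_mat(1))
    have "(mat_adjoint U2 * U2) $$ (i, j) = (\<Sum>k<?n. cnj (U2 $$ (k, i)) * U2 $$ (k, j))"
      using ij U2 by (subst times_mat_index) auto
    also have "\<dots> = (if i = j then 1 else 0)"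
      unfolding sum.lessThan_Suc_shift using ij in'
      by (cases i; cases j) (auto simp: U2_def)
    finally show "(mat_adjoint U2 * U2) $$ (i, j) = 1\<^sub>m ?n $$ (i, j)" using ij by simp
  qed (use U2 in auto)
  then have uU2: "unitary_mat ?n U2" using U2 unfolding unitary_mat_def by simp
  have A'D: "A' = U2 * diag_cmat ?n (\<lambda>i. complex_of_real (lam i)) * mat_adjoint U2"
  proof (rule eq_matI)
    fix i j assume "i < dim_row (U2 * diag_cmat ?n (\<lambda>i. complex_of_real (lam i)) * mat_adjoint U2)"
      "j < dim_col (U2 * diag_cmat ?n (\<lambda>i. complex_of_real (lam i)) * mat_adjoint U2)"
    then have ij: "i < ?n" "j < ?n" using U2 by auto
    have in': "A' $$ (Suc i', Suc j') = (\<Sum>k<m. U' $$ (i', k) * of_real (lam' k) * cnj (U' $$ (j', k)))"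
      if "i' < m" "j' < m" for i' j'
      using arg_cong[OF BU, of "\<lambda>M. M $$ (i', j')"] U'(1) that
      by (simp add: diag_conj_index B_def del: index_mult_mat(1))
    have "(U2 * diag_cmat ?n (\<lambda>i. complex_of_real (lam i)) * mat_adjoint U2) $$ (i, j) =
      (\<Sum>k<?n. U2 $$ (i, k) * of_real (lam k) * cnj (U2 $$ (j, k)))"
      using ij U2 by (subst diag_conj_index) auto
    also have "\<dots> = A' $$ (i, j)"
      unfolding sum.lessThan_Suc_shift using ij in' A'0[of i] A'0'[of j] e_real
      by (cases i; cases j) (auto simp: U2_def lam_def)
    finally show "A' $$ (i, j) = (U2 * diag_cmat ?n (\<lambda>i. complex_of_real (lam i)) * mat_adjoint U2) $$ (i, j)" ..
  qed (use A' U2 in auto)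
  have "A = (W * mat_adjoint W) * A * (W * mat_adjoint W)" using W A by simp
  also have "\<dots> = W * A' * mat_adjoint W"
    unfolding A'_def using W(1) A by (simp add: assoc_mult_mat[of _ ?n ?n _ ?n _ ?n] mult_carrier_mat[of _ ?n ?n _ ?n])
  also have "\<dots> = (W * U2) * diag_cmat ?n (\<lambda>i. complex_of_real (lam i)) * mat_adjoint (W * U2)"
    unfolding A'D using W(1) U2
    by (simp add: mat_adjoint_times assoc_mult_mat[of _ ?n ?n _ ?n _ ?n] mult_carrier_mat[of _ ?n ?n _ ?n])
  finally show ?case using unitary_mat_times[OF uW uU2] by blast
qed

text \<open>The choice operator inside \<open>mat_fun\<close> returns a true diagonalisation because
  one exists. The obtained \<open>U\<close> and \<open>lam\<close> are exactly that choice, so they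
  can be used to compute \<open>mat_fun f A\<close>.\<close>

lemma mat_fun_spectral:
  assumes A: "A \<in> carrier_mat n n" "hermitian_mat A"
  obtains U lam where "unitary_mat n U" "A = U * diag_cmat n (\<lambda>i. complex_of_real (lam i)) * mat_adjoint U"
    "mat_fun f A = U * diag_cmat n (\<lambda>i. complex_of_real (f (lam i))) * mat_adjoint U"
proof -
  have n: "dim_row A = n" using A by simp
  define P where "P = (\<lambda>(U, lam). unitary_mat n U \<and> A = U * diag_cmat n (\<lambda>i. complex_of_real (lam i)) * mat_adjoint U)"
  obtain U lam where Ul: "(SOME x. P x) = (U, lam)" by (cases "SOME x. P x")
  have "\<exists>x. P x" using hermitian_spectral_decomposition[OF A] unfolding P_def by auto
  from someI_ex[OF this] have "P (U, lam)" unfolding Ul .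
  moreover have "mat_fun f A = U * diag_cmat n (\<lambda>i. complex_of_real (f (lam i))) * mat_adjoint U"
    unfolding mat_fun_def Let_def n using Ul unfolding P_def by simp
  ultimately show ?thesis using that unfolding P_def by auto
qed

lemma mat_fun_carrier:
  assumes A: "A \<in> carrier_mat n n" "hermitian_mat A"
  shows "mat_fun f A \<in> carrier_mat n n"
  using mat_fun_spectral[OF A, of f] unitary_matD(1) by (metis diag_cmat_carrier mat_adjoint_carrier mult_carrier_mat)

lemma diag_conj_eigen_coeff:
  assumes U: "unitary_mat n U" and v: "v \<in> carrier_vec n"
  shows "mat_adjoint U *\<^sub>v ((U * diag_cmat n f * mat_adjoint U) *\<^sub>v v) = vec n (\<lambda>i. f i * (mat_adjoint U *\<^sub>v v) $ i)"
proof -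
  note U = unitary_matD[OF U]
  have "mat_adjoint U *\<^sub>v ((U * diag_cmat n f * mat_adjoint U) *\<^sub>v v) = (mat_adjoint U * (U * diag_cmat n f * mat_adjoint U)) *\<^sub>v v"
    using U v by (intro assoc_mult_mat_vec[symmetric]) auto
  also have "mat_adjoint U * (U * diag_cmat n f * mat_adjoint U) = (mat_adjoint U * U) * diag_cmat n f * mat_adjoint U"
    using U(1) by (simp add: assoc_mult_mat[of _ n n _ n _ n])
  also have "\<dots> *\<^sub>v v = diag_cmat n f *\<^sub>v (mat_adjoint U *\<^sub>v v)"
    using U v by (simp add: assoc_mult_mat_vec[of _ n n _ n])
  also have "\<dots> = vec n (\<lambda>i. f i * (mat_adjoint U *\<^sub>v v) $ i)"
  proof (rule eq_vecI)
    fix i assume "i < dim_vec (vec n (\<lambda>i. f i * (mat_adjoint U *\<^sub>v v) $ i))"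
    then have i: "i < n" by simp
    let ?u = "mat_adjoint U *\<^sub>v v"
    have u: "?u \<in> carrier_vec n"
      using mult_mat_vec_carrier[OF mat_adjoint_carrier[OF U(1)] v] .
    have "(diag_cmat n f *\<^sub>v ?u) $ i = (\<Sum>k<n. diag_cmat n f $$ (i, k) * ?u $ k)"
      by (subst mult_mat_vec_index) (use i carrier_vecD[OF u] in \<open>simp_all del: index_mult_mat_vec dim_mult_mat_vec diag_cmat_index\<close>)
    also have "\<dots> = (\<Sum>k<n. if k = i then f i * ?u $ i else 0)"
      using i by (intro sum.cong) auto
    finally show "(diag_cmat n f *\<^sub>v ?u) $ i = vec n (\<lambda>i. f i * ?u $ i) $ i" using i by (simp del: index_mult_mat_vec)
  qed (use U in auto)
  finally show ?thesis .
qed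

text \<open>In the coordinates of the diagonalisation chosen by \<open>mat_fun\<close>, the vector
  \<open>v\<close> lives on the indices with \<open>lam i = x\<close>, where
  \<open>f (lam i)\<close> is \<open>f x\<close>. Every later evaluation of \<open>mat_fun\<close>
  goes through known eigenvectors in this way, so the arbitrary choice does no harm.\<close>

lemma mat_fun_eigenvector:
  assumes A: "A \<in> carrier_mat n n" "hermitian_mat A" and v: "v \<in> carrier_vec n"
    and ev: "A *\<^sub>v v = complex_of_real x \<cdot>\<^sub>v v"
  shows "mat_fun f A *\<^sub>v v = complex_of_real (f x) \<cdot>\<^sub>v v"
proof -
  obtain U lam where uU: "unitary_mat n U" and AU: "A = U * diag_cmat n (\<lambda>i. complex_of_real (lam i)) * mat_adjoint U"
    and fU: "mat_fun f A = U * diag_cmat n (\<lambda>i. complex_of_real (f (lam i))) * mat_adjoint U"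
    using mat_fun_spectral[OF A] by blast
  note U = unitary_matD[OF uU]
  let ?u = "mat_adjoint U *\<^sub>v v"
  have u: "?u \<in> carrier_vec n"
    using mult_mat_vec_carrier[OF mat_adjoint_carrier[OF U(1)] v] .
  have "vec n (\<lambda>i. complex_of_real (lam i) * ?u $ i) = complex_of_real x \<cdot>\<^sub>v ?u"
    using diag_conj_eigen_coeff[OF uU v, of "\<lambda>i. complex_of_real (lam i)"] v U(1)
    unfolding AU[symmetric] ev by (simp add: mult_mat_vec[of _ n n])
  then have coeff: "complex_of_real (lam i) * ?u $ i = complex_of_real x * ?u $ i" if "i < n" for i
  proof -
    have "vec n (\<lambda>i. complex_of_real (lam i) * ?u $ i) $ i = (complex_of_real x \<cdot>\<^sub>v ?u) $ i"
      unfolding \<open>vec n (\<lambda>i. complex_of_real (lam i) * ?u $ i) = complex_of_real x \<cdot>\<^sub>v ?u\<close> ..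
    then show ?thesis using that carrier_vecD[OF u]
      by (simp del: index_mult_mat_vec dim_mult_mat_vec)
  qed
  have "mat_adjoint U *\<^sub>v (mat_fun f A *\<^sub>v v) = vec n (\<lambda>i. complex_of_real (f (lam i)) * ?u $ i)"
    unfolding fU by (rule diag_conj_eigen_coeff[OF uU v])
  also have "\<dots> = complex_of_real (f x) \<cdot>\<^sub>v ?u"
  proof (rule eq_vecI)
    fix i assume "i < dim_vec (complex_of_real (f x) \<cdot>\<^sub>v ?u)"
    then have i: "i < n" using carrier_vecD[OF u] by (simp del: dim_mult_mat_vec)
    show "vec n (\<lambda>i. complex_of_real (f (lam i)) * ?u $ i) $ i = (complex_of_real (f x) \<cdot>\<^sub>v ?u) $ i"
      using coeff[OF i] i carrier_vecD[OF u] by (cases "lam i = x") (auto simp del: index_mult_mat_vec dim_mult_mat_vec)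
  qed (use u U in auto)
  also have "\<dots> = mat_adjoint U *\<^sub>v (complex_of_real (f x) \<cdot>\<^sub>v v)"
    using v U(1) by (simp add: mult_mat_vec[of _ n n])
  finally have "U *\<^sub>v (mat_adjoint U *\<^sub>v (mat_fun f A *\<^sub>v v)) = U *\<^sub>v (mat_adjoint U *\<^sub>v (complex_of_real (f x) \<cdot>\<^sub>v v))"
    by simp
  moreover have "U *\<^sub>v (mat_adjoint U *\<^sub>v y) = y" if "y \<in> carrier_vec n" for y
    using U that by (simp add: assoc_mult_mat_vec[symmetric, of _ n n _ n])
  ultimately show ?thesis using v mult_mat_vec_carrier[OF mat_fun_carrier[OF A] v] by simp
qed

section \<open>Expectations, and the relative entropy of a pure state\<close>

lemma cinner_carrier: "v \<in> carrier_vec n \<Longrightarrow> cinner v w = (\<Sum>i<n. cnj (v $ i) * w $ i)"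
  unfolding cinner_def by auto

lemma cinner_mult_mat_vec:
  assumes "A \<in> carrier_mat n m" "v \<in> carrier_vec n" "w \<in> carrier_vec m"
  shows "cinner v (A *\<^sub>v w) = cinner (mat_adjoint A *\<^sub>v v) w"
proof -
  have "cinner v (A *\<^sub>v w) = (\<Sum>i<n. \<Sum>j<m. cnj (v $ i) * (A $$ (i, j) * w $ j))"
    using assms unfolding cinner_carrier[OF assms(2)]
    by (intro sum.cong refl) (auto simp: mult_mat_vec_index sum_distrib_left simp del: index_mult_mat_vec)
  also have "\<dots> = (\<Sum>j<m. cnj ((mat_adjoint A *\<^sub>v v) $ j) * w $ j)"
    using assms by (subst sum.swap, intro sum.cong refl)
      (auto simp: mult_mat_vec_index sum_distrib_left sum_distrib_right mult_ac simp del: index_mult_mat_vec)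
  also have "\<dots> = cinner (mat_adjoint A *\<^sub>v v) w" using assms unfolding cinner_def by simp
  finally show ?thesis .
qed

text \<open>Completeness expands \<psi> in the eigenvectors \<open>E i\<close>, and
  \<open>mat_fun_eigenvector\<close> evaluates the matrix on each of them; the hidden
  diagonalisation never has to be compared with \<open>E\<close>.\<close>

lemma spectral_expectation:
  assumes M: "M \<in> carrier_mat n n" "hermitian_mat M" and \<psi>: "\<psi> \<in> carrier_vec n" and I: "finite I"
    and E: "\<And>i. i \<in> I \<Longrightarrow> E i \<in> carrier_vec n"
    and ev: "\<And>i. i \<in> I \<Longrightarrow> M *\<^sub>v E i = complex_of_real (x i) \<cdot>\<^sub>v E i"
    and complete: "\<And>a b. a < n \<Longrightarrow> b < n \<Longrightarrow> (\<Sum>i\<in>I. E i $ a * cnj (E i $ b)) = (if a = b then 1 else 0)"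
  shows "cinner \<psi> (mat_fun f M *\<^sub>v \<psi>) = complex_of_real (\<Sum>i\<in>I. (cmod (cinner (E i) \<psi>))\<^sup>2 * f (x i))"
proof -
  let ?F = "mat_fun f M"
  have F: "?F \<in> carrier_mat n n" by (rule mat_fun_carrier[OF M])
  have frame: "parseval_frame I {..<n} (\<lambda>i a. E i $ a)"
    unfolding parseval_frame_def using I complete by auto
  define c where "c i = cinner (E i) \<psi>" for i
  have c: "c i = (\<Sum>a<n. cnj (E i $ a) * \<psi> $ a)" if "i \<in> I" for i
    unfolding c_def using cinner_carrier[OF E[OF that]] .
  have \<psi>_exp: "\<psi> $ b = (\<Sum>i\<in>I. c i * E i $ b)" if "b < n" for b
    using frame_reconstruction[OF frame, of b "\<lambda>a. \<psi> $ a"] that by (simp add: c)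
  have F\<psi>: "(?F *\<^sub>v \<psi>) $ a = (\<Sum>i\<in>I. c i * (of_real (f (x i)) * E i $ a))" if a: "a < n" for a
  proof -
    have "(?F *\<^sub>v \<psi>) $ a = (\<Sum>b<n. \<Sum>i\<in>I. c i * (?F $$ (a, b) * E i $ b))"
      using F \<psi> a by (subst mult_mat_vec_index)
        (auto simp: \<psi>_exp sum_distrib_left mult_ac intro!: sum.cong)
    also have "\<dots> = (\<Sum>i\<in>I. c i * (?F *\<^sub>v E i) $ a)"
    proof (subst sum.swap, intro sum.cong refl)
      fix i assume "i \<in> I"
      then show "(\<Sum>b<n. c i * (?F $$ (a, b) * E i $ b)) = c i * (?F *\<^sub>v E i) $ a"
        using F E[of i] a by (subst mult_mat_vec_index) (auto simp: sum_distrib_left)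
    qed
    also have "\<dots> = (\<Sum>i\<in>I. c i * (of_real (f (x i)) * E i $ a))"
    proof (intro sum.cong refl)
      fix i assume i: "i \<in> I"
      show "c i * (?F *\<^sub>v E i) $ a = c i * (of_real (f (x i)) * E i $ a)"
        unfolding mat_fun_eigenvector[OF M E[OF i] ev[OF i]] using E[OF i] a by simp
    qed
    finally show ?thesis .
  qed
  have "cinner \<psi> (?F *\<^sub>v \<psi>) = (\<Sum>a<n. \<Sum>i\<in>I. cnj (\<psi> $ a) * (c i * (of_real (f (x i)) * E i $ a)))"
    unfolding cinner_carrier[OF \<psi>] by (intro sum.cong refl) (simp add: F\<psi> sum_distrib_left del: index_mult_mat_vec)
  also have "\<dots> = (\<Sum>i\<in>I. c i * of_real (f (x i)) * cnj (c i))"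
  proof (subst sum.swap, intro sum.cong refl)
    fix i assume i: "i \<in> I"
    have "cnj (c i) = (\<Sum>a<n. cnj (\<psi> $ a) * E i $ a)" by (simp add: c[OF i] mult.commute)
    then show "(\<Sum>a<n. cnj (\<psi> $ a) * (c i * (of_real (f (x i)) * E i $ a))) = c i * of_real (f (x i)) * cnj (c i)"
      by (simp add: sum_distrib_left mult_ac)
  qed
  also have "\<dots> = (\<Sum>i\<in>I. of_real ((cmod (c i))\<^sup>2 * f (x i)))"
    by (intro sum.cong refl) (simp only: of_real_mult complex_norm_square mult_ac)
  finally show ?thesis unfolding c_def by simp
qed

text \<open>Move \<open>M\<close> to the other side of the inner product. For a state in the range
  of \<mu> this removes the amplitudes at eigenvalue 0.\<close>

lemma cinner_eigenvector_range:
  assumes M: "M \<in> carrier_mat n n" "hermitian_mat M" and E: "E \<in> carrier_vec n"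
    and ev: "M *\<^sub>v E = 0 \<cdot>\<^sub>v E" and y: "y \<in> carrier_vec n"
  shows "cinner E (M *\<^sub>v y) = 0"
proof -
  have "cinner E (M *\<^sub>v y) = cinner (M *\<^sub>v E) y"
    using cinner_mult_mat_vec[OF M(1) E y] M(2) unfolding hermitian_mat_def by simp
  then show ?thesis unfolding ev cinner_def using E y by simp
qed

lemma mtrace_proj_vec:
  assumes "\<psi> \<in> carrier_vec n" "F \<in> carrier_mat n n"
  shows "mtrace (proj_vec \<psi> * F) = cinner \<psi> (F *\<^sub>v \<psi>)"
proof -
  have "mtrace (proj_vec \<psi> * F) = (\<Sum>i<n. \<Sum>k<n. \<psi> $ i * cnj (\<psi> $ k) * F $$ (k, i))"
    using assms unfolding mtrace_def
    by (auto simp: proj_vec_def times_mat_index simp del: index_mult_mat(1) intro!: sum.cong)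
  also have "\<dots> = cinner \<psi> (F *\<^sub>v \<psi>)"
    unfolding cinner_carrier[OF assms(1)] using assms
    by (subst sum.swap, intro sum.cong refl)
      (auto simp: mult_mat_vec_index sum_distrib_left mult_ac simp del: index_mult_mat_vec)
  finally show ?thesis .
qed

lemma proj_vec_carrier: "\<psi> \<in> carrier_vec n \<Longrightarrow> proj_vec \<psi> \<in> carrier_mat n n"
  unfolding proj_vec_def by auto

lemma hermitian_proj_vec: "hermitian_mat (proj_vec \<psi>)"
  unfolding hermitian_mat_def by (rule eq_matI) (auto simp: proj_vec_def)

lemma proj_vec_mult:
  assumes "\<psi> \<in> carrier_vec n" "v \<in> carrier_vec n"
  shows "proj_vec \<psi> *\<^sub>v v = cinner \<psi> v \<cdot>\<^sub>v \<psi>"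
  by (rule eq_vecI)
    (use assms in \<open>auto simp: proj_vec_def mult_mat_vec_index cinner_carrier[OF assms(1)] sum_distrib_left sum_distrib_right
      mult_ac simp del: index_mult_mat_vec\<close>)

text \<open>The range of the projection is the line through \<psi>, so the inclusion reduces to one
  membership.\<close>

lemma mat_range_proj_vec_subset:
  assumes \<psi>: "pure_state n \<psi>" and M: "M \<in> carrier_mat n n"
  shows "mat_range (proj_vec \<psi>) \<subseteq> mat_range M \<longleftrightarrow> (\<exists>y\<in>carrier_vec n. \<psi> = M *\<^sub>v y)"
proof
  have c: "\<psi> \<in> carrier_vec n" "cinner \<psi> \<psi> = 1" using \<psi> unfolding pure_state_def by auto
  have P: "dim_col (proj_vec \<psi>) = n" using c unfolding proj_vec_def by simp
  {
    assume "mat_range (proj_vec \<psi>) \<subseteq> mat_range M"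
    moreover have "\<psi> \<in> mat_range (proj_vec \<psi>)"
      unfolding mat_range_def P mem_Collect_eq
      using proj_vec_mult[OF c(1) c(1)] c by (intro exI[of _ \<psi>]) simp
    ultimately show "\<exists>y\<in>carrier_vec n. \<psi> = M *\<^sub>v y" using M unfolding mat_range_def by auto
  next
    assume "\<exists>y\<in>carrier_vec n. \<psi> = M *\<^sub>v y"
    then obtain y where y: "y \<in> carrier_vec n" "\<psi> = M *\<^sub>v y" by auto
    show "mat_range (proj_vec \<psi>) \<subseteq> mat_range M"
    proof
      fix z assume "z \<in> mat_range (proj_vec \<psi>)"
      then obtain v where v: "v \<in> carrier_vec n" "z = proj_vec \<psi> *\<^sub>v v" unfolding mat_range_def P by auto
      have "z = cinner \<psi> v \<cdot>\<^sub>v \<psi>" unfolding v(2) by (rule proj_vec_mult[OF c(1) v(1)])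
      also have "\<dots> = cinner \<psi> v \<cdot>\<^sub>v (M *\<^sub>v y)" unfolding y(2)[symmetric] ..
      also have "\<dots> = M *\<^sub>v (cinner \<psi> v \<cdot>\<^sub>v y)" using M y(1) by (simp add: mult_mat_vec[of _ n n])
      finally show "z \<in> mat_range M" unfolding mat_range_def using M y(1) by auto
    qed
  }
qed

text \<open>The projection has \<psi> as eigenvector with eigenvalue 1, and the logarithm of 1 is 0;
  only the term with the logarithm of \<open>M\<close> survives in the trace.\<close>

lemma rel_entropy_pure:
  assumes \<psi>: "pure_state n \<psi>" and M: "M \<in> carrier_mat n n" "hermitian_mat M"
  shows "rel_entropy (proj_vec \<psi>) M =
    (if \<exists>y\<in>carrier_vec n. \<psi> = M *\<^sub>v y then ereal (- Re (cinner \<psi> (mat_fun log2s M *\<^sub>v \<psi>))) else \<infinity>)"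
proof -
  have c: "\<psi> \<in> carrier_vec n" "cinner \<psi> \<psi> = 1" using \<psi> unfolding pure_state_def by auto
  note P = proj_vec_carrier[OF c(1)] hermitian_proj_vec[of \<psi>]
  have "proj_vec \<psi> *\<^sub>v \<psi> = complex_of_real 1 \<cdot>\<^sub>v \<psi>"
    using proj_vec_mult[OF c(1) c(1)] c by simp
  then have "mat_fun log2s (proj_vec \<psi>) *\<^sub>v \<psi> = complex_of_real (log2s 1) \<cdot>\<^sub>v \<psi>"
    by (rule mat_fun_eigenvector[OF P c(1)])
  also have "\<dots> = 0\<^sub>v n" using c(1) by (intro eq_vecI) (auto simp: log2s_def)
  finally have F0: "mat_fun log2s (proj_vec \<psi>) *\<^sub>v \<psi> = 0\<^sub>v n" .
  note F = mat_fun_carrier[OF P, of log2s] mat_fun_carrier[OF M, of log2s]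
  have "mtrace (proj_vec \<psi> * (mat_fun log2s (proj_vec \<psi>) - mat_fun log2s M)) =
     cinner \<psi> ((mat_fun log2s (proj_vec \<psi>) - mat_fun log2s M) *\<^sub>v \<psi>)"
    using F c by (intro mtrace_proj_vec) auto
  also have "(mat_fun log2s (proj_vec \<psi>) - mat_fun log2s M) *\<^sub>v \<psi> = - (mat_fun log2s M *\<^sub>v \<psi>)"
    using F c F0 by (subst minus_mult_distrib_mat_vec[of _ n n]) (auto intro!: eq_vecI simp del: index_mult_mat_vec)
  also have "cinner \<psi> (- (mat_fun log2s M *\<^sub>v \<psi>)) = - cinner \<psi> (mat_fun log2s M *\<^sub>v \<psi>)"
    unfolding cinner_carrier[OF c(1)] using F(2) by (simp add: sum_negf del: index_mult_mat_vec)
  finally show ?thesis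
    unfolding rel_entropy_def mat_range_proj_vec_subset[OF \<psi> M(1)] by simp
qed

lemma unitary_columns:
  assumes "unitary_mat n U" "i < n" "j < n"
  shows "(\<Sum>k<n. cnj (U $$ (k, i)) * U $$ (k, j)) = (if i = j then 1 else 0)"
  using arg_cong[OF unitary_matD(2)[OF assms(1)], of "\<lambda>M. M $$ (i, j)"] unitary_matD(1)[OF assms(1)] assms(2,3)
  by (simp add: times_mat_index del: index_mult_mat(1))

lemma unitary_rows:
  assumes "unitary_mat n U" "i < n" "j < n"
  shows "(\<Sum>k<n. U $$ (i, k) * cnj (U $$ (j, k))) = (if i = j then 1 else 0)"
  using arg_cong[OF unitary_matD(3)[OF assms(1)], of "\<lambda>M. M $$ (i, j)"] unitary_matD(1)[OF assms(1)] assms(2,3)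
  by (simp add: times_mat_index del: index_mult_mat(1))

lemma mtrace_diag_conj:
  assumes U: "unitary_mat n U"
  shows "mtrace (U * diag_cmat n f * mat_adjoint U) = (\<Sum>k<n. f k)"
proof -
  note Uc = unitary_matD(1)[OF U]
  have "mtrace (U * diag_cmat n f * mat_adjoint U) = (\<Sum>i<n. \<Sum>k<n. U $$ (i, k) * f k * cnj (U $$ (i, k)))"
    unfolding mtrace_def using Uc by (auto simp: diag_conj_index simp del: index_mult_mat(1) intro!: sum.cong)
  also have "\<dots> = (\<Sum>k<n. f k * (\<Sum>i<n. cnj (U $$ (i, k)) * U $$ (i, k)))"
    by (subst sum.swap) (simp add: sum_distrib_left mult_ac)
  also have "\<dots> = (\<Sum>k<n. f k)"
    using unitary_columns[OF U] by (intro sum.cong) auto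
  finally show ?thesis .
qed

lemma vn_entropy_spectral:
  assumes R: "R \<in> carrier_mat n n" "hermitian_mat R"
  obtains U lam where "unitary_mat n U" "R = U * diag_cmat n (\<lambda>i. complex_of_real (lam i)) * mat_adjoint U"
    "vn_entropy R = - (\<Sum>i<n. lam i * log2s (lam i))"
proof -
  obtain U lam where uU: "unitary_mat n U" and RU: "R = U * diag_cmat n (\<lambda>i. complex_of_real (lam i)) * mat_adjoint U"
    and fU: "mat_fun log2s R = U * diag_cmat n (\<lambda>i. complex_of_real (log2s (lam i))) * mat_adjoint U"
    using mat_fun_spectral[OF R] by blast
  note U = unitary_matD[OF uU]
  let ?D = "diag_cmat n (\<lambda>i. complex_of_real (lam i))" and ?L = "diag_cmat n (\<lambda>i. complex_of_real (log2s (lam i)))"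
  let ?DL = "diag_cmat n (\<lambda>i. complex_of_real (lam i * log2s (lam i)))"
  have DL: "?D * ?L = ?DL" by (rule eq_matI) (auto simp: times_diag_cmat_index simp del: index_mult_mat(1))
  have "R * mat_fun log2s R = U * (?D * (mat_adjoint U * U) * ?L) * mat_adjoint U"
    unfolding fU unfolding RU using U(1) by (simp add: assoc_mult_mat[of _ n n _ n _ n] mult_carrier_mat[of _ n n _ n])
  also have "\<dots> = U * ?DL * mat_adjoint U" unfolding U(2) using DL by simp
  finally have prod: "R * mat_fun log2s R = U * ?DL * mat_adjoint U" .
  have "mtrace (R * mat_fun log2s R) = (\<Sum>k<n. complex_of_real (lam k * log2s (lam k)))"
    unfolding prod by (rule mtrace_diag_conj[OF uU])
  then have "vn_entropy R = - (\<Sum>i<n. lam i * log2s (lam i))" unfolding vn_entropy_def by simp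
  then show ?thesis using that uU RU by blast
qed

section \<open>Index pairs and Kronecker products\<close>

lemma sum_index_pairs: "(\<Sum>i<a * b. g i) = (\<Sum>k<a. \<Sum>m<b. g (k * b + m))" for a b :: nat
proof -
  have "(\<Sum>i<a * b. g i) = (\<Sum>k<a. sum g {k * b..<k * b + b})" by (rule sum.nat_group[symmetric])
  also have "\<dots> = (\<Sum>k<a. \<Sum>m<b. g (k * b + m))"
  proof (rule sum.cong[OF refl])
    fix k
    show "sum g {k * b..<k * b + b} = (\<Sum>m<b. g (k * b + m))"
      using sum.shift_bounds_nat_ivl[of g 0 "k * b" b] by (simp add: add.commute atLeast0LessThan)
  qed
  finally show ?thesis .
qed

lemma index_pair_less: "k < a \<Longrightarrow> m < b \<Longrightarrow> k * b + m < a * b" for a b k m :: nat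
  using mult_le_mono1[of "Suc k" a b] by simp

lemma index_div_less: "i < a * b \<Longrightarrow> i div b < a" for a b :: nat
  by (simp add: less_mult_imp_div_less)

lemma index_mod_less: "i < a * b \<Longrightarrow> i mod b < b" for a b :: nat
  by (cases "b = 0") auto

lemma kron_dim [simp]: "dim_row (kron A B) = dim_row A * dim_row B" "dim_col (kron A B) = dim_col A * dim_col B"
  unfolding kron_def by auto

lemma kron_carrier [simp]: "A \<in> carrier_mat a b \<Longrightarrow> B \<in> carrier_mat c e \<Longrightarrow> kron A B \<in> carrier_mat (a * c) (b * e)"
  by (intro carrier_matI) auto

lemma kron_index:
  "i < dim_row A * dim_row B \<Longrightarrow> j < dim_col A * dim_col B \<Longrightarrow>
    kron A B $$ (i, j) = A $$ (i div dim_row B, j div dim_col B) * B $$ (i mod dim_row B, j mod dim_col B)"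
  unfolding kron_def by simp

lemma kron_pair_index:
  "i < dim_row A \<Longrightarrow> k < dim_row B \<Longrightarrow> j < dim_col A \<Longrightarrow> m < dim_col B \<Longrightarrow>
    kron A B $$ (i * dim_row B + k, j * dim_col B + m) = A $$ (i, j) * B $$ (k, m)"
  by (subst kron_index) (auto simp: index_pair_less)

lemma kron_times:
  assumes "dim_col A = dim_row C" "dim_col B = dim_row D"
  shows "kron A B * kron C D = kron (A * C) (B * D)"
proof (rule eq_matI)
  fix i j assume "i < dim_row (kron (A * C) (B * D))" "j < dim_col (kron (A * C) (B * D))"
  then have i: "i < dim_row A * dim_row B" and j: "j < dim_col C * dim_col D" by auto
  note ij = index_div_less[OF i] index_mod_less[OF i] index_div_less[OF j] index_mod_less[OF j]
  let ?i = "i div dim_row B" and ?i' = "i mod dim_row B" and ?j = "j div dim_col D" and ?j' = "j mod dim_col D"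
  have "(kron A B * kron C D) $$ (i, j) =
    (\<Sum>k<dim_row C. \<Sum>m<dim_row D. (A $$ (?i, k) * C $$ (k, ?j)) * (B $$ (?i', m) * D $$ (m, ?j')))"
    using i j assms by (subst times_mat_index)
      (auto simp: sum_index_pairs kron_index index_pair_less mult_ac intro!: sum.cong)
  also have "\<dots> = (A * C) $$ (?i, ?j) * (B * D) $$ (?i', ?j')"
    using ij assms by (simp add: times_mat_index sum_product del: index_mult_mat(1))
  also have "\<dots> = kron (A * C) (B * D) $$ (i, j)"
    using i j by (subst kron_index) auto
  finally show "(kron A B * kron C D) $$ (i, j) = kron (A * C) (B * D) $$ (i, j)" .
qed auto

lemma kron_adjoint: "mat_adjoint (kron A B) = kron (mat_adjoint A) (mat_adjoint B)" for A B :: "complex mat"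
  by (rule eq_matI) (auto simp: kron_index index_div_less index_mod_less)

lemma kron_one: "kron (1\<^sub>m a) (1\<^sub>m b) = (1\<^sub>m (a * b) :: complex mat)"
proof (rule eq_matI)
  fix i j assume "i < dim_row (1\<^sub>m (a * b))" "j < dim_col (1\<^sub>m (a * b))"
  then have i: "i < a * b" and j: "j < a * b" by auto
  show "kron (1\<^sub>m a) (1\<^sub>m b) $$ (i, j) = (1\<^sub>m (a * b) :: complex mat) $$ (i, j)"
    using i j index_div_less[OF i] index_mod_less[OF i] index_div_less[OF j] index_mod_less[OF j]
    by (auto simp: kron_index) (metis div_mult_mod_eq)
qed auto

lemma kron_assoc: "kron (kron A B) C = kron A (kron B C)" for A B C :: "complex mat"
proof -
  have mm: "i mod (b * c) div c = i div c mod b" "i mod (b * c) mod c = i mod c" for i b c :: nat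
    by (cases "c = 0", auto simp: mod_mult2_eq mult.commute[of b c] div_mult2_eq)+
  have dd: "i div c div b = i div (b * c)" for i b c :: nat
    by (simp add: div_mult2_eq mult.commute[of b c])
  show ?thesis
  proof (rule eq_matI)
    fix i j assume "i < dim_row (kron A (kron B C))" "j < dim_col (kron A (kron B C))"
    then have i: "i < dim_row A * dim_row B * dim_row C" and j: "j < dim_col A * dim_col B * dim_col C"
      by (auto simp: mult.assoc)
    note ij = index_div_less[OF i] index_div_less[OF j]
      index_mod_less[OF i[unfolded mult.assoc]] index_mod_less[OF j[unfolded mult.assoc]]
    show "kron (kron A B) C $$ (i, j) = kron A (kron B C) $$ (i, j)"
      using i j ij by (simp add: kron_index mm dd mult.assoc)
  qed (auto simp: mult.assoc)
qed

lemma kron_mult_vec_index: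
  assumes "i < dim_row A" "k < dim_row B" "dim_vec v = dim_col A * dim_col B"
  shows "(kron A B *\<^sub>v v) $ (i * dim_row B + k) =
    (\<Sum>x<dim_col A. \<Sum>y<dim_col B. A $$ (i, x) * B $$ (k, y) * v $ (x * dim_col B + y))"
  using assms by (subst mult_mat_vec_index)
    (auto simp: index_pair_less sum_index_pairs kron_pair_index intro!: sum.cong)

section \<open>Eigenvectors of a Markov state\<close>

lemma expectation_diag_conj:
  assumes U: "unitary_mat n U" and i: "i < n"
  shows "cinner (col U i) ((U * diag_cmat n f * mat_adjoint U) *\<^sub>v col U i) = f i"
proof -
  note Uc = unitary_matD(1)[OF U]
  let ?A = "U * diag_cmat n f * mat_adjoint U"
  have A: "?A \<in> carrier_mat n n" using Uc by auto
  have "(?A *\<^sub>v col U i) $ a = f i * U $$ (a, i)" if a: "a < n" for a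
  proof -
    have "(?A *\<^sub>v col U i) $ a = (\<Sum>b<n. \<Sum>k<n. U $$ (a, k) * f k * (cnj (U $$ (b, k)) * U $$ (b, i)))"
      using A Uc a i by (subst mult_mat_vec_index)
        (auto simp: diag_conj_index sum_distrib_right mult.assoc simp del: index_mult_mat(1) intro!: sum.cong)
    also have "\<dots> = (\<Sum>k<n. U $$ (a, k) * f k * (if k = i then 1 else 0))"
      using unitary_columns[OF U] i by (subst sum.swap) (auto simp: sum_distrib_left[symmetric] intro!: sum.cong)
    also have "\<dots> = (\<Sum>k<n. if k = i then U $$ (a, k) * f k else 0)" by (intro sum.cong) auto
    finally show ?thesis using i by (simp add: mult.commute)
  qed
  then have "cinner (col U i) (?A *\<^sub>v col U i) = (\<Sum>a<n. f i * (cnj (U $$ (a, i)) * U $$ (a, i)))"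
    unfolding cinner_def using Uc i by (auto simp del: index_mult_mat_vec intro!: sum.cong)
  also have "\<dots> = f i" using unitary_columns[OF U i i] by (simp add: sum_distrib_left[symmetric])
  finally show ?thesis .
qed

text \<open>Positivity is tested on the columns of \<open>U\<close>, and the sum is read off from
  the trace.\<close>

lemma density_eigenvalues:
  assumes R: "density_mat n R" and U: "unitary_mat n U"
    and RU: "R = U * diag_cmat n (\<lambda>i. complex_of_real (lam i)) * mat_adjoint U"
  shows "\<And>i. i < n \<Longrightarrow> 0 \<le> lam i" "(\<Sum>i<n. lam i) = 1"
proof -
  fix i assume i: "i < n"
  have "col U i \<in> carrier_vec n" using unitary_matD(1)[OF U] i by auto
  then have "0 \<le> Re (cinner (col U i) (R *\<^sub>v col U i))" using R unfolding density_mat_def by blast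
  then show "0 \<le> lam i" unfolding RU expectation_diag_conj[OF U i] by simp
next
  have "mtrace R = 1" using R unfolding density_mat_def by blast
  then have "complex_of_real (\<Sum>i<n. lam i) = 1" unfolding RU mtrace_diag_conj[OF U] by simp
  then show "(\<Sum>i<n. lam i) = 1" unfolding of_real_eq_1_iff .
qed

lemma density_spectral:
  assumes "density_mat n R"
  shows "\<exists>U lam. unitary_mat n U \<and> R = U * diag_cmat n (\<lambda>i. complex_of_real (lam i)) * mat_adjoint U
     \<and> (\<forall>i<n. 0 \<le> lam i) \<and> (\<Sum>i<n. lam i) = 1"
proof -
  have R: "R \<in> carrier_mat n n" "hermitian_mat R" using assms unfolding density_mat_def by auto
  from hermitian_spectral_decomposition[OF R] obtain U lam where
    *: "unitary_mat n U" "R = U * diag_cmat n (\<lambda>i. complex_of_real (lam i)) * mat_adjoint U" by blast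
  show ?thesis using density_eigenvalues[OF assms *] * by blast
qed

lemma kron_diag_cmat:
  "kron (diag_cmat n f) (diag_cmat m g) = diag_cmat (n * m) (\<lambda>i. f (i div m) * g (i mod m))"
proof (rule eq_matI)
  fix i j assume "i < dim_row (diag_cmat (n * m) (\<lambda>i. f (i div m) * g (i mod m)))"
    "j < dim_col (diag_cmat (n * m) (\<lambda>i. f (i div m) * g (i mod m)))"
  then have i: "i < n * m" and j: "j < n * m" by auto
  show "kron (diag_cmat n f) (diag_cmat m g) $$ (i, j) = diag_cmat (n * m) (\<lambda>i. f (i div m) * g (i mod m)) $$ (i, j)"
    using i j index_div_less[OF i] index_mod_less[OF i] index_div_less[OF j] index_mod_less[OF j]
    by (auto simp: kron_index) (metis div_mult_mod_eq)
qed auto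

lemma kron_zero:
  "kron A (0\<^sub>m a b) = (0\<^sub>m (dim_row A * a) (dim_col A * b) :: complex mat)"
  "kron (0\<^sub>m a b) A = (0\<^sub>m (a * dim_row A) (b * dim_col A) :: complex mat)"
  by (rule eq_matI; auto simp: kron_index index_div_less index_mod_less)+

lemma orthonormal_sum_eigen:
  assumes I: "finite I" and M: "M \<in> carrier_mat n n"
    and E: "\<And>i. i \<in> I \<Longrightarrow> E i \<in> carrier_vec n"
    and orth: "\<And>i j. i \<in> I \<Longrightarrow> j \<in> I \<Longrightarrow> cinner (E i) (E j) = (if i = j then 1 else 0)"
    and entries: "\<And>a b. a < n \<Longrightarrow> b < n \<Longrightarrow> M $$ (a, b) = (\<Sum>i\<in>I. complex_of_real (x i) * (E i $ a * cnj (E i $ b)))"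
  shows "hermitian_mat M" "\<And>i. i \<in> I \<Longrightarrow> M *\<^sub>v E i = complex_of_real (x i) \<cdot>\<^sub>v E i"
proof -
  show "hermitian_mat M"
    unfolding hermitian_mat_def
    by (rule eq_matI) (use M entries in \<open>auto simp: mult_ac\<close>)
  fix i assume i: "i \<in> I"
  show "M *\<^sub>v E i = complex_of_real (x i) \<cdot>\<^sub>v E i"
  proof (rule eq_vecI)
    fix a assume "a < dim_vec (complex_of_real (x i) \<cdot>\<^sub>v E i)"
    then have a: "a < n" using E[OF i] by simp
    have "(M *\<^sub>v E i) $ a = (\<Sum>b<n. \<Sum>j\<in>I. complex_of_real (x j) * E j $ a * (cnj (E j $ b) * E i $ b))"
      using M E[OF i] a by (subst mult_mat_vec_index) (auto simp: entries sum_distrib_right mult.assoc intro!: sum.cong)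
    also have "\<dots> = (\<Sum>j\<in>I. complex_of_real (x j) * E j $ a * cinner (E j) (E i))"
      by (subst sum.swap, intro sum.cong refl) (simp add: cinner_carrier[OF E] sum_distrib_left)
    also have "\<dots> = (\<Sum>j\<in>I. if j = i then complex_of_real (x j) * E j $ a else 0)"
      using orth[OF _ i] by (intro sum.cong) auto
    finally show "(M *\<^sub>v E i) $ a = (complex_of_real (x i) \<cdot>\<^sub>v E i) $ a" using i I a E[OF i] by simp
  qed (use M E[OF i] in auto)
qed

text \<open>The data of a Markov state with spectral decompositions of all \<sigma>_j and \<tau>_j
  already chosen: \<open>Us\<close>, \<open>s\<close> and \<open>Ut\<close>, \<open>t\<close> are
  their eigenbases and eigenvalues.\<close>

locale markov_data =
  fixes X Y Z J :: nat and l r :: "nat \<Rightarrow> nat" and W :: "nat \<Rightarrow> complex mat" and p :: "nat \<Rightarrow> real"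
    and Us Ut :: "nat \<Rightarrow> complex mat" and s t :: "nat \<Rightarrow> nat \<Rightarrow> real"
  assumes W: "\<And>j. j < J \<Longrightarrow> W j \<in> carrier_mat Y (l j * r j)"
    and W_orth: "\<And>j k. j < J \<Longrightarrow> k < J \<Longrightarrow>
        mat_adjoint (W j) * W k = (if j = k then 1\<^sub>m (l j * r j) else 0\<^sub>m (l j * r j) (l k * r k))"
    and W_complete: "\<And>a b. a < Y \<Longrightarrow> b < Y \<Longrightarrow> (\<Sum>j<J. (W j * mat_adjoint (W j)) $$ (a, b)) = (if a = b then 1 else 0)"
    and p: "\<And>j. j < J \<Longrightarrow> 0 \<le> p j" "(\<Sum>j<J. p j) = 1"
    and Us: "\<And>j. j < J \<Longrightarrow> unitary_mat (X * l j) (Us j)"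
    and Ut: "\<And>j. j < J \<Longrightarrow> unitary_mat (r j * Z) (Ut j)"
    and s: "\<And>j k. j < J \<Longrightarrow> k < X * l j \<Longrightarrow> 0 \<le> s j k" "\<And>j. j < J \<Longrightarrow> (\<Sum>k<X * l j. s j k) = 1"
    and t: "\<And>j m. j < J \<Longrightarrow> m < r j * Z \<Longrightarrow> 0 \<le> t j m" "\<And>j. j < J \<Longrightarrow> (\<Sum>m<r j * Z. t j m) = 1"
begin

definition "G j = kron (kron (1\<^sub>m X) (W j)) (1\<^sub>m Z)"
definition "n j = X * l j * (r j * Z)"
text \<open>The columns are the eigenvectors of \<mu> that belong to block j. Column
  \<open>k * (r j * Z) + m\<close> is the embedded product of the k-th eigenvector of \<sigma>_j and
  the m-th one of \<tau>_j, with eigenvalue \<open>p j * (s j k * t j m)\<close>.\<close>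

definition "Q j = G j * kron (Us j) (Ut j)"
definition "sig j = Us j * diag_cmat (X * l j) (\<lambda>k. complex_of_real (s j k)) * mat_adjoint (Us j)"
definition "tau j = Ut j * diag_cmat (r j * Z) (\<lambda>m. complex_of_real (t j m)) * mat_adjoint (Ut j)"
definition "eig j i = p j * (s j (i div (r j * Z)) * t j (i mod (r j * Z)))"
definition "\<mu> = mat (X * Y * Z) (X * Y * Z) (\<lambda>(i, i').
   \<Sum>j<J. complex_of_real (p j) * ((G j * kron (sig j) (tau j) * mat_adjoint (G j)) $$ (i, i')))"

lemma G_carrier: "j < J \<Longrightarrow> G j \<in> carrier_mat (X * Y * Z) (n j)"
  using W[of j] unfolding G_def n_def by (intro carrier_matI) (auto simp: mult_ac)

lemma U_carrier: "j < J \<Longrightarrow> kron (Us j) (Ut j) \<in> carrier_mat (n j) (n j)"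
  using unitary_matD(1)[OF Us] unitary_matD(1)[OF Ut] unfolding n_def by simp

lemma Q_carrier: "j < J \<Longrightarrow> Q j \<in> carrier_mat (X * Y * Z) (n j)"
  unfolding Q_def by (rule mult_carrier_mat[OF G_carrier U_carrier])

lemma U_unitary: "j < J \<Longrightarrow> unitary_mat (n j) (kron (Us j) (Ut j))"
  using unitary_matD[OF Us[of j]] unitary_matD[OF Ut[of j]] U_carrier[of j] unfolding unitary_mat_def
  by (simp add: kron_adjoint kron_times kron_one n_def)

lemma G_orth:
  assumes "j < J" "k < J"
  shows "mat_adjoint (G j) * G k = (if j = k then 1\<^sub>m (n j) else 0\<^sub>m (n j) (n k))"
proof -
  have "mat_adjoint (G j) * G k = kron (kron (1\<^sub>m X) (mat_adjoint (W j) * W k)) (1\<^sub>m Z)"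
    unfolding G_def using W[OF assms(1)] W[OF assms(2)] by (simp add: kron_adjoint kron_times)
  also have "\<dots> = (if j = k then 1\<^sub>m (n j) else 0\<^sub>m (n j) (n k))"
  proof (cases "j = k")
    case True
    then show ?thesis using assms by (simp add: W_orth kron_one n_def mult_ac)
  next
    case False
    have "kron (kron (1\<^sub>m X) (0\<^sub>m (l j * r j) (l k * r k))) (1\<^sub>m Z) = (0\<^sub>m (n j) (n k) :: complex mat)"
      by (simp add: kron_zero n_def mult_ac)
    then show ?thesis using assms False by (simp add: W_orth)
  qed
  finally show ?thesis .
qed

lemma Q_orth:
  assumes "j < J" "k < J"
  shows "mat_adjoint (Q j) * Q k = (if j = k then 1\<^sub>m (n j) else 0\<^sub>m (n j) (n k))"
proof -
  note c = G_carrier[OF assms(1)] G_carrier[OF assms(2)] U_carrier[OF assms(1)] U_carrier[OF assms(2)]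
  let ?Uj = "kron (Us j) (Ut j)" and ?Uk = "kron (Us k) (Ut k)"
  have "mat_adjoint (Q j) = mat_adjoint ?Uj * mat_adjoint (G j)"
    unfolding Q_def using c by (intro mat_adjoint_times) auto
  then have "mat_adjoint (Q j) * Q k = mat_adjoint ?Uj * mat_adjoint (G j) * (G k * ?Uk)"
    unfolding Q_def by simp
  also have "\<dots> = mat_adjoint ?Uj * (mat_adjoint (G j) * (G k * ?Uk))"
    using c by (intro assoc_mult_mat[of _ "n j" "n j" _ "X * Y * Z" _ "n k"]) auto
  also have "mat_adjoint (G j) * (G k * ?Uk) = mat_adjoint (G j) * G k * ?Uk"
    using c by (intro assoc_mult_mat[symmetric, of _ "n j" "X * Y * Z" _ "n k" _ "n k"]) auto
  finally show ?thesis
    unfolding G_orth[OF assms] using c unitary_matD(2)[OF U_unitary[OF assms(1)]]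
    by (cases "j = k")
      (auto simp: left_mult_zero_mat[of _ "n k" "n k"] right_mult_zero_mat[of _ "n j" "n j"])
qed

lemma Q_complete_matrix:
  assumes "j < J"
  shows "Q j * mat_adjoint (Q j) = kron (kron (1\<^sub>m X) (W j * mat_adjoint (W j))) (1\<^sub>m Z)"
proof -
  note c = G_carrier[OF assms] U_carrier[OF assms]
  let ?U = "kron (Us j) (Ut j)"
  have "mat_adjoint (Q j) = mat_adjoint ?U * mat_adjoint (G j)"
    unfolding Q_def using c by (intro mat_adjoint_times) auto
  then have "Q j * mat_adjoint (Q j) = G j * ?U * (mat_adjoint ?U * mat_adjoint (G j))"
    unfolding Q_def by simp
  also have "\<dots> = G j * (?U * (mat_adjoint ?U * mat_adjoint (G j)))"
    using c by (intro assoc_mult_mat[of _ "X * Y * Z" "n j" _ "n j" _ "X * Y * Z"])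
      (auto intro!: mult_carrier_mat[of _ "n j" "n j"])
  also have "?U * (mat_adjoint ?U * mat_adjoint (G j)) = ?U * mat_adjoint ?U * mat_adjoint (G j)"
    using c by (intro assoc_mult_mat[symmetric, of _ "n j" "n j" _ "n j" _ "X * Y * Z"]) auto
  also have "\<dots> = mat_adjoint (G j)" using unitary_matD(3)[OF U_unitary[OF assms]] c by auto
  also have "G j * mat_adjoint (G j) = kron (kron (1\<^sub>m X) (W j * mat_adjoint (W j))) (1\<^sub>m Z)"
    unfolding G_def using W[OF assms] by (simp add: kron_adjoint kron_times)
  finally show ?thesis .
qed

text \<open>The unitaries cancel in \<open>Q j\<close> times its adjoint, so only the projections to
  the ranges of the \<open>W j\<close> remain, and these resolve the identity of the middle
  system.\<close>

lemma Q_complete: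
  assumes "a < X * Y * Z" "b < X * Y * Z"
  shows "(\<Sum>j<J. \<Sum>i<n j. Q j $$ (a, i) * cnj (Q j $$ (b, i))) = (if a = b then 1 else 0)"
proof -
  note ab = index_div_less[OF assms(1)] index_mod_less[OF assms(1)] index_div_less[OF assms(2)] index_mod_less[OF assms(2)]
  note ab' = index_mod_less[OF ab(1)] index_mod_less[OF ab(3)] index_div_less[OF ab(1)] index_div_less[OF ab(3)]
  have "(\<Sum>j<J. \<Sum>i<n j. Q j $$ (a, i) * cnj (Q j $$ (b, i))) =
    (\<Sum>j<J. kron (kron (1\<^sub>m X) (W j * mat_adjoint (W j))) (1\<^sub>m Z) $$ (a, b))"
  proof (intro sum.cong refl)
    fix j assume "j \<in> {..<J}"
    then have j: "j < J" by simp
    show "(\<Sum>i<n j. Q j $$ (a, i) * cnj (Q j $$ (b, i))) = kron (kron (1\<^sub>m X) (W j * mat_adjoint (W j))) (1\<^sub>m Z) $$ (a, b)"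
      unfolding Q_complete_matrix[OF j, symmetric] using Q_carrier[OF j] assms
      by (subst times_mat_index) auto
  qed
  also have "\<dots> = (\<Sum>j<J. 1\<^sub>m X $$ (a div Z div Y, b div Z div Y) * (W j * mat_adjoint (W j)) $$ (a div Z mod Y, b div Z mod Y)
      * 1\<^sub>m Z $$ (a mod Z, b mod Z))"
  proof (intro sum.cong refl)
    fix j assume "j \<in> {..<J}"
    then have "dim_row (W j) = Y" using W by auto
    then show "kron (kron (1\<^sub>m X) (W j * mat_adjoint (W j))) (1\<^sub>m Z) $$ (a, b) = 1\<^sub>m X $$ (a div Z div Y, b div Z div Y) * (W j * mat_adjoint (W j)) $$ (a div Z mod Y, b div Z mod Y)
      * 1\<^sub>m Z $$ (a mod Z, b mod Z)"
      using assms ab by (simp add: kron_index del: index_mult_mat(1) index_one_mat(1))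
  qed
  also have "\<dots> = 1\<^sub>m X $$ (a div Z div Y, b div Z div Y) * 1\<^sub>m Y $$ (a div Z mod Y, b div Z mod Y)
      * 1\<^sub>m Z $$ (a mod Z, b mod Z)"
    using W_complete[OF ab'(1,2)] ab' by (simp add: sum_distrib_left[symmetric] sum_distrib_right[symmetric] del: index_mult_mat(1))
  also have "\<dots> = kron (kron (1\<^sub>m X) (1\<^sub>m Y)) (1\<^sub>m Z) $$ (a, b)"
    using assms ab by (simp add: kron_index del: index_one_mat(1))
  also have "\<dots> = (if a = b then 1 else 0)" using assms by (simp add: kron_one)
  finally show ?thesis .
qed

lemma sandwich:
  assumes "j < J"
  shows "G j * kron (sig j) (tau j) * mat_adjoint (G j) =
    Q j * diag_cmat (n j) (\<lambda>i. complex_of_real (s j (i div (r j * Z)) * t j (i mod (r j * Z)))) * mat_adjoint (Q j)"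
proof -
  note c = G_carrier[OF assms] U_carrier[OF assms]
  note u = unitary_matD(1)[OF Us[OF assms]] unitary_matD(1)[OF Ut[OF assms]]
  let ?U = "kron (Us j) (Ut j)"
  let ?D = "diag_cmat (n j) (\<lambda>i. complex_of_real (s j (i div (r j * Z)) * t j (i mod (r j * Z))))"
  have "kron (sig j) (tau j) = ?U * ?D * mat_adjoint ?U"
    unfolding sig_def tau_def n_def using u
    by (simp add: kron_times[symmetric] kron_adjoint kron_diag_cmat)
  then have "G j * kron (sig j) (tau j) * mat_adjoint (G j) = G j * (?U * ?D * mat_adjoint ?U) * mat_adjoint (G j)" by simp
  also have "\<dots> = G j * (?U * ?D) * mat_adjoint ?U * mat_adjoint (G j)"
    using c by (subst assoc_mult_mat[of "G j" "X * Y * Z" "n j" "?U * ?D" "n j" "mat_adjoint ?U" "n j"]) auto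
  also have "\<dots> = G j * (?U * ?D) * (mat_adjoint ?U * mat_adjoint (G j))"
    using c by (intro assoc_mult_mat[of _ "X * Y * Z" "n j" _ "n j" _ "X * Y * Z"]) auto
  also have "G j * (?U * ?D) = Q j * ?D"
    unfolding Q_def using c by (intro assoc_mult_mat[symmetric, of _ "X * Y * Z" "n j" _ "n j" _ "n j"]) auto
  also have "mat_adjoint ?U * mat_adjoint (G j) = mat_adjoint (Q j)"
    unfolding Q_def using c by (intro mat_adjoint_times[symmetric]) auto
  finally show ?thesis .
qed

definition "idx = Sigma {..<J} (\<lambda>j. {..<n j})"
definition "E = (\<lambda>(j, i). col (Q j) i)"

lemma sum_idx: "(\<Sum>i\<in>idx. h i) = (\<Sum>j<J. \<Sum>i<n j. h (j, i))"
  unfolding idx_def by (subst sum.Sigma) (auto intro!: sum.cong)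

lemma idxE: "i \<in> idx \<Longrightarrow> \<exists>j m. i = (j, m) \<and> j < J \<and> m < n j" unfolding idx_def by auto

lemma E_carrier: "i \<in> idx \<Longrightarrow> E i \<in> carrier_vec (X * Y * Z)"
  using Q_carrier unfolding E_def by (auto dest!: idxE)

lemma \<mu>_carrier: "\<mu> \<in> carrier_mat (X * Y * Z) (X * Y * Z)" unfolding \<mu>_def by simp

lemma E_orth:
  assumes "i \<in> idx" "i' \<in> idx"
  shows "cinner (E i) (E i') = (if i = i' then 1 else 0)"
proof -
  obtain j m j' m' where i: "i = (j, m)" "j < J" "m < n j" "i' = (j', m')" "j' < J" "m' < n j'"
    using idxE[OF assms(1)] idxE[OF assms(2)] by auto
  have "cinner (E i) (E i') = (mat_adjoint (Q j) * Q j') $$ (m, m')"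
    using i Q_carrier[OF i(2)] Q_carrier[OF i(5)] unfolding cinner_carrier[OF E_carrier[OF assms(1)]]
    by (subst times_mat_index) (auto simp: E_def)
  also have "\<dots> = (if i = i' then 1 else 0)" unfolding Q_orth[OF i(2,5)] using i by auto
  finally show ?thesis .
qed

lemma \<mu>_entries:
  assumes "a < X * Y * Z" "b < X * Y * Z"
  shows "\<mu> $$ (a, b) = (\<Sum>i\<in>idx. complex_of_real (case i of (j, m) \<Rightarrow> eig j m) * (E i $ a * cnj (E i $ b)))"
proof -
  have "\<mu> $$ (a, b) = (\<Sum>j<J. complex_of_real (p j) * ((G j * kron (sig j) (tau j) * mat_adjoint (G j)) $$ (a, b)))"
    unfolding \<mu>_def using assms by simp
  also have "\<dots> = (\<Sum>j<J. \<Sum>m<n j. complex_of_real (eig j m) * (E (j, m) $ a * cnj (E (j, m) $ b)))"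
  proof (intro sum.cong refl)
    fix j assume "j \<in> {..<J}"
    then have j: "j < J" by simp
    show "complex_of_real (p j) * ((G j * kron (sig j) (tau j) * mat_adjoint (G j)) $$ (a, b)) =
      (\<Sum>m<n j. complex_of_real (eig j m) * (E (j, m) $ a * cnj (E (j, m) $ b)))"
      unfolding sandwich[OF j] using Q_carrier[OF j] assms
      by (subst diag_conj_index) (auto simp: eig_def E_def sum_distrib_left mult_ac intro!: sum.cong)
  qed
  finally show ?thesis unfolding sum_idx by simp
qed

lemmas \<mu>_spectral = orthonormal_sum_eigen[OF _ \<mu>_carrier E_carrier E_orth \<mu>_entries]

lemma finite_idx: "finite idx" unfolding idx_def by auto

lemma \<mu>_hermitian: "hermitian_mat \<mu>" using \<mu>_spectral(1)[OF finite_idx] by blast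

lemma \<mu>_eigen: "i \<in> idx \<Longrightarrow> \<mu> *\<^sub>v E i = complex_of_real (case i of (j, m) \<Rightarrow> eig j m) \<cdot>\<^sub>v E i"
  using \<mu>_spectral(2)[OF finite_idx] by blast

lemma E_complete:
  assumes "a < X * Y * Z" "b < X * Y * Z"
  shows "(\<Sum>i\<in>idx. E i $ a * cnj (E i $ b)) = (if a = b then 1 else 0)"
  unfolding Q_complete[OF assms, symmetric] sum_idx
  using carrier_matD[OF Q_carrier] assms by (intro sum.cong refl) (simp add: E_def)

end

lemma markov_state_data:
  assumes "markov_state X Y Z M"
  shows "\<exists>J l r W p Us Ut s t. markov_data X Y Z J l r W p Us Ut s t \<and> M = markov_data.\<mu> X Y Z J l r W p Us Ut s t"
  using assms unfolding markov_state_def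
proof (elim exE conjE)
  fix J :: nat and l r :: "nat \<Rightarrow> nat" and W :: "nat \<Rightarrow> complex mat" and p :: "nat \<Rightarrow> real"
    and \<sigma> \<tau> :: "nat \<Rightarrow> complex mat"
  assume 1: "\<forall>j<J. 0 < l j \<and> 0 < r j \<and> W j \<in> carrier_mat Y (l j * r j)"
    and 2: "\<forall>j<J. \<forall>k<J. mat_adjoint (W j) * W k = (if j = k then 1\<^sub>m (l j * r j) else 0\<^sub>m (l j * r j) (l k * r k))"
    and 3: "\<forall>a<Y. \<forall>b<Y. (\<Sum>j<J. (W j * mat_adjoint (W j)) $$ (a, b)) = (if a = b then 1 else 0)"
    and 4: "\<forall>j<J. 0 \<le> p j" "(\<Sum>j<J. p j) = 1"
    and 5: "\<forall>j<J. density_mat (X * l j) (\<sigma> j) \<and> density_mat (r j * Z) (\<tau> j)"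
    and 6: "M = mat (X * Y * Z) (X * Y * Z) (\<lambda>(i, i').
          \<Sum>j<J. complex_of_real (p j) *
            ((kron (kron (1\<^sub>m X) (W j)) (1\<^sub>m Z) * kron (\<sigma> j) (\<tau> j)
               * mat_adjoint (kron (kron (1\<^sub>m X) (W j)) (1\<^sub>m Z))) $$ (i, i')))"
  have "\<forall>j\<in>{..<J}. \<exists>U lam. unitary_mat (X * l j) U \<and> \<sigma> j = U * diag_cmat (X * l j) (\<lambda>i. complex_of_real (lam i)) * mat_adjoint U
     \<and> (\<forall>i<X * l j. 0 \<le> lam i) \<and> (\<Sum>i<X * l j. lam i) = 1"
    using 5 by (intro ballI density_spectral) simp
  from bchoice[OF this] obtain Us where "\<forall>j\<in>{..<J}. \<exists>lam. unitary_mat (X * l j) (Us j) \<and> \<sigma> j = Us j * diag_cmat (X * l j) (\<lambda>i. complex_of_real (lam i)) * mat_adjoint (Us j)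
     \<and> (\<forall>i<X * l j. 0 \<le> lam i) \<and> (\<Sum>i<X * l j. lam i) = 1" ..
  from bchoice[OF this] obtain s where S: "\<And>j. j < J \<Longrightarrow> unitary_mat (X * l j) (Us j)"
      "\<And>j. j < J \<Longrightarrow> \<sigma> j = Us j * diag_cmat (X * l j) (\<lambda>i. complex_of_real (s j i)) * mat_adjoint (Us j)"
      "\<And>j i. j < J \<Longrightarrow> i < X * l j \<Longrightarrow> 0 \<le> s j i" "\<And>j. j < J \<Longrightarrow> (\<Sum>i<X * l j. s j i) = 1"
    by auto
  have "\<forall>j\<in>{..<J}. \<exists>U lam. unitary_mat (r j * Z) U \<and> \<tau> j = U * diag_cmat (r j * Z) (\<lambda>i. complex_of_real (lam i)) * mat_adjoint U
     \<and> (\<forall>i<r j * Z. 0 \<le> lam i) \<and> (\<Sum>i<r j * Z. lam i) = 1"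
    using 5 by (intro ballI density_spectral) simp
  from bchoice[OF this] obtain Ut where "\<forall>j\<in>{..<J}. \<exists>lam. unitary_mat (r j * Z) (Ut j) \<and> \<tau> j = Ut j * diag_cmat (r j * Z) (\<lambda>i. complex_of_real (lam i)) * mat_adjoint (Ut j)
     \<and> (\<forall>i<r j * Z. 0 \<le> lam i) \<and> (\<Sum>i<r j * Z. lam i) = 1" ..
  from bchoice[OF this] obtain t where T: "\<And>j. j < J \<Longrightarrow> unitary_mat (r j * Z) (Ut j)"
      "\<And>j. j < J \<Longrightarrow> \<tau> j = Ut j * diag_cmat (r j * Z) (\<lambda>i. complex_of_real (t j i)) * mat_adjoint (Ut j)"
      "\<And>j i. j < J \<Longrightarrow> i < r j * Z \<Longrightarrow> 0 \<le> t j i" "\<And>j. j < J \<Longrightarrow> (\<Sum>i<r j * Z. t j i) = 1"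
    by auto
  have md: "markov_data X Y Z J l r W p Us Ut s t"
    by unfold_locales (use 1 2 3 4 S T in auto)
  interpret markov_data X Y Z J l r W p Us Ut s t by (rule md)
  have "M = \<mu>"
    unfolding 6 \<mu>_def
    by (intro cong_mat refl) (auto simp: G_def sig_def tau_def S(2)[symmetric] T(2)[symmetric] intro!: sum.cong)
  then show "\<exists>J l r W p Us Ut s t. markov_data X Y Z J l r W p Us Ut s t \<and> M = markov_data.\<mu> X Y Z J l r W p Us Ut s t"
    using md by blast
qed

section \<open>Overlap of a symmetric pure state with a Markov state\<close>

lemma kron3_mult_vec_index:
  assumes "i < dim_row A" "k < dim_row B" "m < dim_row C" "dim_vec v = dim_col A * dim_col B * dim_col C"
  shows "(kron (kron A B) C *\<^sub>v v) $ ((i * dim_row B + k) * dim_row C + m) =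
    (\<Sum>x<dim_col A. \<Sum>y<dim_col B. \<Sum>z<dim_col C.
      A $$ (i, x) * B $$ (k, y) * C $$ (m, z) * v $ ((x * dim_col B + y) * dim_col C + z))"
proof -
  have "(kron (kron A B) C *\<^sub>v v) $ ((i * dim_row B + k) * dim_row C + m) =
    (\<Sum>u<dim_col A * dim_col B. \<Sum>z<dim_col C. kron A B $$ (i * dim_row B + k, u) * C $$ (m, z) * v $ (u * dim_col C + z))"
    using kron_mult_vec_index[of "i * dim_row B + k" "kron A B" m C v] assms by (simp add: index_pair_less)
  then show ?thesis unfolding sum_index_pairs using assms by (simp add: kron_pair_index)
qed

lemma isometry_columns:
  assumes "isometry_mat n m V" "i < m" "j < m"
  shows "(\<Sum>k<n. cnj (V $$ (k, i)) * V $$ (k, j)) = (if i = j then 1 else 0)"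
proof -
  have V: "V \<in> carrier_mat n m" "mat_adjoint V * V = 1\<^sub>m m" using assms unfolding isometry_mat_def by auto
  show ?thesis using arg_cong[OF V(2), of "\<lambda>M. M $$ (i, j)"] V(1) assms(2,3)
    by (simp add: times_mat_index del: index_mult_mat(1))
qed

lemma isometry_kron:
  assumes "isometry_mat a b V" "isometry_mat c e V'"
  shows "isometry_mat (a * c) (b * e) (kron V V')"
proof -
  have V: "V \<in> carrier_mat a b" "V' \<in> carrier_mat c e" using assms unfolding isometry_mat_def by auto
  then show ?thesis using assms unfolding isometry_mat_def
    by (auto simp: kron_adjoint kron_times kron_one)
qed

lemma isometry_one: "isometry_mat n n (1\<^sub>m n)"
  unfolding isometry_mat_def by auto

lemma isometry_times:
  assumes "isometry_mat a b V" "isometry_mat b c V'"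
  shows "isometry_mat a c (V * V')"
proof -
  have V: "V \<in> carrier_mat a b" "V' \<in> carrier_mat b c" "mat_adjoint V * V = 1\<^sub>m b" "mat_adjoint V' * V' = 1\<^sub>m c"
    using assms unfolding isometry_mat_def by auto
  have "mat_adjoint (V * V') * (V * V') = mat_adjoint V' * mat_adjoint V * (V * V')"
    using V by (subst mat_adjoint_times) auto
  also have "\<dots> = mat_adjoint V' * (mat_adjoint V * (V * V'))"
    using V by (intro assoc_mult_mat[of _ c b _ a _ c]) auto
  also have "mat_adjoint V * (V * V') = mat_adjoint V * V * V'"
    using V by (intro assoc_mult_mat[symmetric, of _ b a _ b _ c]) auto
  finally show ?thesis using V unfolding isometry_mat_def by auto
qed

lemma isometry_unitary_adjoint:
  assumes "unitary_mat n U"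
  shows "isometry_mat n n (mat_adjoint U)" "isometry_mat n n U"
  using unitary_matD[OF assms] unfolding isometry_mat_def by auto

lemma index_pair_eq: "m < b \<Longrightarrow> m' < b \<Longrightarrow> k * b + m = k' * b + m' \<longleftrightarrow> k = k' \<and> m = m'" for b :: nat
  by (metis add.commute add_right_cancel div_mult_self3 div_less add_0 gr_implies_not0 mult.commute)

lemma index_pair_div: "m < b \<Longrightarrow> (k * b + m) div b = k" for b :: nat
  by simp

lemma sum_one_mat: "c < n \<Longrightarrow> (\<Sum>z<n. 1\<^sub>m n $$ (c, z) * g z) = (g c :: complex)"
  using sum.delta[of "{..<n}" c g] by (simp add: if_distrib[of "\<lambda>x. x * _"] cong: if_cong)

text \<open>The conjugated rows of an isometry are an orthonormal basis of the large space seen in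
  the small one; orthonormality of the columns is the frame identity.\<close>

lemma isometry_frame_pairs:
  assumes V: "isometry_mat n (a * b) V"
  shows "parseval_frame {..<n} ({..<a} \<times> {..<b}) (\<lambda>k (x, y). cnj (V $$ (k, x * b + y)))"
  unfolding parseval_frame_def
  using isometry_columns[OF V] by (auto simp: index_pair_less index_pair_eq)

text \<open>Embeds A b_L and passes to the eigenbasis of \<sigma>_j; row \<open>k\<close> is the
  conjugate of the compressed k-th eigenvector. It stands before the locale below since the
  assumption on \<omega> is phrased with it, and \<open>VA\<close> is an argument because the
  embedding is later rotated.\<close>

definition (in markov_data) "P VA j = mat_adjoint (Us j) * kron VA (1\<^sub>m (l j))"

text \<open>The assumption \<open>omega\<close> says that the marginal of \<mu>, compressed to A, is
  the diagonal matrix with entries \<open>w\<close>. This is a choice of basis in A, made in C as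
  well so that \<open>sym\<close> keeps its form.\<close>

locale markov_overlap = markov_data +
  fixes d b :: nat and VA VB VC :: "complex mat" and \<psi> :: "complex vec" and \<epsilon> :: complex and w :: "nat \<Rightarrow> real"
  assumes VA: "isometry_mat X d VA" and VB: "isometry_mat Y b VB" and VC: "isometry_mat Z d VC"
    and \<psi>: "\<psi> \<in> carrier_vec (d * b * d)"
    and eps: "cmod \<epsilon> = 1"
    and sym: "\<And>a \<beta> c. a < d \<Longrightarrow> \<beta> < b \<Longrightarrow> c < d \<Longrightarrow> \<psi> $ ((a * b + \<beta>) * d + c) = \<epsilon> * \<psi> $ ((c * b + \<beta>) * d + a)"
    and omega: "\<And>a a'. a < d \<Longrightarrow> a' < d \<Longrightarrow>
      (\<Sum>j<J. \<Sum>k<X * l j. \<Sum>\<kappa><l j. complex_of_real (p j * s j k) * (cnj (P VA j $$ (k, a * l j + \<kappa>)) * P VA j $$ (k, a' * l j + \<kappa>)))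
      = (if a = a' then complex_of_real (w a) else 0)"
begin

definition "V = kron (kron VA VB) VC"
definition "R j = mat_adjoint (Ut j) * kron (1\<^sub>m (r j)) VC"
definition "WB j = mat_adjoint (W j) * VB"
text \<open>The component of \<psi> in block j with A and C still at their original dimension
  \<open>d\<close>; the embeddings of A and C are carried by \<open>P\<close> and \<open>R\<close>
  instead.\<close>

definition "\<Phi> j = kron (kron (1\<^sub>m d) (WB j)) (1\<^sub>m d) *\<^sub>v \<psi>"
definition "amp j k m = (\<Sum>x<d * l j. \<Sum>y<r j * d. P VA j $$ (k, x) * R j $$ (m, y) * \<Phi> j $ (x * (r j * d) + y))"

lemma V_carriers: "VA \<in> carrier_mat X d" "VB \<in> carrier_mat Y b" "VC \<in> carrier_mat Z d"
  using VA VB VC unfolding isometry_mat_def by auto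

lemma V_carrier: "V \<in> carrier_mat (X * Y * Z) (d * b * d)"
  using V_carriers unfolding V_def by simp

lemma WB_carrier: "j < J \<Longrightarrow> WB j \<in> carrier_mat (l j * r j) b"
  using W V_carriers unfolding WB_def by (intro mult_carrier_mat[of _ _ Y]) auto

lemma P_isometry: "j < J \<Longrightarrow> isometry_mat (X * l j) (d * l j) (P VA j)"
  unfolding P_def
  by (rule isometry_times[OF isometry_unitary_adjoint(1)[OF Us] isometry_kron[OF VA isometry_one]])

lemma R_isometry: "j < J \<Longrightarrow> isometry_mat (r j * Z) (r j * d) (R j)"
  unfolding R_def
  by (rule isometry_times[OF isometry_unitary_adjoint(1)[OF Ut] isometry_kron[OF isometry_one VC]])

text \<open>\<open>VA\<close> and \<open>VC\<close> act on other tensor factors than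
  \<open>W j\<close>, so they can be attached to the eigenvectors, which become the compressed
  \<open>P\<close> and \<open>R\<close>, while \<open>W j\<close> and \<open>VB\<close> merge into
  \<open>WB j\<close>. Associativity of \<open>kron\<close> regroups A, b_L b_R, C into A b_L and
  b_R C.\<close>

lemma adjoint_Q_V:
  assumes "j < J"
  shows "mat_adjoint (Q j) * V = kron (P VA j) (R j) * kron (kron (1\<^sub>m d) (WB j)) (1\<^sub>m d)"
proof -
  note c = G_carrier[OF assms] U_carrier[OF assms] V_carrier
  note u = unitary_matD(1)[OF Us[OF assms]] unitary_matD(1)[OF Ut[OF assms]]
  note v = V_carriers W[OF assms] WB_carrier[OF assms]
  let ?U = "kron (Us j) (Ut j)"
  have "mat_adjoint (Q j) = mat_adjoint ?U * mat_adjoint (G j)"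
    unfolding Q_def using c by (intro mat_adjoint_times) auto
  then have "mat_adjoint (Q j) * V = mat_adjoint ?U * (mat_adjoint (G j) * V)"
    using c by (simp add: assoc_mult_mat[of _ "n j" "n j" _ "X * Y * Z" _ "d * b * d"])
  also have "mat_adjoint (G j) * V = kron (kron VA (WB j)) VC"
    unfolding G_def V_def WB_def using v by (simp add: kron_adjoint kron_times)
  also have "\<dots> = kron (kron VA (1\<^sub>m (l j * r j))) VC * kron (kron (1\<^sub>m d) (WB j)) (1\<^sub>m d)"
    using v by (simp add: kron_times)
  also have "kron (kron VA (1\<^sub>m (l j * r j))) VC = kron (kron VA (1\<^sub>m (l j))) (kron (1\<^sub>m (r j)) VC)"
    by (simp add: kron_one[symmetric] kron_assoc)
  also have "mat_adjoint ?U * (kron (kron VA (1\<^sub>m (l j))) (kron (1\<^sub>m (r j)) VC) * kron (kron (1\<^sub>m d) (WB j)) (1\<^sub>m d)) =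
    mat_adjoint ?U * kron (kron VA (1\<^sub>m (l j))) (kron (1\<^sub>m (r j)) VC) * kron (kron (1\<^sub>m d) (WB j)) (1\<^sub>m d)"
    using v c by (intro assoc_mult_mat[symmetric, of _ "n j" "n j" _ "d * (l j * r j) * d" _ "d * b * d"])
      (auto simp: n_def mult_ac)
  also have "mat_adjoint ?U * kron (kron VA (1\<^sub>m (l j))) (kron (1\<^sub>m (r j)) VC) = kron (P VA j) (R j)"
    unfolding P_def R_def using v u by (simp add: kron_adjoint kron_times)
  finally show ?thesis .
qed

lemma amplitude:
  assumes "j < J" "k < X * l j" "m < r j * Z"
  shows "cinner (E (j, k * (r j * Z) + m)) (V *\<^sub>v \<psi>) = amp j k m"
proof -
  let ?i = "k * (r j * Z) + m"
  have i: "?i < n j" unfolding n_def using assms by (intro index_pair_less)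
  note c = Q_carrier[OF assms(1)] V_carrier \<psi> WB_carrier[OF assms(1)]
  have P: "P VA j \<in> carrier_mat (X * l j) (d * l j)" and R: "R j \<in> carrier_mat (r j * Z) (r j * d)"
    using P_isometry[OF assms(1)] R_isometry[OF assms(1)] unfolding isometry_mat_def by auto
  have \<Phi>: "dim_vec (\<Phi> j) = d * (l j * r j) * d" unfolding \<Phi>_def using c(4) by simp
  have V\<psi>: "V *\<^sub>v \<psi> \<in> carrier_vec (X * Y * Z)" using c by (intro mult_mat_vec_carrier) auto
  have "cinner (E (j, ?i)) (V *\<^sub>v \<psi>) = (\<Sum>a<X * Y * Z. cnj (Q j $$ (a, ?i)) * (V *\<^sub>v \<psi>) $ a)"
    unfolding cinner_def E_def using c i by (auto simp del: index_mult_mat_vec intro!: sum.cong)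
  also have "\<dots> = (mat_adjoint (Q j) *\<^sub>v (V *\<^sub>v \<psi>)) $ ?i"
    using c i carrier_vecD[OF V\<psi>] by (subst mult_mat_vec_index) (auto simp del: index_mult_mat_vec)
  also have "mat_adjoint (Q j) *\<^sub>v (V *\<^sub>v \<psi>) = (mat_adjoint (Q j) * V) *\<^sub>v \<psi>"
    using c by (intro assoc_mult_mat_vec[symmetric]) auto
  also have "\<dots> = kron (P VA j) (R j) *\<^sub>v \<Phi> j"
    unfolding adjoint_Q_V[OF assms(1)] \<Phi>_def
  proof (rule assoc_mult_mat_vec)
    show "kron (P VA j) (R j) \<in> carrier_mat (n j) (d * (l j * r j) * d)"
      using P R by (intro carrier_matI) (auto simp: n_def mult_ac)
  qed (use c in auto)
  also have "\<dots> $ ?i = amp j k m"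
    unfolding amp_def using kron_mult_vec_index[of k "P VA j" m "R j" "\<Phi> j"] P R \<Phi> assms
    by (simp add: mult_ac)
  finally show ?thesis .
qed

lemma \<Phi>_index:
  assumes "j < J" "a < d" "i < l j * r j" "c < d"
  shows "\<Phi> j $ ((a * (l j * r j) + i) * d + c) = (\<Sum>\<beta><b. WB j $$ (i, \<beta>) * \<psi> $ ((a * b + \<beta>) * d + c))"
proof -
  have B: "dim_row (WB j) = l j * r j" "dim_col (WB j) = b" using WB_carrier[OF assms(1)] by auto
  have "\<Phi> j $ ((a * (l j * r j) + i) * d + c) =
    (\<Sum>x<d. \<Sum>y<b. \<Sum>z<d. 1\<^sub>m d $$ (a, x) * WB j $$ (i, y) * 1\<^sub>m d $$ (c, z) * \<psi> $ ((x * b + y) * d + z))"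
    unfolding \<Phi>_def using kron3_mult_vec_index[of a "1\<^sub>m d" i "WB j" c "1\<^sub>m d" \<psi>] assms B \<psi> by simp
  also have "\<dots> = (\<Sum>x<d. 1\<^sub>m d $$ (a, x) * (\<Sum>y<b. \<Sum>z<d. 1\<^sub>m d $$ (c, z) * (WB j $$ (i, y) * \<psi> $ ((x * b + y) * d + z))))"
    by (simp only: sum_distrib_left mult_ac)
  also have "\<dots> = (\<Sum>\<beta><b. WB j $$ (i, \<beta>) * \<psi> $ ((a * b + \<beta>) * d + c))"
    by (simp only: sum_one_mat assms)
  finally show ?thesis .
qed

text \<open>Reshapes \<open>\<Phi> j\<close> into the two slots A b_L and b_R C that
  \<open>symmetric_block\<close> expects.\<close>

definition "\<phi> j = (\<lambda>(a, \<kappa>) (\<rho>, c). \<Phi> j $ ((a * l j + \<kappa>) * (r j * d) + (\<rho> * d + c)))"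

lemma \<phi>_eq:
  assumes "j < J" "a < d" "\<kappa> < l j" "\<rho> < r j" "c < d"
  shows "\<phi> j (a, \<kappa>) (\<rho>, c) = (\<Sum>\<beta><b. WB j $$ (\<kappa> * r j + \<rho>, \<beta>) * \<psi> $ ((a * b + \<beta>) * d + c))"
proof -
  have "(a * l j + \<kappa>) * (r j * d) + (\<rho> * d + c) = (a * (l j * r j) + (\<kappa> * r j + \<rho>)) * d + c"
    by (simp add: algebra_simps)
  then have "\<phi> j (a, \<kappa>) (\<rho>, c) = \<Phi> j $ ((a * (l j * r j) + (\<kappa> * r j + \<rho>)) * d + c)"
    unfolding \<phi>_def prod.case by (rule arg_cong)
  then show ?thesis using \<Phi>_index[of j a "\<kappa> * r j + \<rho>" c] assms by (simp add: index_pair_less)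
qed

definition "e j = (\<lambda>k (a, \<kappa>). cnj (P VA j $$ (k, a * l j + \<kappa>)))"
definition "f j = (\<lambda>m (\<rho>, c). cnj (R j $$ (m, \<rho> * d + c)))"

lemma frame_e: "j < J \<Longrightarrow> parseval_frame {..<X * l j} ({..<d} \<times> {..<l j}) (e j)"
  unfolding e_def by (rule isometry_frame_pairs[OF P_isometry])

lemma frame_f: "j < J \<Longrightarrow> parseval_frame {..<r j * Z} ({..<r j} \<times> {..<d}) (f j)"
  unfolding f_def by (rule isometry_frame_pairs[OF R_isometry])

text \<open>The quadratic form at \<open>y\<close> of p_j \<sigma>_j, compressed to A b_L and traced
  over b_L. Summed over j it becomes the form of \<omega>, so each single term is dominated by
  it.\<close>

definition "D j y = (\<Sum>k<X * l j. \<Sum>\<kappa><l j. p j * s j k * (cmod (\<Sum>a<d. cnj (e j k (a, \<kappa>)) * y a))\<^sup>2)"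

lemma D_nonneg: "j < J \<Longrightarrow> 0 \<le> D j y"
  unfolding D_def using p s by (intro sum_nonneg mult_nonneg_nonneg) auto

lemma sum_D: "(\<Sum>j<J. D j y) = (\<Sum>a<d. w a * (cmod (y a))\<^sup>2)"
proof -
  have sq: "complex_of_real ((cmod (\<Sum>a<d. g a))\<^sup>2) = (\<Sum>a<d. \<Sum>a'<d. cnj (g a) * g a')" for g :: "nat \<Rightarrow> complex"
  proof -
    have "complex_of_real ((cmod (\<Sum>a<d. g a))\<^sup>2) = cnj (\<Sum>a<d. g a) * (\<Sum>a<d. g a)"
      by (simp only: complex_norm_square mult.commute)
    then show ?thesis by (simp only: cnj_sum sum_product)
  qed
  have "complex_of_real (\<Sum>j<J. D j y) = (\<Sum>j<J. \<Sum>k<X * l j. \<Sum>\<kappa><l j. \<Sum>a<d. \<Sum>a'<d. complex_of_real (p j * s j k) *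
     (cnj (P VA j $$ (k, a * l j + \<kappa>)) * P VA j $$ (k, a' * l j + \<kappa>)) * (cnj (y a) * y a'))"
    unfolding D_def of_real_sum of_real_mult[of "p _ * s _ _"] sq sum_distrib_left
    by (intro sum.cong refl) (simp add: e_def mult_ac)
  also have "\<dots> = (\<Sum>a<d. \<Sum>a'<d. (\<Sum>j<J. \<Sum>k<X * l j. \<Sum>\<kappa><l j. complex_of_real (p j * s j k) *
     (cnj (P VA j $$ (k, a * l j + \<kappa>)) * P VA j $$ (k, a' * l j + \<kappa>))) * (cnj (y a) * y a'))"
    unfolding sum_distrib_right
    by (simp only: sum.swap[of _ "{..<d}" "{..<l _}"] sum.swap[of _ "{..<d}" "{..<X * l _}"] sum.swap[of _ "{..<d}" "{..<J}"])
  also have "\<dots> = (\<Sum>a<d. \<Sum>a'<d. if a = a' then complex_of_real (w a) * (cnj (y a) * y a') else 0)"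
    by (intro sum.cong refl) (simp add: omega del: of_real_mult)
  also have "\<dots> = complex_of_real (\<Sum>a<d. w a * (cmod (y a))\<^sup>2)"
    by (simp only: sum.delta' sum.delta finite_lessThan of_real_sum of_real_mult complex_norm_square)
      (auto simp: mult_ac intro!: sum.cong)
  finally show ?thesis unfolding of_real_eq_iff .
qed

lemma w_nonneg:
  assumes "a < d"
  shows "0 \<le> w a"
proof -
  have "(\<Sum>a'<d. w a' * (cmod (if a' = a then 1 else 0))\<^sup>2) = (\<Sum>a'<d. if a' = a then w a' else 0)"
    by (intro sum.cong) auto
  also have "\<dots> = w a" using assms by simp
  finally show ?thesis using sum_D[of "\<lambda>a'. if a' = a then 1 else 0"]
    sum_nonneg[of "{..<J}" "\<lambda>j. D j (\<lambda>a'. if a' = a then 1 else 0)"] D_nonneg by simp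
qed

text \<open>Compression can only shorten the eigenvectors, so \<open>frame_norm_le_1\<close> bounds
  the trace by the sum of the p_j s_j, which is 1.\<close>

lemma w_sum: "(\<Sum>a<d. w a) \<le> 1"
proof -
  have w: "w a = (\<Sum>j<J. \<Sum>k<X * l j. \<Sum>\<kappa><l j. p j * s j k * (cmod (e j k (a, \<kappa>)))\<^sup>2)" if "a < d" for a
  proof -
    have "complex_of_real (w a) = complex_of_real (\<Sum>j<J. \<Sum>k<X * l j. \<Sum>\<kappa><l j. p j * s j k * (cmod (e j k (a, \<kappa>)))\<^sup>2)"
      using omega[OF that that, symmetric]
      by (simp add: e_def complex_norm_square mult_ac del: of_real_power)
    then show ?thesis unfolding of_real_eq_iff .
  qed
  have "(\<Sum>a<d. w a) = (\<Sum>a<d. \<Sum>j<J. \<Sum>k<X * l j. \<Sum>\<kappa><l j. p j * s j k * (cmod (e j k (a, \<kappa>)))\<^sup>2)"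
    by (intro sum.cong refl) (simp add: w)
  also have "\<dots> = (\<Sum>j<J. \<Sum>k<X * l j. p j * s j k * (\<Sum>a<d. \<Sum>\<kappa><l j. (cmod (e j k (a, \<kappa>)))\<^sup>2))"
    by (simp only: sum_distrib_left sum.swap[of _ "{..<X * l _}" "{..<d}"] sum.swap[of _ "{..<J}" "{..<d}"])
  also have "\<dots> \<le> (\<Sum>j<J. \<Sum>k<X * l j. p j * s j k * 1)"
    using frame_norm_le_1[OF frame_e] p s
    by (intro sum_mono mult_left_mono) (auto simp: sum.cartesian_product')
  also have "\<dots> = (\<Sum>j<J. p j)" using s(2) by (simp add: sum_distrib_left[symmetric])
  finally show ?thesis using p(2) by simp
qed

text \<open>If the embedded \<psi> is in the range of \<mu>, it is orthogonal to every eigenvector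
  of \<mu> with eigenvalue 0, and \<open>amp\<close> is the overlap with such an
  eigenvector.\<close>

lemma amp_zero:
  assumes y: "y \<in> carrier_vec (X * Y * Z)" "V *\<^sub>v \<psi> = \<mu> *\<^sub>v y"
    and jkm: "j < J" "k < X * l j" "m < r j * Z" and z: "p j * s j k = 0 \<or> t j m = 0"
  shows "amp j k m = 0"
proof -
  let ?i = "(j, k * (r j * Z) + m)"
  have i: "?i \<in> idx" unfolding idx_def n_def using jkm index_pair_less[OF jkm(2,3)] by auto
  have "eig j (k * (r j * Z) + m) = p j * (s j k * t j m)" unfolding eig_def by (simp add: index_pair_div[OF jkm(3)] jkm(3))
  then have "\<mu> *\<^sub>v E ?i = 0 \<cdot>\<^sub>v E ?i" using \<mu>_eigen[OF i] z by auto
  from cinner_eigenvector_range[OF \<mu>_carrier \<mu>_hermitian E_carrier[OF i] this y(1)]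
  show ?thesis unfolding amplitude[OF jkm, symmetric] y(2) .
qed

text \<open>The probability p_j is attached to the weights of \<sigma>_j, because it is the marginal
  of p_j \<sigma>_j that \<omega> dominates, while the weights of \<tau>_j must keep total 1. The
  exchange symmetry survives in each block, since \<open>WB j\<close> acts on B alone.\<close>

lemma block:
  assumes y: "y \<in> carrier_vec (X * Y * Z)" "V *\<^sub>v \<psi> = \<mu> *\<^sub>v y" and j: "j < J"
  shows "symmetric_block {..<d} {..<l j} {..<r j} {..<X * l j} {..<r j * Z} (e j) (f j)
    (\<lambda>k. p j * s j k) (t j) w (\<phi> j) \<epsilon> (amp j)"
proof
  show "(\<Sum>k<X * l j. \<Sum>\<kappa><l j. p j * s j k * (cmod (\<Sum>a<d. cnj (e j k (a, \<kappa>)) * y a))\<^sup>2) \<le> (\<Sum>a<d. w a * (cmod (y a))\<^sup>2)" for y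
    unfolding sum_D[symmetric] D_def[symmetric] using j D_nonneg
    by (intro member_le_sum[where f = "\<lambda>j. D j y"]) auto
  show "\<phi> j (a, \<kappa>) (\<rho>, c) = \<epsilon> * \<phi> j (c, \<kappa>) (\<rho>, a)" if "a \<in> {..<d}" "\<kappa> \<in> {..<l j}" "\<rho> \<in> {..<r j}" "c \<in> {..<d}" for a \<kappa> \<rho> c
  proof -
    have "\<phi> j (a, \<kappa>) (\<rho>, c) = (\<Sum>\<beta><b. WB j $$ (\<kappa> * r j + \<rho>, \<beta>) * \<psi> $ ((a * b + \<beta>) * d + c))"
      using \<phi>_eq[OF j] that by simp
    also have "\<dots> = (\<Sum>\<beta><b. WB j $$ (\<kappa> * r j + \<rho>, \<beta>) * (\<epsilon> * \<psi> $ ((c * b + \<beta>) * d + a)))"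
      using that by (intro sum.cong refl arg_cong2[where f = "(*)"] sym) auto
    also have "\<dots> = \<epsilon> * \<phi> j (c, \<kappa>) (\<rho>, a)"
      using \<phi>_eq[OF j, of c \<kappa> \<rho> a] that by (simp add: sum_distrib_left mult_ac)
    finally show ?thesis .
  qed
  show "amp j k m = (\<Sum>x\<in>{..<d} \<times> {..<l j}. \<Sum>y\<in>{..<r j} \<times> {..<d}. cnj (e j k x) * cnj (f j m y) * \<phi> j x y)" for k m
    unfolding amp_def by (simp add: sum_index_pairs sum.cartesian_product' e_def f_def \<phi>_def)
  show "amp j k m = 0" if "k \<in> {..<X * l j}" "m \<in> {..<r j * Z}" "p j * s j k = 0 \<or> t j m = 0" for k m
    using amp_zero[OF y j] that by auto
qed (use frame_e[OF j] frame_f[OF j] p s t w_nonneg eps j in auto)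

text \<open>The diagonal entry at \<open>a\<close> of the state of \<psi> on A, in the basis that
  diagonalises \<omega>.\<close>

definition "marginal a = (\<Sum>\<beta><b. \<Sum>c<d. (cmod (\<psi> $ ((a * b + \<beta>) * d + c)))\<^sup>2)"

text \<open>Stacking the \<open>WB j\<close> gives an isometry from B to the direct sum of all b_L
  b_R: the \<open>W j\<close> resolve the identity and \<open>VB\<close> is an isometry. The
  conjugated rows of that isometry form the frame.\<close>

lemma WB_frame: "parseval_frame (Sigma {..<J} (\<lambda>j. {..<l j * r j})) {..<b} (\<lambda>k \<beta>. cnj (WB (fst k) $$ (snd k, \<beta>)))"
  unfolding parseval_frame_def
proof (intro conjI ballI)
  fix \<beta> \<beta>' assume "\<beta> \<in> {..<b}" "\<beta>' \<in> {..<b}"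
  then have \<beta>: "\<beta> < b" "\<beta>' < b" by auto
  have "(\<Sum>k\<in>Sigma {..<J} (\<lambda>j. {..<l j * r j}). cnj (WB (fst k) $$ (snd k, \<beta>)) *
      cnj (cnj (WB (fst k) $$ (snd k, \<beta>')))) =
    (\<Sum>j<J. \<Sum>i<l j * r j. cnj (WB j $$ (i, \<beta>)) * WB j $$ (i, \<beta>'))"
    by (subst sum.Sigma) (auto intro!: sum.cong)
  also have "\<dots> = (\<Sum>j<J. \<Sum>y<Y. \<Sum>y'<Y. cnj (VB $$ (y, \<beta>)) * VB $$ (y', \<beta>') * (W j * mat_adjoint (W j)) $$ (y, y'))"
  proof (rule sum.cong[OF refl])
    fix j assume "j \<in> {..<J}"
    then have j: "j < J" by simp
    note c = W[OF j] V_carriers(2) WB_carrier[OF j]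
    have WB: "WB j $$ (i, \<beta>) = (\<Sum>y<Y. cnj (W j $$ (y, i)) * VB $$ (y, \<beta>))" if "i < l j * r j" "\<beta> < b" for i \<beta>
      unfolding WB_def using c that by (subst times_mat_index) auto
    have WW: "(W j * mat_adjoint (W j)) $$ (y, y') = (\<Sum>i<l j * r j. W j $$ (y, i) * cnj (W j $$ (y', i)))" if "y < Y" "y' < Y" for y y'
      using c that by (subst times_mat_index) auto
    have "(\<Sum>i<l j * r j. cnj (WB j $$ (i, \<beta>)) * WB j $$ (i, \<beta>')) =
      (\<Sum>i<l j * r j. \<Sum>y<Y. \<Sum>y'<Y. cnj (VB $$ (y, \<beta>)) * VB $$ (y', \<beta>') * (W j $$ (y, i) * cnj (W j $$ (y', i))))"
    proof (intro sum.cong refl)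
      fix i assume "i \<in> {..<l j * r j}"
      then have i: "i < l j * r j" by simp
      show "cnj (WB j $$ (i, \<beta>)) * WB j $$ (i, \<beta>') =
        (\<Sum>y<Y. \<Sum>y'<Y. cnj (VB $$ (y, \<beta>)) * VB $$ (y', \<beta>') * (W j $$ (y, i) * cnj (W j $$ (y', i))))"
        unfolding WB[OF i \<beta>(1)] WB[OF i \<beta>(2)] cnj_sum sum_product
        by (intro sum.cong refl) simp
    qed
    also have "\<dots> = (\<Sum>y<Y. \<Sum>y'<Y. cnj (VB $$ (y, \<beta>)) * VB $$ (y', \<beta>') * (W j * mat_adjoint (W j)) $$ (y, y'))"
      by (simp only: sum.swap[of _ "{..<Y}" "{..<l j * r j}"], intro sum.cong refl)
        (simp add: WW sum_distrib_left del: index_mult_mat(1))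
    finally show "(\<Sum>i<l j * r j. cnj (WB j $$ (i, \<beta>)) * WB j $$ (i, \<beta>')) =
      (\<Sum>y<Y. \<Sum>y'<Y. cnj (VB $$ (y, \<beta>)) * VB $$ (y', \<beta>') * (W j * mat_adjoint (W j)) $$ (y, y'))" .
  qed
  also have "\<dots> = (\<Sum>y<Y. \<Sum>y'<Y. cnj (VB $$ (y, \<beta>)) * VB $$ (y', \<beta>') * (if y = y' then 1 else 0))"
    by (simp only: sum.swap[of _ "{..<Y}" "{..<J}"] sum_distrib_left[symmetric], intro sum.cong refl)
      (simp add: W_complete del: index_mult_mat(1))
  also have "\<dots> = (\<Sum>y<Y. \<Sum>y'<Y. if y = y' then cnj (VB $$ (y, \<beta>)) * VB $$ (y', \<beta>') else 0)"
    by (intro sum.cong) auto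
  also have "\<dots> = (if \<beta> = \<beta>' then 1 else 0)" using isometry_columns[OF VB \<beta>] by simp
  finally show "(\<Sum>k\<in>Sigma {..<J} (\<lambda>j. {..<l j * r j}). cnj (WB (fst k) $$ (snd k, \<beta>)) *
      cnj (cnj (WB (fst k) $$ (snd k, \<beta>')))) = (if \<beta> = \<beta>' then 1 else 0)" .
qed auto

text \<open>For fixed indices in A and C this is Parseval for the stacked block maps: decomposing B
  into blocks preserves the norm.\<close>

lemma sum_weights:
  assumes y: "y \<in> carrier_vec (X * Y * Z)" "V *\<^sub>v \<psi> = \<mu> *\<^sub>v y" and a: "a < d"
  shows "(\<Sum>j<J. symmetric_block.weight {..<d} {..<l j} {..<r j} (\<phi> j) a) = marginal a"
proof -
  have "(\<Sum>j<J. \<Sum>\<kappa><l j. \<Sum>y\<in>{..<r j} \<times> {..<d}. (cmod (\<phi> j (a, \<kappa>) y))\<^sup>2) =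
    (\<Sum>j<J. \<Sum>i<l j * r j. \<Sum>c<d. (cmod (\<Sum>\<beta><b. WB j $$ (i, \<beta>) * \<psi> $ ((a * b + \<beta>) * d + c)))\<^sup>2)"
    unfolding sum_index_pairs sum.cartesian_product'
    by (intro sum.cong refl) (simp add: \<phi>_eq a)
  also have "\<dots> = (\<Sum>k\<in>Sigma {..<J} (\<lambda>j. {..<l j * r j}). \<Sum>c<d.
      (cmod (\<Sum>\<beta><b. cnj (cnj (WB (fst k) $$ (snd k, \<beta>))) * \<psi> $ ((a * b + \<beta>) * d + c)))\<^sup>2)"
    by (subst sum.Sigma) (auto intro!: sum.cong)
  also have "\<dots> = (\<Sum>c<d. \<Sum>\<beta><b. (cmod (\<psi> $ ((a * b + \<beta>) * d + c)))\<^sup>2)"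
    by (subst sum.swap) (intro sum.cong refl frame_parseval[OF WB_frame])
  also have "\<dots> = marginal a" unfolding marginal_def by (rule sum.swap)
  finally show ?thesis
    using symmetric_block.weight_def[OF block[OF y]] by simp
qed

text \<open>The expectation of the logarithm of \<mu> is a sum over blocks of the left-hand sides of
  \<open>log_weights_le\<close>; on the right the weights of the blocks add up to the marginal.
  Dividing by ln 2 passes to the binary logarithm.\<close>

lemma range_bound:
  assumes y: "y \<in> carrier_vec (X * Y * Z)" "V *\<^sub>v \<psi> = \<mu> *\<^sub>v y"
  shows "Re (cinner (V *\<^sub>v \<psi>) (mat_fun log2s \<mu> *\<^sub>v (V *\<^sub>v \<psi>))) \<le> (\<Sum>a<d. marginal a * log2s (w a))"
    and "\<And>a. a < d \<Longrightarrow> w a = 0 \<Longrightarrow> marginal a = 0"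
proof -
  note blk = block[OF y]
  let ?weight = "\<lambda>j. symmetric_block.weight {..<d} {..<l j} {..<r j} (\<phi> j)"
  show mz: "marginal a = 0" if "a < d" "w a = 0" for a
    unfolding sum_weights[OF y that(1), symmetric]
    using symmetric_block.weight_zero[OF blk] that by (intro sum.neutral) auto
  have V\<psi>: "V *\<^sub>v \<psi> \<in> carrier_vec (X * Y * Z)" using V_carrier \<psi> by (intro mult_mat_vec_carrier) auto
  have "cinner (V *\<^sub>v \<psi>) (mat_fun log2s \<mu> *\<^sub>v (V *\<^sub>v \<psi>)) =
    complex_of_real (\<Sum>i\<in>idx. (cmod (cinner (E i) (V *\<^sub>v \<psi>)))\<^sup>2 * log2s (case i of (j, m) \<Rightarrow> eig j m))"
    by (rule spectral_expectation[OF \<mu>_carrier \<mu>_hermitian V\<psi> finite_idx E_carrier \<mu>_eigen E_complete])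
  also have "(\<Sum>i\<in>idx. (cmod (cinner (E i) (V *\<^sub>v \<psi>)))\<^sup>2 * log2s (case i of (j, m) \<Rightarrow> eig j m)) =
    (\<Sum>j<J. \<Sum>k<X * l j. \<Sum>m<r j * Z. (cmod (amp j k m))\<^sup>2 * ln (p j * s j k * t j m) / ln 2)"
    unfolding sum_idx n_def sum_index_pairs[of _ "X * l _" "r _ * Z"] prod.case
  proof (intro sum.cong refl)
    fix j k m assume "j \<in> {..<J}" "k \<in> {..<X * l j}" "m \<in> {..<r j * Z}"
    then have jkm: "j < J" "k < X * l j" "m < r j * Z" by auto
    have x: "eig j (k * (r j * Z) + m) = p j * s j k * t j m"
      unfolding eig_def by (simp add: index_pair_div[OF jkm(3)] jkm(3))
    show "(cmod (cinner (E (j, k * (r j * Z) + m)) (V *\<^sub>v \<psi>)))\<^sup>2 * log2s (eig j (k * (r j * Z) + m)) =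
        (cmod (amp j k m))\<^sup>2 * ln (p j * s j k * t j m) / ln 2"
    \<comment> \<open>At eigenvalue 0 the values of \<open>log2s\<close> and \<open>ln\<close> are
      not compared; the amplitude is 0 there.\<close>
    proof (cases "p j * s j k = 0 \<or> t j m = 0")
      case True
      then show ?thesis unfolding amplitude[OF jkm] using amp_zero[OF y jkm] by simp
    next
      case False
      then have "0 < p j * s j k * t j m"
        using p(1)[OF jkm(1)] s(1)[OF jkm(1,2)] t(1)[OF jkm(1,3)] by (simp add: order_le_less)
      then show ?thesis unfolding amplitude[OF jkm] x by (simp add: log2s_def log_def)
    qed
  qed
  finally have "Re (cinner (V *\<^sub>v \<psi>) (mat_fun log2s \<mu> *\<^sub>v (V *\<^sub>v \<psi>))) =
    (\<Sum>j<J. (\<Sum>k<X * l j. \<Sum>m<r j * Z. (cmod (amp j k m))\<^sup>2 * ln (p j * s j k * t j m)) / ln 2)"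
    by (simp add: sum_divide_distrib)
  also have "\<dots> \<le> (\<Sum>j<J. (\<Sum>a<d. ?weight j a * ln (w a)) / ln 2)"
    using symmetric_block.log_weights_le[OF blk] by (intro sum_mono divide_right_mono) auto
  also have "\<dots> = (\<Sum>a<d. (\<Sum>j<J. ?weight j a) * ln (w a) / ln 2)"
    by (simp add: sum_divide_distrib sum_distrib_right) (rule sum.swap)
  also have "\<dots> = (\<Sum>a<d. marginal a * log2s (w a))"
  proof (intro sum.cong refl)
    fix a assume "a \<in> {..<d}"
    then have a: "a < d" by simp
    show "(\<Sum>j<J. ?weight j a) * ln (w a) / ln 2 = marginal a * log2s (w a)"
      unfolding sum_weights[OF y a] using mz[OF a] w_nonneg[OF a]
      by (cases "w a = 0") (auto simp: log2s_def log_def)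
  qed
  finally show "Re (cinner (V *\<^sub>v \<psi>) (mat_fun log2s \<mu> *\<^sub>v (V *\<^sub>v \<psi>))) \<le> (\<Sum>a<d. marginal a * log2s (w a))" .
qed

end

section \<open>The lower bound\<close>

text \<open>Use ln x \<le> x - 1 at x = w a / lam i with weight lam i * T a i. As \<open>T\<close>
  is doubly stochastic, the right-hand sides sum to the trace of \<omega> minus 1, which is at most
  0. In the application \<open>T\<close> consists of the squared overlaps of the eigenbases of
  \<omega> and of the state on A.\<close>

lemma klein_inequality:
  fixes n :: nat
  assumes lam: "\<And>i. i < n \<Longrightarrow> 0 \<le> lam i" "(\<Sum>i<n. lam i) = 1"
    and w: "\<And>a. a < n \<Longrightarrow> 0 \<le> w a" "(\<Sum>a<n. w a) \<le> 1"
    and T: "\<And>a i. a < n \<Longrightarrow> i < n \<Longrightarrow> 0 \<le> T a i"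
      "\<And>i. i < n \<Longrightarrow> (\<Sum>a<n. T a i) = 1" "\<And>a. a < n \<Longrightarrow> (\<Sum>i<n. T a i) = 1"
    and q: "\<And>a. a < n \<Longrightarrow> q a = (\<Sum>i<n. lam i * T a i)"
    and supp: "\<And>a. a < n \<Longrightarrow> w a = 0 \<Longrightarrow> q a = 0"
  shows "(\<Sum>a<n. q a * log2s (w a)) \<le> (\<Sum>i<n. lam i * log2s (lam i))"
proof -
  have pointwise: "lam i * T a i * log2s (w a) - lam i * T a i * log2s (lam i) \<le> T a i * (w a - lam i) / ln 2"
    if a: "a < n" and i: "i < n" for a i
  proof (cases "lam i = 0 \<or> T a i = 0")
    case True
    then show ?thesis using w(1)[OF a] T(1)[OF a i] by auto
  next
    case False
    then have l: "0 < lam i" and t: "0 < T a i" using lam(1)[OF i] T(1)[OF a i] by auto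
    have "0 < lam i * T a i" using l t by simp
    also have "\<dots> \<le> q a" unfolding q[OF a] using lam(1) T(1) a i
      by (intro member_le_sum[where f = "\<lambda>i. lam i * T a i"]) auto
    finally have wa: "0 < w a" using supp[OF a] w(1)[OF a] by (cases "w a = 0") auto
    have "ln (w a / lam i) \<le> w a / lam i - 1" using wa l by (intro ln_le_minus_one) simp
    then have "ln (w a) - ln (lam i) \<le> (w a - lam i) / lam i" using wa l by (simp add: ln_div diff_divide_distrib)
    then have "(lam i * T a i) * (ln (w a) - ln (lam i)) \<le> (lam i * T a i) * ((w a - lam i) / lam i)"
      using l t by (intro mult_left_mono) auto
    also have "\<dots> = T a i * (w a - lam i)" using l by simp
    finally have "(lam i * T a i) * (ln (w a) - ln (lam i)) / ln 2 \<le> T a i * (w a - lam i) / ln 2"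
      by (rule divide_right_mono) simp
    then show ?thesis using wa l by (simp add: log2s_def log_def algebra_simps diff_divide_distrib)
  qed
  have "(\<Sum>a<n. q a * log2s (w a)) - (\<Sum>i<n. lam i * log2s (lam i)) =
    (\<Sum>a<n. \<Sum>i<n. lam i * T a i * log2s (w a)) - (\<Sum>i<n. \<Sum>a<n. lam i * T a i * log2s (lam i))"
    using T(2) by (simp add: q sum_distrib_right sum_distrib_left[symmetric] mult.assoc[symmetric])
      (simp add: mult_ac sum_distrib_left[symmetric])
  also have "\<dots> = (\<Sum>a<n. \<Sum>i<n. lam i * T a i * log2s (w a) - lam i * T a i * log2s (lam i))"
    by (subst (2) sum.swap) (simp add: sum_subtractf)
  also have "\<dots> \<le> (\<Sum>a<n. \<Sum>i<n. T a i * (w a - lam i) / ln 2)"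
    using pointwise by (intro sum_mono) auto
  also have "\<dots> = ((\<Sum>a<n. w a * (\<Sum>i<n. T a i)) - (\<Sum>a<n. \<Sum>i<n. lam i * T a i)) / ln 2"
    by (simp add: sum_divide_distrib[symmetric] sum_subtractf sum_distrib_left algebra_simps)
  also have "(\<Sum>a<n. \<Sum>i<n. lam i * T a i) = (\<Sum>i<n. lam i * (\<Sum>a<n. T a i))"
    by (subst sum.swap) (simp add: sum_distrib_left)
  also have "((\<Sum>a<n. w a * (\<Sum>i<n. T a i)) - (\<Sum>i<n. lam i * (\<Sum>a<n. T a i))) / ln 2 = ((\<Sum>a<n. w a) - 1) / ln 2"
    using T lam(2) by simp
  also have "\<dots> \<le> 0" using w(2) by (simp add: divide_nonpos_pos)
  finally show ?thesis by simp
qed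

section \<open>Reduced states of a pure state\<close>

lemma red_A_carrier: "red_A dA dB dC \<psi> \<in> carrier_mat dA dA"
  unfolding red_A_def ptrace_mid_def by simp

lemma red_A_index:
  assumes "\<psi> \<in> carrier_vec (dA * (dB * dC))" "a < dA" "a' < dA"
  shows "red_A dA dB dC \<psi> $$ (a, a') = (\<Sum>k<dB * dC. \<psi> $ (a * (dB * dC) + k) * cnj (\<psi> $ (a' * (dB * dC) + k)))"
  unfolding red_A_def ptrace_mid_def using assms
  by (auto simp: proj_vec_def index_pair_less intro!: sum.cong)

lemma sum_norm_pure:
  assumes "pure_state n \<psi>"
  shows "(\<Sum>i<n. (cmod (\<psi> $ i))\<^sup>2) = 1"
proof -
  have "complex_of_real (\<Sum>i<n. (cmod (\<psi> $ i))\<^sup>2) = 1"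
    using assms unfolding cmod_sq_sum pure_state_def using cinner_carrier[of \<psi> n \<psi>] by simp
  then show ?thesis unfolding of_real_eq_1_iff .
qed

text \<open>A Gram matrix is positive, its form at \<open>v\<close> being a sum of squared moduli
  over \<open>K\<close>. Both marginals of a pure state are of this kind, with the traced-out index
  in the role of \<open>k\<close>.\<close>

lemma density_mat_gram:
  assumes M: "M \<in> carrier_mat n n"
    and entries: "\<And>a a'. a < n \<Longrightarrow> a' < n \<Longrightarrow> M $$ (a, a') = (\<Sum>k\<in>K. g a k * cnj (g a' k))"
    and norm: "(\<Sum>a<n. \<Sum>k\<in>K. (cmod (g a k))\<^sup>2) = 1"
  shows "density_mat n M"
  unfolding density_mat_def
proof (intro conjI ballI)
  show "hermitian_mat M"
    unfolding hermitian_mat_def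
    by (rule eq_matI) (use M entries in \<open>auto simp: mult.commute\<close>)
  have "mtrace M = (\<Sum>a<n. \<Sum>k\<in>K. g a k * cnj (g a k))"
    unfolding mtrace_def using M entries by auto
  also have "\<dots> = complex_of_real (\<Sum>a<n. \<Sum>k\<in>K. (cmod (g a k))\<^sup>2)"
    by (simp add: complex_norm_square del: of_real_power)
  finally show "mtrace M = 1" unfolding norm by simp
  fix v :: "complex vec" assume v: "v \<in> carrier_vec n"
  have "cinner v (M *\<^sub>v v) = (\<Sum>a<n. \<Sum>a'<n. \<Sum>k\<in>K. (cnj (v $ a) * g a k) * (cnj (g a' k) * v $ a'))"
    unfolding cinner_carrier[OF v] using M v entries
    by (intro sum.cong refl) (auto simp: mult_mat_vec_index sum_distrib_left sum_distrib_right mult_ac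
        simp del: index_mult_mat_vec intro!: sum.cong)
  also have "\<dots> = (\<Sum>k\<in>K. (\<Sum>a<n. cnj (v $ a) * g a k) * (\<Sum>a'<n. cnj (g a' k) * v $ a'))"
    by (simp only: sum.swap[of _ K "{..<n}"] sum_product)
  also have "\<dots> = (\<Sum>k\<in>K. complex_of_real ((cmod (\<Sum>a<n. cnj (v $ a) * g a k))\<^sup>2))"
    by (intro sum.cong refl) (simp only: complex_norm_square cnj_sum complex_cnj_mult complex_cnj_cnj mult.commute)
  also have "\<dots> = complex_of_real (\<Sum>k\<in>K. (cmod (\<Sum>a<n. cnj (v $ a) * g a k))\<^sup>2)" by simp
  finally show "0 \<le> Re (cinner v (M *\<^sub>v v))" by (simp add: sum_nonneg)
qed (rule M)

lemma density_red_A: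
  assumes "pure_state (dA * (dB * dC)) \<psi>"
  shows "density_mat dA (red_A dA dB dC \<psi>)"
proof (rule density_mat_gram[where K = "{..<dB * dC}" and g = "\<lambda>a k. \<psi> $ (a * (dB * dC) + k)"])
  show "(\<Sum>a<dA. \<Sum>k<dB * dC. (cmod (\<psi> $ (a * (dB * dC) + k)))\<^sup>2) = 1"
    using sum_norm_pure[OF assms] unfolding sum_index_pairs[of _ dA "dB * dC"] .
qed (use assms red_A_carrier red_A_index in \<open>auto simp: pure_state_def\<close>)

lemma pure_state_isometry:
  assumes V: "isometry_mat m n V" and \<psi>: "pure_state n \<psi>"
  shows "pure_state m (V *\<^sub>v \<psi>)"
proof -
  have V: "V \<in> carrier_mat m n" "mat_adjoint V * V = 1\<^sub>m n" using V unfolding isometry_mat_def by auto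
  have \<psi>: "\<psi> \<in> carrier_vec n" "cinner \<psi> \<psi> = 1" using \<psi> unfolding pure_state_def by auto
  have c: "V *\<^sub>v \<psi> \<in> carrier_vec m" using V \<psi> by (intro mult_mat_vec_carrier) auto
  have "cinner (V *\<^sub>v \<psi>) (V *\<^sub>v \<psi>) = cinner (mat_adjoint V *\<^sub>v (V *\<^sub>v \<psi>)) \<psi>"
    by (rule cinner_mult_mat_vec[OF V(1) c \<psi>(1)])
  also have "mat_adjoint V *\<^sub>v (V *\<^sub>v \<psi>) = (mat_adjoint V * V) *\<^sub>v \<psi>"
    using V \<psi> by (intro assoc_mult_mat_vec[symmetric]) auto
  finally show ?thesis using c V \<psi> unfolding pure_state_def by simp
qed

lemma unitary_adjoint: "unitary_mat n U \<Longrightarrow> unitary_mat n (mat_adjoint U)"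
  using unitary_matD[of n U] unfolding unitary_mat_def by auto

text \<open>Both sides evaluate the quadratic form of one matrix, given once as a Gram matrix and
  once by its spectral decomposition.\<close>

lemma weighted_square_gram:
  fixes n :: nat
  assumes rho: "\<And>x y. x < n \<Longrightarrow> y < n \<Longrightarrow> (\<Sum>k\<in>K. g x k * cnj (g y k)) = (\<Sum>i<m. Y x i * complex_of_real (lam i) * cnj (Y y i))"
  shows "(\<Sum>k\<in>K. (cmod (\<Sum>x<n. c x * g x k))\<^sup>2) = (\<Sum>i<m. lam i * (cmod (\<Sum>x<n. c x * Y x i))\<^sup>2)"
proof -
  have sq: "complex_of_real ((cmod (\<Sum>x<n. h x))\<^sup>2) = (\<Sum>x<n. \<Sum>y<n. h x * cnj (h y))" for h :: "nat \<Rightarrow> complex"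
    by (simp only: complex_norm_square cnj_sum sum_product)
  have "complex_of_real (\<Sum>k\<in>K. (cmod (\<Sum>x<n. c x * g x k))\<^sup>2) =
    (\<Sum>k\<in>K. \<Sum>x<n. \<Sum>y<n. c x * cnj (c y) * (g x k * cnj (g y k)))"
    unfolding of_real_sum sq by (intro sum.cong refl) simp
  also have "\<dots> = (\<Sum>x<n. \<Sum>y<n. c x * cnj (c y) * (\<Sum>k\<in>K. g x k * cnj (g y k)))"
    by (simp only: sum.swap[of _ "{..<n}" K] sum_distrib_left)
  also have "\<dots> = (\<Sum>x<n. \<Sum>y<n. c x * cnj (c y) * (\<Sum>i<m. Y x i * complex_of_real (lam i) * cnj (Y y i)))"
    by (intro sum.cong refl) (simp add: rho)
  also have "\<dots> = (\<Sum>i<m. \<Sum>x<n. \<Sum>y<n. c x * cnj (c y) * (Y x i * complex_of_real (lam i) * cnj (Y y i)))"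
    unfolding sum_distrib_left by (subst (2) sum.swap, subst sum.swap) (rule refl)
  also have "\<dots> = complex_of_real (\<Sum>i<m. lam i * (cmod (\<Sum>x<n. c x * Y x i))\<^sup>2)"
    unfolding of_real_sum of_real_mult sq sum_distrib_left by (intro sum.cong refl) (simp add: mult_ac)
  finally show ?thesis unfolding of_real_eq_iff .
qed

text \<open>The compressed marginal of \<mu> on A is diagonalised by some \<open>U\<close>. To meet
  the assumptions of \<open>markov_overlap\<close>, \<open>U\<close> is attached to both embeddings
  \<open>VA\<close> and \<open>VC\<close>, and its adjoint to \<psi> on A and on C. The embedded
  vector does not change, and using the same unitary on A and C preserves the exchange
  symmetry.\<close>

theorem entropy_le_rel_entropy_markov:
  assumes \<psi>0: "pure_state (d * b * d) \<psi>0"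
    and eps: "cmod \<epsilon> = 1"
    and sym: "\<And>a \<beta> c. a < d \<Longrightarrow> \<beta> < b \<Longrightarrow> c < d \<Longrightarrow> \<psi>0 $ ((a * b + \<beta>) * d + c) = \<epsilon> * \<psi>0 $ ((c * b + \<beta>) * d + a)"
    and VA: "isometry_mat X d VA" and VB: "isometry_mat Y b VB" and VC: "isometry_mat Z d VC"
    and M: "markov_state X Y Z M"
  shows "ereal (vn_entropy (red_A d b d \<psi>0)) \<le> rel_entropy (proj_vec (kron (kron VA VB) VC *\<^sub>v \<psi>0)) M"
proof -
  obtain J l r W p Us Ut s t where md: "markov_data X Y Z J l r W p Us Ut s t"
    and M\<mu>: "M = markov_data.\<mu> X Y Z J l r W p Us Ut s t"
    using markov_state_data[OF M] by blast
  interpret markov_data X Y Z J l r W p Us Ut s t by (rule md)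
  let ?V = "kron (kron VA VB) VC"
  have \<psi>0c: "\<psi>0 \<in> carrier_vec (d * b * d)" using \<psi>0 unfolding pure_state_def by simp
  have Vc: "VA \<in> carrier_mat X d" "VB \<in> carrier_mat Y b" "VC \<in> carrier_mat Z d"
    using VA VB VC unfolding isometry_mat_def by auto
  have pure: "pure_state (X * Y * Z) (?V *\<^sub>v \<psi>0)"
    by (rule pure_state_isometry[OF isometry_kron[OF isometry_kron[OF VA VB] VC] \<psi>0])
  show ?thesis
  proof (cases "\<exists>y\<in>carrier_vec (X * Y * Z). ?V *\<^sub>v \<psi>0 = \<mu> *\<^sub>v y")
    case False
    then show ?thesis unfolding M\<mu> rel_entropy_pure[OF pure \<mu>_carrier \<mu>_hermitian] by simp
  next
    case True
    then obtain y where y: "y \<in> carrier_vec (X * Y * Z)" "?V *\<^sub>v \<psi>0 = \<mu> *\<^sub>v y" by auto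
    define \<omega> where "\<omega> = mat d d (\<lambda>(a, a'). \<Sum>j<J. \<Sum>k<X * l j. \<Sum>\<kappa><l j. complex_of_real (p j * s j k) *
      (cnj (P VA j $$ (k, a * l j + \<kappa>)) * P VA j $$ (k, a' * l j + \<kappa>)))"
    have \<omega>: "\<omega> \<in> carrier_mat d d" unfolding \<omega>_def by simp
    have "hermitian_mat \<omega>"
      unfolding hermitian_mat_def by (rule eq_matI) (auto simp: \<omega>_def mult_ac)
    from hermitian_spectral_decomposition[OF \<omega> this] obtain U w where uU: "unitary_mat d U"
      and \<omega>U: "\<omega> = U * diag_cmat d (\<lambda>i. complex_of_real (w i)) * mat_adjoint U" by blast
    note U = unitary_matD[OF uU]
    let ?W = "kron (kron (mat_adjoint U) (1\<^sub>m b)) (mat_adjoint U)"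
    define \<psi> where "\<psi> = ?W *\<^sub>v \<psi>0"
    have Wc: "?W \<in> carrier_mat (d * b * d) (d * b * d)" using U by simp
    have \<psi>c: "\<psi> \<in> carrier_vec (d * b * d)" unfolding \<psi>_def using Wc \<psi>0c by (rule mult_mat_vec_carrier)
    have \<psi>_index: "\<psi> $ ((a * b + \<beta>) * d + c) = (\<Sum>c'<d. cnj (U $$ (c', c)) * (\<Sum>a'<d. cnj (U $$ (a', a)) * \<psi>0 $ ((a' * b + \<beta>) * d + c')))"
      if "a < d" "\<beta> < b" "c < d" for a \<beta> c
    proof -
      have "\<psi> $ ((a * b + \<beta>) * d + c) = (\<Sum>x<d. \<Sum>y<b. \<Sum>z<d.
          mat_adjoint U $$ (a, x) * 1\<^sub>m b $$ (\<beta>, y) * mat_adjoint U $$ (c, z) * \<psi>0 $ ((x * b + y) * d + z))"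
        unfolding \<psi>_def
        using kron3_mult_vec_index[of a "mat_adjoint U" \<beta> "1\<^sub>m b" c "mat_adjoint U" \<psi>0] that \<psi>0c carrier_matD[OF U(1)]
        by simp
      also have "\<dots> = (\<Sum>x<d. \<Sum>y<b. 1\<^sub>m b $$ (\<beta>, y) * (\<Sum>z<d. mat_adjoint U $$ (a, x) * mat_adjoint U $$ (c, z) * \<psi>0 $ ((x * b + y) * d + z)))"
        by (simp only: sum_distrib_left mult_ac)
      also have "\<dots> = (\<Sum>x<d. \<Sum>z<d. mat_adjoint U $$ (a, x) * mat_adjoint U $$ (c, z) * \<psi>0 $ ((x * b + \<beta>) * d + z))"
        by (simp only: sum_one_mat that)
      also have "\<dots> = (\<Sum>z<d. \<Sum>x<d. cnj (U $$ (x, a)) * cnj (U $$ (z, c)) * \<psi>0 $ ((x * b + \<beta>) * d + z))"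
        using that U(1) by (subst sum.swap) (auto intro!: sum.cong)
      finally show ?thesis by (simp only: sum_distrib_left mult_ac)
    qed
    have VU: "isometry_mat X d (VA * U)" "isometry_mat Z d (VC * U)"
      using isometry_times[OF VA isometry_unitary_adjoint(2)[OF uU]] isometry_times[OF VC isometry_unitary_adjoint(2)[OF uU]] .
    \<comment> \<open>Rotating the embedding acts on the A index of the compressed eigenvectors
      only, so \<omega> is conjugated by \<open>U\<close> and becomes diagonal.\<close>
    have PU: "P (VA * U) j $$ (k, a * l j + \<kappa>) = (\<Sum>x<d. P VA j $$ (k, x * l j + \<kappa>) * U $$ (x, a))"
      if "j < J" "k < X * l j" "\<kappa> < l j" "a < d" for j k a \<kappa>
    proof -
      note Uj = unitary_matD(1)[OF Us[OF that(1)]]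
      have "P (VA * U) j = mat_adjoint (Us j) * (kron VA (1\<^sub>m (l j)) * kron U (1\<^sub>m (l j)))"
        unfolding P_def using Vc(1) U(1) by (simp add: kron_times)
      also have "\<dots> = P VA j * kron U (1\<^sub>m (l j))"
        unfolding P_def using Vc(1) U(1) Uj
        by (intro assoc_mult_mat[symmetric, of _ "X * l j" "X * l j" _ "d * l j" _ "d * l j"]) auto
      finally have eq: "P (VA * U) j = P VA j * kron U (1\<^sub>m (l j))" .
      have Pd: "dim_row (P VA j) = X * l j" "dim_col (P VA j) = d * l j" unfolding P_def using Vc(1) Uj by auto
      have "P (VA * U) j $$ (k, a * l j + \<kappa>) =
        (\<Sum>x<d. \<Sum>m<l j. P VA j $$ (k, x * l j + m) * kron U (1\<^sub>m (l j)) $$ (x * l j + m, a * l j + \<kappa>))"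
        unfolding eq using that U(1) Pd
        by (subst times_mat_index) (auto simp: index_pair_less sum_index_pairs)
      also have "\<dots> = (\<Sum>x<d. \<Sum>m<l j. P VA j $$ (k, x * l j + m) * (U $$ (x, a) * 1\<^sub>m (l j) $$ (m, \<kappa>)))"
      proof (intro sum.cong refl)
        fix x m assume "x \<in> {..<d}" "m \<in> {..<l j}"
        then have "kron U (1\<^sub>m (l j)) $$ (x * l j + m, a * l j + \<kappa>) = U $$ (x, a) * 1\<^sub>m (l j) $$ (m, \<kappa>)"
          using kron_pair_index[of x U m "1\<^sub>m (l j)" a \<kappa>] that carrier_matD[OF U(1)]
          by (simp del: index_one_mat(1))
        then show "P VA j $$ (k, x * l j + m) * kron U (1\<^sub>m (l j)) $$ (x * l j + m, a * l j + \<kappa>) =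
          P VA j $$ (k, x * l j + m) * (U $$ (x, a) * 1\<^sub>m (l j) $$ (m, \<kappa>))" by simp
      qed
      also have "\<dots> = (\<Sum>x<d. \<Sum>m<l j. 1\<^sub>m (l j) $$ (\<kappa>, m) * (P VA j $$ (k, x * l j + m) * U $$ (x, a)))"
        using that by (intro sum.cong refl) auto
      finally show ?thesis by (simp only: sum_one_mat that)
    qed
    have "markov_overlap X Y Z J l r W p Us Ut s t d b (VA * U) VB (VC * U) \<psi> \<epsilon> w"
    proof
      show "\<psi> $ ((a * b + \<beta>) * d + c) = \<epsilon> * \<psi> $ ((c * b + \<beta>) * d + a)" if "a < d" "\<beta> < b" "c < d" for a \<beta> c
      proof -
        have "\<psi> $ ((a * b + \<beta>) * d + c) = (\<Sum>c'<d. \<Sum>a'<d. cnj (U $$ (c', c)) * (cnj (U $$ (a', a)) * (\<epsilon> * \<psi>0 $ ((c' * b + \<beta>) * d + a'))))"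
          unfolding \<psi>_index[OF that] sum_distrib_left
          using that by (intro sum.cong refl arg_cong2[where f = "(*)"] sym) auto
        also have "\<dots> = \<epsilon> * \<psi> $ ((c * b + \<beta>) * d + a)"
          unfolding \<psi>_index[OF that(3,2,1)] sum_distrib_left by (subst sum.swap) (simp only: mult_ac)
        finally show ?thesis .
      qed
      show "(\<Sum>j<J. \<Sum>k<X * l j. \<Sum>\<kappa><l j. complex_of_real (p j * s j k) *
          (cnj (P (VA * U) j $$ (k, a * l j + \<kappa>)) * P (VA * U) j $$ (k, a' * l j + \<kappa>)))
        = (if a = a' then complex_of_real (w a) else 0)" if "a < d" "a' < d" for a a'
      proof -
        have "(\<Sum>j<J. \<Sum>k<X * l j. \<Sum>\<kappa><l j. complex_of_real (p j * s j k) *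
          (cnj (P (VA * U) j $$ (k, a * l j + \<kappa>)) * P (VA * U) j $$ (k, a' * l j + \<kappa>))) =
          (\<Sum>j<J. \<Sum>k<X * l j. \<Sum>\<kappa><l j. \<Sum>x<d. \<Sum>y<d. cnj (U $$ (x, a)) * U $$ (y, a') * (complex_of_real (p j * s j k) *
          (cnj (P VA j $$ (k, x * l j + \<kappa>)) * P VA j $$ (k, y * l j + \<kappa>))))"
        proof (intro sum.cong refl)
          fix j k \<kappa> assume "j \<in> {..<J}" "k \<in> {..<X * l j}" "\<kappa> \<in> {..<l j}"
          then have jk: "j < J" "k < X * l j" "\<kappa> < l j" by auto
          show "complex_of_real (p j * s j k) * (cnj (P (VA * U) j $$ (k, a * l j + \<kappa>)) * P (VA * U) j $$ (k, a' * l j + \<kappa>)) =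
            (\<Sum>x<d. \<Sum>y<d. cnj (U $$ (x, a)) * U $$ (y, a') * (complex_of_real (p j * s j k) *
             (cnj (P VA j $$ (k, x * l j + \<kappa>)) * P VA j $$ (k, y * l j + \<kappa>))))"
            unfolding PU[OF jk that(1)] PU[OF jk that(2)] cnj_sum sum_product
            unfolding sum_distrib_left by (intro sum.cong refl) (simp only: complex_cnj_mult mult_ac)
        qed
        also have "\<dots> = (\<Sum>x<d. \<Sum>y<d. cnj (U $$ (x, a)) * U $$ (y, a') * \<omega> $$ (x, y))"
        proof -
          have "\<omega> $$ (x, y) = (\<Sum>j<J. \<Sum>k<X * l j. \<Sum>\<kappa><l j. complex_of_real (p j * s j k) *
             (cnj (P VA j $$ (k, x * l j + \<kappa>)) * P VA j $$ (k, y * l j + \<kappa>)))" if "x < d" "y < d" for x y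
            unfolding \<omega>_def using that by simp
          then show ?thesis
            by (simp add: sum_distrib_left sum.swap[of _ "{..<d}" "{..<l _}"] sum.swap[of _ "{..<d}" "{..<X * l _}"] sum.swap[of _ "{..<d}" "{..<J}"] del: of_real_mult)
        qed
        also have "\<dots> = (mat_adjoint U * (\<omega> * U)) $$ (a, a')"
          using that U(1) \<omega> by (subst times_mat_index)
            (auto simp: times_mat_index sum_distrib_left mult_ac simp del: index_mult_mat(1) intro!: sum.cong)
        also have "mat_adjoint U * (\<omega> * U) = (mat_adjoint U * U) * diag_cmat d (\<lambda>i. complex_of_real (w i)) * (mat_adjoint U * U)"
          unfolding \<omega>U using U(1) by (simp add: assoc_mult_mat[of _ d d _ d _ d] mult_carrier_mat[of _ d d _ d])
        finally show ?thesis unfolding U(2) using that by simp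
      qed
    qed (use VU VB \<psi>c eps in auto)
    then interpret ov: markov_overlap X Y Z J l r W p Us Ut s t d b "VA * U" VB "VC * U" \<psi> \<epsilon> w .
    have V\<psi>: "ov.V *\<^sub>v \<psi> = ?V *\<^sub>v \<psi>0"
    proof -
      have "ov.V *\<^sub>v \<psi> = (ov.V * ?W) *\<^sub>v \<psi>0"
        unfolding \<psi>_def using ov.V_carrier Wc \<psi>0c by (intro assoc_mult_mat_vec[symmetric]) auto
      also have "ov.V * ?W = kron (kron (VA * U * mat_adjoint U) VB) (VC * U * mat_adjoint U)"
        unfolding ov.V_def using Vc U(1) by (simp add: kron_times)
      also have "VA * U * mat_adjoint U = VA"
        using Vc(1) U by (simp add: assoc_mult_mat[of _ X d _ d _ d])
      also have "VC * U * mat_adjoint U = VC"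
        using Vc(3) U by (simp add: assoc_mult_mat[of _ Z d _ d _ d])
      finally show ?thesis .
    qed
    note bound = ov.range_bound[OF y(1), unfolded V\<psi>, OF y(2)]
    have pureA: "pure_state (d * (b * d)) \<psi>0" using \<psi>0 by (simp add: mult.assoc)
    let ?\<rho> = "red_A d b d \<psi>0"
    have dens: "density_mat d ?\<rho>" by (rule density_red_A[OF pureA])
    then have \<rho>: "?\<rho> \<in> carrier_mat d d" "hermitian_mat ?\<rho>" unfolding density_mat_def by auto
    obtain A lam where uA: "unitary_mat d A" and \<rho>A: "?\<rho> = A * diag_cmat d (\<lambda>i. complex_of_real (lam i)) * mat_adjoint A"
      and S: "vn_entropy ?\<rho> = - (\<Sum>i<d. lam i * log2s (lam i))"
      using vn_entropy_spectral[OF \<rho>] by blast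
    note lam = density_eigenvalues[OF dens uA \<rho>A]
    have uN: "unitary_mat d (mat_adjoint U * A)" by (rule unitary_mat_times[OF unitary_adjoint[OF uU] uA])
    \<comment> \<open>The columns of \<open>A\<close> are the eigenvectors of the state on A and
      those of \<open>U\<close> the eigenvectors of \<omega>; \<open>T\<close> is doubly stochastic
      as the entrywise squared modulus of a unitary.\<close>
    define T where "T a i = (cmod ((mat_adjoint U * A) $$ (a, i)))\<^sup>2" for a i
    have T1: "(\<Sum>a<d. T a i) = 1" if "i < d" for i
    proof -
      have "complex_of_real (\<Sum>a<d. T a i) = 1"
        unfolding T_def cmod_sq_sum using unitary_columns[OF uN that that] by simp
      then show ?thesis unfolding of_real_eq_1_iff .
    qed
    have T2: "(\<Sum>i<d. T a i) = 1" if "a < d" for a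
    proof -
      have "complex_of_real (\<Sum>i<d. T a i) = 1"
        unfolding T_def cmod_sq_sum using unitary_rows[OF uN that that] by (simp add: mult.commute)
      then show ?thesis unfolding of_real_eq_1_iff .
    qed
    \<comment> \<open>This removes the rotation of C, which leaves the marginal on A
      unchanged.\<close>
    have frameU: "parseval_frame {..<d} {..<d} (\<lambda>c c'. U $$ (c', c))"
      unfolding parseval_frame_def using unitary_rows[OF uU] by auto
    have marg: "ov.marginal a = (\<Sum>i<d. lam i * T a i)" if a: "a < d" for a
    proof -
      have "ov.marginal a = (\<Sum>\<beta><b. \<Sum>c<d. (cmod (\<Sum>c'<d. cnj (U $$ (c', c)) * (\<Sum>a'<d. cnj (U $$ (a', a)) * \<psi>0 $ ((a' * b + \<beta>) * d + c'))))\<^sup>2)"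
        unfolding ov.marginal_def using a by (intro sum.cong refl) (simp add: \<psi>_index)
      also have "\<dots> = (\<Sum>\<beta><b. \<Sum>c'<d. (cmod (\<Sum>a'<d. cnj (U $$ (a', a)) * \<psi>0 $ ((a' * b + \<beta>) * d + c')))\<^sup>2)"
        by (intro sum.cong refl frame_parseval[OF frameU])
      also have "\<dots> = (\<Sum>k<b * d. (cmod (\<Sum>a'<d. cnj (U $$ (a', a)) * \<psi>0 $ (a' * (b * d) + k)))\<^sup>2)"
        unfolding sum_index_pairs by (simp add: algebra_simps)
      also have "\<dots> = (\<Sum>i<d. lam i * (cmod (\<Sum>a'<d. cnj (U $$ (a', a)) * A $$ (a', i)))\<^sup>2)"
      proof (rule weighted_square_gram)
        fix x y assume xy: "x < d" "y < d"
        show "(\<Sum>k<b * d. \<psi>0 $ (x * (b * d) + k) * cnj (\<psi>0 $ (y * (b * d) + k))) = (\<Sum>i<d. A $$ (x, i) * complex_of_real (lam i) * cnj (A $$ (y, i)))"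
          using red_A_index[of \<psi>0 d b d x y] xy \<psi>0c unitary_matD(1)[OF uA] unfolding \<rho>A
          by (simp add: mult.assoc diag_conj_index del: index_mult_mat(1))
      qed
      also have "\<dots> = (\<Sum>i<d. lam i * T a i)"
        unfolding T_def using a U(1) unitary_matD(1)[OF uA]
        by (intro sum.cong refl) (auto simp: times_mat_index simp del: index_mult_mat(1))
      finally show ?thesis .
    qed
    have "(\<Sum>a<d. ov.marginal a * log2s (w a)) \<le> (\<Sum>i<d. lam i * log2s (lam i))"
      by (rule klein_inequality[where T = T])
        (use lam ov.w_nonneg ov.w_sum T1 T2 marg bound(2) in \<open>auto simp: T_def\<close>)
    then have "vn_entropy ?\<rho> \<le> - Re (cinner (?V *\<^sub>v \<psi>0) (mat_fun log2s \<mu> *\<^sub>v (?V *\<^sub>v \<psi>0)))"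
      using bound(1) unfolding S by linarith
    then show ?thesis unfolding M\<mu> rel_entropy_pure[OF pure \<mu>_carrier \<mu>_hermitian] using True by simp
  qed
qed

section \<open>The upper bound\<close>

lemma red_AC_index:
  assumes "\<psi> \<in> carrier_vec (dA * dB * dC)" "a < dA" "c < dC" "a' < dA" "c' < dC"
  shows "red_AC dA dB dC \<psi> $$ (a * dC + c, a' * dC + c') =
    (\<Sum>\<beta><dB. \<psi> $ ((a * dB + \<beta>) * dC + c) * cnj (\<psi> $ ((a' * dB + \<beta>) * dC + c')))"
proof -
  have idx: "a * dB * dC + \<beta> * dC + c < dA * dB * dC" if "\<beta> < dB" "a < dA" "c < dC" for a \<beta> c
    using index_pair_less[OF index_pair_less[OF that(2,1)] that(3)] by (simp add: algebra_simps)
  have assoc: "a * dB * dC + \<beta> * dC + c = (a * dB + \<beta>) * dC + c" for a \<beta> c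
    by (simp add: algebra_simps)
  have "red_AC dA dB dC \<psi> $$ (a * dC + c, a' * dC + c') =
    (\<Sum>\<beta><dB. proj_vec \<psi> $$ (a * dB * dC + \<beta> * dC + c, a' * dB * dC + \<beta> * dC + c'))"
    unfolding red_AC_def ptrace_mid_def using assms by (simp add: index_pair_less index_pair_div)
  also have "\<dots> = (\<Sum>\<beta><dB. \<psi> $ (a * dB * dC + \<beta> * dC + c) * cnj (\<psi> $ (a' * dB * dC + \<beta> * dC + c')))"
    using assms idx by (intro sum.cong refl) (simp add: proj_vec_def)
  finally show ?thesis unfolding assoc .
qed

text \<open>Let \<open>g \<beta>\<close> be the defect of the claimed identity. The vector
  \<open>y\<close>, coordinate (a, c) minus \<epsilon> times coordinate (c, a), is chosen so that
  the state on AC maps it to the combination of the slices of \<psi> at fixed \<beta> with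
  coefficients \<open>cnj (g \<beta>)\<close>. This lies in the range, so it has the symmetry;
  comparing its entries at (a, c) and (c, a) shows that the squares of all defects sum to 0.\<close>

lemma exchange_symmetry:
  assumes \<psi>: "\<psi> \<in> carrier_vec (d * b * d)" and \<epsilon>: "cnj \<epsilon> = \<epsilon>"
    and range: "\<And>v a c. v \<in> mat_range (red_AC d b d \<psi>) \<Longrightarrow> a < d \<Longrightarrow> c < d \<Longrightarrow> v $ (a * d + c) = \<epsilon> * v $ (c * d + a)"
    and abc: "a < d" "\<beta> < b" "c < d"
  shows "\<psi> $ ((a * b + \<beta>) * d + c) = \<epsilon> * \<psi> $ ((c * b + \<beta>) * d + a)"
proof -
  let ?R = "red_AC d b d \<psi>"
  have R: "?R \<in> carrier_mat (d * d) (d * d)" unfolding red_AC_def ptrace_mid_def by simp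
  define y where "y = vec (d * d) (\<lambda>i. (if i = a * d + c then 1 else 0) - \<epsilon> * (if i = c * d + a then 1 else 0))"
  define g where "g \<beta> = \<psi> $ ((a * b + \<beta>) * d + c) - \<epsilon> * \<psi> $ ((c * b + \<beta>) * d + a)" for \<beta>
  note ac = index_pair_less[OF abc(1,3)] index_pair_less[OF abc(3,1)]
  have Ry: "(?R *\<^sub>v y) $ (x * d + z) = (\<Sum>\<beta><b. \<psi> $ ((x * b + \<beta>) * d + z) * cnj (g \<beta>))" if "x < d" "z < d" for x z
  proof -
    have "(?R *\<^sub>v y) $ (x * d + z) = (\<Sum>i<d * d. ?R $$ (x * d + z, i) * y $ i)"
      using R that by (subst mult_mat_vec_index) (auto simp: y_def index_pair_less)
    also have "\<dots> = (\<Sum>i<d * d. (if i = a * d + c then ?R $$ (x * d + z, i) else 0) - \<epsilon> * (if i = c * d + a then ?R $$ (x * d + z, i) else 0))"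
      by (intro sum.cong refl) (auto simp: y_def algebra_simps)
    also have "\<dots> = ?R $$ (x * d + z, a * d + c) - \<epsilon> * ?R $$ (x * d + z, c * d + a)"
      using ac by (simp add: sum_subtractf sum_distrib_left[symmetric])
    also have "\<dots> = (\<Sum>\<beta><b. \<psi> $ ((x * b + \<beta>) * d + z) * cnj (g \<beta>))"
      unfolding red_AC_index[OF \<psi> that abc(1,3)] red_AC_index[OF \<psi> that abc(3,1)] g_def
        sum_distrib_left sum_subtractf[symmetric]
      by (intro sum.cong refl) (simp add: \<epsilon> algebra_simps)
    finally show ?thesis .
  qed
  have "?R *\<^sub>v y \<in> mat_range ?R" unfolding mat_range_def using R by (auto simp: y_def)
  from range[OF this abc(1,3)] have "(\<Sum>\<beta><b. \<psi> $ ((a * b + \<beta>) * d + c) * cnj (g \<beta>)) = \<epsilon> * (\<Sum>\<beta><b. \<psi> $ ((c * b + \<beta>) * d + a) * cnj (g \<beta>))"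
    unfolding Ry[OF abc(1,3)] Ry[OF abc(3,1)] .
  moreover have "(\<Sum>\<beta><b. cnj (g \<beta>) * g \<beta>) =
      (\<Sum>\<beta><b. \<psi> $ ((a * b + \<beta>) * d + c) * cnj (g \<beta>)) - \<epsilon> * (\<Sum>\<beta><b. \<psi> $ ((c * b + \<beta>) * d + a) * cnj (g \<beta>))"
    unfolding sum_distrib_left sum_subtractf[symmetric]
    by (intro sum.cong refl) (simp add: g_def algebra_simps)
  ultimately have "(\<Sum>\<beta><b. cnj (g \<beta>) * g \<beta>) = 0" by simp
  then have "(\<Sum>\<beta><b. (cmod (g \<beta>))\<^sup>2) = 0" 
    unfolding cmod_sq_sum[symmetric] of_real_eq_0_iff .
  then have "g \<beta> = 0" using abc by (simp add: sum_nonneg_eq_0_iff)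
  then show ?thesis unfolding g_def by simp
qed

section \<open>The product of the marginals as a Markov state\<close>

text \<open>A companion of \<open>spectral_expectation\<close> for a vector given directly as a sum
  of eigenvectors, as a Schmidt decomposition provides it.\<close>

lemma expectation_eigen_sum:
  assumes M: "M \<in> carrier_mat n n" "hermitian_mat M" and \<psi>: "\<psi> \<in> carrier_vec n"
    and F: "\<And>i. i \<in> I \<Longrightarrow> F i \<in> carrier_vec n"
    and ev: "\<And>i. i \<in> I \<Longrightarrow> M *\<^sub>v F i = complex_of_real (x i) \<cdot>\<^sub>v F i"
    and sum: "\<And>a. a < n \<Longrightarrow> \<psi> $ a = (\<Sum>i\<in>I. F i $ a)"
  shows "cinner \<psi> (mat_fun f M *\<^sub>v \<psi>) = (\<Sum>i\<in>I. complex_of_real (f (x i)) * cinner \<psi> (F i))"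
proof -
  let ?F = "mat_fun f M"
  have c: "?F \<in> carrier_mat n n" by (rule mat_fun_carrier[OF M])
  have "(?F *\<^sub>v \<psi>) $ a = (\<Sum>i\<in>I. complex_of_real (f (x i)) * F i $ a)" if a: "a < n" for a
  proof -
    have "(?F *\<^sub>v \<psi>) $ a = (\<Sum>i\<in>I. \<Sum>b<n. ?F $$ (a, b) * F i $ b)"
      using c \<psi> a by (subst sum.swap, subst mult_mat_vec_index) (auto simp: sum sum_distrib_left intro!: sum.cong)
    also have "\<dots> = (\<Sum>i\<in>I. (?F *\<^sub>v F i) $ a)"
    proof (rule sum.cong[OF refl])
      fix i assume "i \<in> I"
      then show "(\<Sum>b<n. ?F $$ (a, b) * F i $ b) = (?F *\<^sub>v F i) $ a"
        using c carrier_vecD[OF F] a by (subst mult_mat_vec_index) auto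
    qed
    also have "\<dots> = (\<Sum>i\<in>I. complex_of_real (f (x i)) * F i $ a)"
    proof (rule sum.cong[OF refl])
      fix i assume i: "i \<in> I"
      show "(?F *\<^sub>v F i) $ a = complex_of_real (f (x i)) * F i $ a"
        unfolding mat_fun_eigenvector[OF M F[OF i] ev[OF i]] using F[OF i] a by simp
    qed
    finally show ?thesis .
  qed
  then have "cinner \<psi> (?F *\<^sub>v \<psi>) = (\<Sum>a<n. \<Sum>i\<in>I. complex_of_real (f (x i)) * (cnj (\<psi> $ a) * F i $ a))"
    unfolding cinner_carrier[OF \<psi>] by (intro sum.cong refl) (simp add: sum_distrib_left mult_ac del: index_mult_mat_vec)
  also have "\<dots> = (\<Sum>i\<in>I. complex_of_real (f (x i)) * cinner \<psi> (F i))"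
    unfolding cinner_carrier[OF \<psi>] by (subst sum.swap) (simp add: sum_distrib_left)
  finally show ?thesis .
qed

text \<open>A preimage is obtained by dividing each eigenvector by its eigenvalue; those with
  eigenvalue 0 contribute nothing to \<psi>.\<close>

lemma in_range_eigen_sum:
  assumes M: "M \<in> carrier_mat n n" and \<psi>: "\<psi> \<in> carrier_vec n"
    and F: "\<And>i. i \<in> I \<Longrightarrow> F i \<in> carrier_vec n"
    and ev: "\<And>i. i \<in> I \<Longrightarrow> M *\<^sub>v F i = complex_of_real (x i) \<cdot>\<^sub>v F i"
    and sum: "\<And>a. a < n \<Longrightarrow> \<psi> $ a = (\<Sum>i\<in>I. F i $ a)"
    and zero: "\<And>i a. i \<in> I \<Longrightarrow> a < n \<Longrightarrow> x i = 0 \<Longrightarrow> F i $ a = 0"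
  shows "\<exists>y\<in>carrier_vec n. \<psi> = M *\<^sub>v y"
proof
  define c where "c i = (if x i = 0 then 0 else 1 / complex_of_real (x i))" for i
  define y where "y = vec n (\<lambda>a. \<Sum>i\<in>I. c i * F i $ a)"
  show "y \<in> carrier_vec n" unfolding y_def by simp
  show "\<psi> = M *\<^sub>v y"
  proof (rule eq_vecI)
    fix a assume "a < dim_vec (M *\<^sub>v y)"
    then have a: "a < n" using M by simp
    have "(M *\<^sub>v y) $ a = (\<Sum>i\<in>I. \<Sum>b<n. c i * (M $$ (a, b) * F i $ b))"
      using M a by (subst sum.swap, subst mult_mat_vec_index) (auto simp: y_def sum_distrib_left mult_ac intro!: sum.cong)
    also have "\<dots> = (\<Sum>i\<in>I. F i $ a)"
    proof (rule sum.cong[OF refl])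
      fix i assume i: "i \<in> I"
      have "(\<Sum>b<n. M $$ (a, b) * F i $ b) = (M *\<^sub>v F i) $ a"
        using M F[OF i] a by (subst mult_mat_vec_index) auto
      also have "\<dots> = complex_of_real (x i) * F i $ a" unfolding ev[OF i] using F[OF i] a by simp
      finally show "(\<Sum>b<n. c i * (M $$ (a, b) * F i $ b)) = F i $ a"
        unfolding sum_distrib_left[symmetric] using zero[OF i a] by (simp add: c_def)
    qed
    finally show "\<psi> $ a = (M *\<^sub>v y) $ a" using sum[OF a] by simp
  qed (use M \<psi> in auto)
qed

text \<open>There is a single block in which b_L is one-dimensional and b_R is all of B. Blocks must
  have positive dimension, hence \<open>0 < b\<close>.\<close>

lemma markov_state_kron:
  assumes b: "0 < b" and \<sigma>: "density_mat dA \<sigma>" and \<tau>: "density_mat (b * dC) \<tau>"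
  shows "markov_state dA b dC (kron \<sigma> \<tau>)"
proof -
  have c: "\<sigma> \<in> carrier_mat dA dA" "\<tau> \<in> carrier_mat (b * dC) (b * dC)"
    using \<sigma> \<tau> unfolding density_mat_def by auto
  have G: "kron (kron (1\<^sub>m dA) (1\<^sub>m b)) (1\<^sub>m dC) = (1\<^sub>m (dA * b * dC) :: complex mat)" by (simp add: kron_one)
  have k: "kron \<sigma> \<tau> \<in> carrier_mat (dA * b * dC) (dA * b * dC)" using c by (intro carrier_matI) (auto simp: mult.assoc)
  have "kron \<sigma> \<tau> = mat (dA * b * dC) (dA * b * dC) (\<lambda>(i, i'). \<Sum>j<1::nat. complex_of_real 1 *
      ((kron (kron (1\<^sub>m dA) (1\<^sub>m b)) (1\<^sub>m dC) * kron \<sigma> \<tau> * mat_adjoint (kron (kron (1\<^sub>m dA) (1\<^sub>m b)) (1\<^sub>m dC))) $$ (i, i')))"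
    unfolding G
    by (rule eq_matI) (use k in \<open>auto simp: left_mult_one_mat[OF k] right_mult_one_mat[OF k] simp del: index_mult_mat(1)\<close>)
  then show ?thesis
    unfolding markov_state_def using b \<sigma> \<tau>
    by (intro exI[of _ "1::nat"] exI[of _ "\<lambda>_. 1::nat"] exI[of _ "\<lambda>_. b"] exI[of _ "\<lambda>_. 1\<^sub>m b"] exI[of _ "\<lambda>_. 1::real"]
        exI[of _ "\<lambda>_. \<sigma>"] exI[of _ "\<lambda>_. \<tau>"]) auto
qed

text \<open>Both marginals of \<psi> have the same nonzero eigenvalues, so a Schmidt vector has
  eigenvalue \<open>(lam i)\<^sup>2\<close> under their product, and its weight in \<psi> is
  \<open>lam i\<close>. The square is the origin of the factor 2.\<close>

theorem Delta_le_twice_entropy: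
  assumes \<psi>: "pure_state (d * b * d) \<psi>"
  shows "Delta d b d \<psi> \<le> ereal (2 * vn_entropy (red_A d b d \<psi>))"
proof -
  define n where "n = b * d"
  have dn: "d * b * d = d * n" unfolding n_def by (simp add: mult.assoc)
  have \<psi>n: "pure_state (d * n) \<psi>" using \<psi> unfolding dn .
  have \<psi>c: "\<psi> \<in> carrier_vec (d * n)" using \<psi>n unfolding pure_state_def by simp
  have b: "0 < b"
  proof (rule ccontr)
    assume "\<not> 0 < b"
    then show False using sum_norm_pure[OF \<psi>] by simp
  qed
  let ?\<rho> = "red_A d b d \<psi>"
  have dens: "density_mat d ?\<rho>" using density_red_A[of d b d \<psi>] \<psi>n unfolding n_def by simp
  then have \<rho>: "?\<rho> \<in> carrier_mat d d" "hermitian_mat ?\<rho>" unfolding density_mat_def by auto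
  have \<rho>_index: "?\<rho> $$ (a, a') = (\<Sum>k<n. \<psi> $ (a * n + k) * cnj (\<psi> $ (a' * n + k)))" if "a < d" "a' < d" for a a'
    using red_A_index[of \<psi> d b d a a'] \<psi>c that unfolding n_def by simp
  \<comment> \<open>The marginal of \<psi> on BC.\<close>
  define \<tau> where "\<tau> = mat n n (\<lambda>(k, k'). \<Sum>a<d. \<psi> $ (a * n + k) * cnj (\<psi> $ (a * n + k')))"
  have dens\<tau>: "density_mat n \<tau>"
  proof (rule density_mat_gram[where K = "{..<d}" and g = "\<lambda>k a. \<psi> $ (a * n + k)"])
    show "(\<Sum>k<n. \<Sum>a<d. (cmod (\<psi> $ (a * n + k)))\<^sup>2) = 1"
      using sum_norm_pure[OF \<psi>n] unfolding sum_index_pairs by (subst sum.swap) simp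
  qed (auto simp: \<tau>_def)
  then have \<tau>: "\<tau> \<in> carrier_mat n n" "hermitian_mat \<tau>" unfolding density_mat_def by auto
  let ?M = "kron ?\<rho> \<tau>"
  have M: "?M \<in> carrier_mat (d * n) (d * n)" using \<rho> \<tau> by simp
  have hM: "hermitian_mat ?M" using \<rho>(2) \<tau>(2) unfolding hermitian_mat_def by (simp add: kron_adjoint)
  obtain A lam where uA: "unitary_mat d A" and \<rho>A: "?\<rho> = A * diag_cmat d (\<lambda>i. complex_of_real (lam i)) * mat_adjoint A"
    and S: "vn_entropy ?\<rho> = - (\<Sum>i<d. lam i * log2s (lam i))"
    using vn_entropy_spectral[OF \<rho>] by blast
  note A = unitary_matD[OF uA]
  note lam = density_eigenvalues[OF dens uA \<rho>A]
  \<comment> \<open>The unnormalised Schmidt partner on BC of the i-th eigenvector of the state on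
    A; its squared norm turns out to be \<open>lam i\<close>.\<close>
  define N where "N i k = (\<Sum>a<d. cnj (A $$ (a, i)) * \<psi> $ (a * n + k))" for i k
  have frameA: "parseval_frame {..<d} {..<d} (\<lambda>i a. A $$ (a, i))"
    unfolding parseval_frame_def using unitary_rows[OF uA] by auto
  have \<psi>N: "\<psi> $ (a * n + k) = (\<Sum>i<d. A $$ (a, i) * N i k)" if "a < d" for a k
    using frame_reconstruction[OF frameA, of a "\<lambda>a. \<psi> $ (a * n + k)"] that unfolding N_def by (simp add: mult.commute)
  have \<rho>A_col: "(\<Sum>x<d. ?\<rho> $$ (a, x) * A $$ (x, i)) = complex_of_real (lam i) * A $$ (a, i)" if "a < d" "i < d" for a i
  proof -
    have "?\<rho> * A = A * diag_cmat d (\<lambda>i. complex_of_real (lam i)) * (mat_adjoint A * A)"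
      unfolding \<rho>A using A(1) by (simp add: assoc_mult_mat[of _ d d _ d _ d] mult_carrier_mat[of _ d d _ d])
    also have "\<dots> = A * diag_cmat d (\<lambda>i. complex_of_real (lam i))" unfolding A(2) using A(1) by simp
    finally have eq: "?\<rho> * A = A * diag_cmat d (\<lambda>i. complex_of_real (lam i))" .
    have "(\<Sum>x<d. ?\<rho> $$ (a, x) * A $$ (x, i)) = (?\<rho> * A) $$ (a, i)"
      using \<rho>(1) A(1) that by (subst times_mat_index) auto
    also have "\<dots> = complex_of_real (lam i) * A $$ (a, i)"
      unfolding eq using A(1) that by (simp add: times_diag_cmat_index mult.commute del: index_mult_mat(1))
    finally show ?thesis .
  qed
  have \<psi>N_ip: "(\<Sum>k<n. cnj (\<psi> $ (a * n + k)) * N i k) = complex_of_real (lam i) * cnj (A $$ (a, i))" if "a < d" "i < d" for a i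
  proof -
    have "(\<Sum>k<n. cnj (\<psi> $ (a * n + k)) * N i k) = (\<Sum>x<d. cnj (A $$ (x, i)) * (\<Sum>k<n. \<psi> $ (x * n + k) * cnj (\<psi> $ (a * n + k))))"
      unfolding N_def sum_distrib_left by (subst sum.swap) (simp add: mult_ac)
    also have "\<dots> = cnj (\<Sum>x<d. ?\<rho> $$ (a, x) * A $$ (x, i))"
      using that by (simp add: \<rho>_index mult.commute)
    finally show ?thesis unfolding \<rho>A_col[OF that] by simp
  qed
  have N_norm: "(\<Sum>k<n. (cmod (N i k))\<^sup>2) = lam i" if "i < d" for i
  proof -
    have "complex_of_real (\<Sum>k<n. (cmod (N i k))\<^sup>2) = (\<Sum>a<d. A $$ (a, i) * (\<Sum>k<n. cnj (\<psi> $ (a * n + k)) * N i k))"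
      unfolding cmod_sq_sum by (subst (1) N_def, simp add: sum_distrib_left sum_distrib_right mult_ac, subst sum.swap, rule refl)
    also have "\<dots> = (\<Sum>a<d. complex_of_real (lam i) * (cnj (A $$ (a, i)) * A $$ (a, i)))"
      using \<psi>N_ip[OF _ that] by (intro sum.cong) (auto simp: mult_ac)
    also have "\<dots> = complex_of_real (lam i)"
      using unitary_columns[OF uA that that] by (simp add: sum_distrib_left[symmetric])
    finally show ?thesis unfolding of_real_eq_iff .
  qed
  \<comment> \<open>The Schmidt term of index \<open>i\<close>, again unnormalised, so that \<psi>
    is the plain sum of the \<open>F i\<close>.\<close>
  define F where "F i = vec (d * n) (\<lambda>x. A $$ (x div n, i) * N i (x mod n))" for i
  have Fc: "F i \<in> carrier_vec (d * n)" for i unfolding F_def by simp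
  have F_index: "F i $ (a * n + k) = A $$ (a, i) * N i k" if "a < d" "k < n" for i a k
    unfolding F_def using index_pair_less[OF that] index_pair_div[OF that(2)] that(2) by simp
  have pairs: "\<exists>a k. x = a * n + k \<and> a < d \<and> k < n" if "x < d * n" for x
    using index_div_less[OF that] index_mod_less[OF that] by (intro exI[of _ "x div n"] exI[of _ "x mod n"]) simp
  have \<psi>F: "\<psi> $ x = (\<Sum>i<d. F i $ x)" if "x < d * n" for x
    using pairs[OF that] by (auto simp: \<psi>N F_index)
  have \<tau>N: "(\<Sum>y<n. \<tau> $$ (k, y) * N i y) = complex_of_real (lam i) * N i k" if "k < n" "i < d" for k i
  proof -
    have "(\<Sum>y<n. \<tau> $$ (k, y) * N i y) = (\<Sum>a<d. \<psi> $ (a * n + k) * (\<Sum>y<n. cnj (\<psi> $ (a * n + y)) * N i y))"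
      using that unfolding \<tau>_def by (simp add: sum_distrib_left sum_distrib_right mult.assoc) (rule sum.swap)
    also have "\<dots> = (\<Sum>a<d. \<psi> $ (a * n + k) * (complex_of_real (lam i) * cnj (A $$ (a, i))))"
      using \<psi>N_ip[OF _ that(2)] by (intro sum.cong) auto
    also have "\<dots> = complex_of_real (lam i) * N i k"
      unfolding N_def sum_distrib_left by (simp add: mult_ac)
    finally show ?thesis .
  qed
  have MF: "?M *\<^sub>v F i = complex_of_real ((lam i)\<^sup>2) \<cdot>\<^sub>v F i" if i: "i < d" for i
  proof (rule eq_vecI)
    fix x assume "x < dim_vec (complex_of_real ((lam i)\<^sup>2) \<cdot>\<^sub>v F i)"
    then have xn: "x < d * n" using carrier_vecD[OF Fc] by simp
    then obtain a k where x: "x = a * n + k" "a < d" "k < n" using pairs[OF xn] by (elim exE conjE)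
    have "(?M *\<^sub>v F i) $ x = (\<Sum>u<d. \<Sum>y<n. ?\<rho> $$ (a, u) * \<tau> $$ (k, y) * F i $ (u * n + y))"
      using kron_mult_vec_index[of a ?\<rho> k \<tau> "F i"] carrier_matD[OF \<rho>(1)] carrier_matD[OF \<tau>(1)] carrier_vecD[OF Fc] x by (simp del: index_mult_mat_vec)
    also have "\<dots> = (\<Sum>u<d. ?\<rho> $$ (a, u) * A $$ (u, i)) * (\<Sum>y<n. \<tau> $$ (k, y) * N i y)"
      unfolding sum_product by (intro sum.cong refl) (simp add: F_index)
    also have "\<dots> = complex_of_real ((lam i)\<^sup>2) * F i $ x"
      unfolding \<rho>A_col[OF x(2) i] \<tau>N[OF x(3) i] x(1) F_index[OF x(2,3)] by (simp add: power2_eq_square)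
    finally show "(?M *\<^sub>v F i) $ x = (complex_of_real ((lam i)\<^sup>2) \<cdot>\<^sub>v F i) $ x" using carrier_vecD[OF Fc[of i]] xn by (simp del: index_mult_mat_vec)
  qed (use M Fc[of i] in auto)
  have F_zero: "F i $ x = 0" if i: "i < d" and xn: "x < d * n" and z: "(lam i)\<^sup>2 = 0" for i x
  proof -
    obtain a k where x: "x = a * n + k" "a < d" "k < n" using pairs[OF xn] by (elim exE conjE)
    have "N i k = 0" using N_norm[OF i] z x(3) by (simp add: sum_nonneg_eq_0_iff)
    then show ?thesis unfolding x(1) F_index[OF x(2,3)] by simp
  qed
  have \<psi>F_ip: "cinner \<psi> (F i) = complex_of_real (lam i)" if i: "i < d" for i
  proof -
    have "cinner \<psi> (F i) = (\<Sum>a<d. A $$ (a, i) * (\<Sum>k<n. cnj (\<psi> $ (a * n + k)) * N i k))"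
      unfolding cinner_carrier[OF \<psi>c] sum_index_pairs by (simp add: F_index sum_distrib_left mult_ac)
    also have "\<dots> = (\<Sum>a<d. complex_of_real (lam i) * (cnj (A $$ (a, i)) * A $$ (a, i)))"
      using \<psi>N_ip[OF _ i] by (intro sum.cong) (auto simp: mult_ac)
    also have "\<dots> = complex_of_real (lam i)"
      using unitary_columns[OF uA i i] by (simp add: sum_distrib_left[symmetric])
    finally show ?thesis .
  qed
  have "cinner \<psi> (mat_fun log2s ?M *\<^sub>v \<psi>) = (\<Sum>i<d. complex_of_real (log2s ((lam i)\<^sup>2)) * cinner \<psi> (F i))"
    by (rule expectation_eigen_sum[OF M hM \<psi>c Fc]) (use MF \<psi>F in auto)
  also have "\<dots> = complex_of_real (\<Sum>i<d. 2 * (lam i * log2s (lam i)))"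
    unfolding of_real_sum
  proof (rule sum.cong[OF refl])
    fix i assume "i \<in> {..<d}"
    then have i: "i < d" by simp
    \<comment> \<open>At eigenvalue 0 both sides of the goal vanish through the factor
      \<open>lam i\<close>.\<close>
    have "log2s ((lam i)\<^sup>2) = 2 * log2s (lam i)" if "lam i \<noteq> 0"
      using that lam(1)[OF i] by (simp add: log2s_def log_nat_power)
    then show "complex_of_real (log2s ((lam i)\<^sup>2)) * cinner \<psi> (F i) = complex_of_real (2 * (lam i * log2s (lam i)))"
      unfolding \<psi>F_ip[OF i] by (cases "lam i = 0") auto
  qed
  finally have exp: "- Re (cinner \<psi> (mat_fun log2s ?M *\<^sub>v \<psi>)) = 2 * vn_entropy ?\<rho>"
    unfolding S by (simp add: sum_distrib_left)
  have ran: "\<exists>y\<in>carrier_vec (d * n). \<psi> = ?M *\<^sub>v y"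
    by (rule in_range_eigen_sum[OF M \<psi>c Fc, where I = "{..<d}" and x = "\<lambda>i. (lam i)\<^sup>2"]) (use MF \<psi>F F_zero in auto)
  have rel: "rel_entropy (proj_vec \<psi>) ?M = ereal (2 * vn_entropy ?\<rho>)"
    unfolding rel_entropy_pure[OF \<psi>n M hM] exp using ran by simp
  have V: "kron (kron (1\<^sub>m d) (1\<^sub>m b)) (1\<^sub>m d) *\<^sub>v \<psi> = \<psi>"
    using \<psi>c unfolding dn[symmetric] by (simp add: kron_one)
  have "markov_state d b d ?M" by (rule markov_state_kron[OF b dens]) (use dens\<tau> n_def in simp)
  then have "Delta d b d \<psi> \<le> rel_entropy (proj_vec (kron (kron (1\<^sub>m d) (1\<^sub>m b)) (1\<^sub>m d) *\<^sub>v \<psi>)) ?M"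
    unfolding Delta_def using isometry_one
    by (intro INF_lower2[of "(d, b, d, 1\<^sub>m d, 1\<^sub>m b, 1\<^sub>m d, ?M)"]) auto
  then show ?thesis unfolding V rel .
qed

theorem theorem5:
  fixes d dB :: nat and \<psi> :: "complex vec"
  assumes "pure_state (d * dB * d) \<psi>"
    and "(\<forall>v \<in> mat_range (red_AC d dB d \<psi>). sym_vec d v) \<or>
         (\<forall>v \<in> mat_range (red_AC d dB d \<psi>). antisym_vec d v)"
  shows "ereal (vn_entropy (red_A d dB d \<psi>)) \<le> Delta d dB d \<psi> \<and>
         Delta d dB d \<psi> \<le> ereal (2 * vn_entropy (red_A d dB d \<psi>))"
proof
  have \<psi>: "\<psi> \<in> carrier_vec (d * dB * d)" using assms(1) unfolding pure_state_def by simp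
  \<comment> \<open>The two cases are merged with \<epsilon> = 1 for the symmetric and \<epsilon> =
    -1 for the antisymmetric subspace; from here on only the modulus 1 and the reality of \<epsilon>
    are used.\<close>
  have "\<exists>\<epsilon>. cnj \<epsilon> = \<epsilon> \<and> cmod \<epsilon> = 1 \<and>
    (\<forall>v\<in>mat_range (red_AC d dB d \<psi>). \<forall>a<d. \<forall>c<d. v $ (a * d + c) = \<epsilon> * v $ (c * d + a))"
    using assms(2)
  proof
    assume "\<forall>v\<in>mat_range (red_AC d dB d \<psi>). sym_vec d v"
    then show ?thesis unfolding sym_vec_def by (intro exI[of _ 1]) auto
  next
    assume anti: "\<forall>v\<in>mat_range (red_AC d dB d \<psi>). antisym_vec d v"
    have "v $ (a * d + c) = - 1 * v $ (c * d + a)"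
      if "v \<in> mat_range (red_AC d dB d \<psi>)" "a < d" "c < d" for v a c
    proof -
      have "v $ (a * d + c) = - v $ (c * d + a)" using anti that unfolding antisym_vec_def by blast
      then show ?thesis by (simp only: mult_minus1)
    qed
    moreover have "cnj (- 1) = - 1" "cmod (- 1) = 1" by simp_all
    ultimately show ?thesis by blast
  qed
  then obtain \<epsilon> where \<epsilon>: "cnj \<epsilon> = \<epsilon>" "cmod \<epsilon> = 1"
    and range: "\<And>v a c. v \<in> mat_range (red_AC d dB d \<psi>) \<Longrightarrow> a < d \<Longrightarrow> c < d \<Longrightarrow> v $ (a * d + c) = \<epsilon> * v $ (c * d + a)"
    by blast
  note sym = exchange_symmetry[OF \<psi> \<epsilon>(1) range]
  show "ereal (vn_entropy (red_A d dB d \<psi>)) \<le> Delta d dB d \<psi>"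
    unfolding Delta_def
    using entropy_le_rel_entropy_markov[OF assms(1) \<epsilon>(2) sym] by (intro INF_greatest) auto
  show "Delta d dB d \<psi> \<le> ereal (2 * vn_entropy (red_A d dB d \<psi>))"
    by (rule Delta_le_twice_entropy[OF assms(1)])
qed

end
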